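(* Let $n\in\mathbb{N}$ and let $P_n(\theta)=a_0+a_1\cos\theta+\cdots+a_n\cos n\theta$ with $a_l\in\mathbb{R}$ ($0\le l\le n$), $P_n(0)=0$, and $P_n(\theta)\ge0$ for all $\theta\in[0,2\pi)$. Suppose in addition that $$\frac{a_0}{2}=\begin{cases}\displaystyle 2\sum_{l=0}^{[n/2]}l(l+1)a_{2l+1}+\frac12\sum_{l=1}^{[n/2]}(2l-1)(2l+1)a_{2l},& n\text{ odd},\\[2mm] \displaystyle 2\sum_{l=1}^{[n/2]}l(l-1)a_{2l-1}+\frac12\sum_{l=1}^{[n/2]}(2l-1)(2l+1)a_{2l},& n\text{ even}.\end{cases}$$ Let $Q_n(z)=b_0+b_1z+\cdots+b_nz^n$ with $b_l\in\mathbb{R}$ satisfy $|Q_n(e^{i\theta})|^2=P_n(\theta)$ for all $\theta$. Assume that $\alpha\in\ell^6$ and $(S-1)\alpha\in\ell^3$. Then $$\int_0^{2\pi}P_n(\theta)\log w(\theta)\frac{d\theta}{2\pi}>-\infty\iff Q_n(S)\alpha\in\ell^2.$$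
   Context: $\mu$ is a probability measure with infinite support on the unit circle (identified with $[0,2\pi]$ via $e^{i\theta}\mapsto\theta$), with Lebesgue decomposition $d\mu(\theta)=w(\theta)\frac{d\theta}{2\pi}+d\mu_s(\theta)$. $\Phi_k$ are its monic orthogonal polynomials, and its sequence of Verblunsky coefficients is $\alpha=(\alpha_k)_{k\ge0}$, $\alpha_k=-\overline{\Phi_{k+1}(0)}\in\mathbb{D}$. $S$ is the left shift on sequences, $(S\alpha)_k=\alpha_{k+1}$, and $Q_n(S)=\sum_l b_lS^l$. $[x]$ is the integer part. A real polynomial $Q_n$ as described exists by the Fejér–Riesz theorem. The integral is well defined in $[-\infty,\infty)$. *)

theory Defs
  imports "HOL-Probability.Probability"
begin

definition circle_borel :: "complex measure" where
  "circle_borel = restrict_space borel (sphere 0 1)"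

definition prob_on_circle :: "complex measure \<Rightarrow> bool" where
  "prob_on_circle \<mu> \<longleftrightarrow> prob_space \<mu> \<and> sets \<mu> = sets circle_borel"

definition msupport :: "complex measure \<Rightarrow> complex set" where
  "msupport \<mu> = {z \<in> space \<mu>. \<forall>U. open U \<longrightarrow> z \<in> U \<longrightarrow> emeasure \<mu> (U \<inter> space \<mu>) > 0}"

(* d\<theta> / (2 \<pi>) on [0, 2 \<pi>], as a measure on the real line *)
abbreviation angle_measure :: "real measure" where
  "angle_measure \<equiv> uniform_measure lborel {0..2*pi}"

definition circle_measure :: "complex measure" where
  "circle_measure = distr angle_measure circle_borel cis"

definition mutually_singular :: "'a measure \<Rightarrow> 'a measure \<Rightarrow> bool" where
  "mutually_singular M N \<longleftrightarrow>
     (\<exists>A \<in> sets M. A \<in> sets N \<and> emeasure M A = 0 \<and> emeasure N (space N - A) = 0)"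

(* d\<mu> = w(\<theta>) d\<theta>/(2 \<pi>) + d\<mu>s, with the density w written in the angle variable;
   only the values of w on [0, 2 \<pi>] matter. *)
definition lebesgue_decomposition ::
    "complex measure \<Rightarrow> (real \<Rightarrow> real) \<Rightarrow> complex measure \<Rightarrow> bool" where
  "lebesgue_decomposition \<mu> w \<mu>s \<longleftrightarrow>
     w \<in> borel_measurable borel \<and> (\<forall>\<theta>\<in>{0..2*pi}. 0 \<le> w \<theta>) \<and>
     sets \<mu>s = sets circle_borel \<and> mutually_singular \<mu>s circle_measure \<and>
     (\<forall>A \<in> sets circle_borel.
        emeasure \<mu> A =
          emeasure (distr (density angle_measure (\<lambda>\<theta>. ennreal (w \<theta>))) circle_borel cis) A
          + emeasure \<mu>s A)"

definition monic_orthogonal_polynomials :: "complex measure \<Rightarrow> (nat \<Rightarrow> complex poly) \<Rightarrow> bool" where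
  "monic_orthogonal_polynomials \<mu> \<Phi> \<longleftrightarrow>
     (\<forall>k. degree (\<Phi> k) = k \<and> lead_coeff (\<Phi> k) = 1) \<and>
     (\<forall>j k. j \<noteq> k \<longrightarrow> (\<integral>z. cnj (poly (\<Phi> j) z) * poly (\<Phi> k) z \<partial>\<mu>) = 0)"

definition verblunsky :: "(nat \<Rightarrow> complex poly) \<Rightarrow> nat \<Rightarrow> complex" where
  "verblunsky \<Phi> k = - cnj (poly (\<Phi> (Suc k)) 0)"

definition in_lp :: "nat \<Rightarrow> (nat \<Rightarrow> complex) \<Rightarrow> bool" where
  "in_lp p x \<longleftrightarrow> summable (\<lambda>k. norm (x k) ^ p)"

definition left_shift :: "(nat \<Rightarrow> complex) \<Rightarrow> nat \<Rightarrow> complex" where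
  "left_shift x k = x (Suc k)"

(* (\<Sum>l\<le>n. b l * S^l) x, where S is the left shift *)
definition shift_poly :: "nat \<Rightarrow> (nat \<Rightarrow> real) \<Rightarrow> (nat \<Rightarrow> complex) \<Rightarrow> nat \<Rightarrow> complex" where
  "shift_poly n b x k = (\<Sum>l\<le>n. of_real (b l) * (left_shift ^^ l) x k)"

definition cos_poly :: "nat \<Rightarrow> (nat \<Rightarrow> real) \<Rightarrow> real \<Rightarrow> real" where
  "cos_poly n a \<theta> = (\<Sum>l\<le>n. a l * cos (real l * \<theta>))"

(* log with log 0 = -\<infinity>; the library's ln has ln 0 = 0. Used only for x \<ge> 0. *)
definition ext_log :: "real \<Rightarrow> ereal" where
  "ext_log x = (if x > 0 then ereal (ln x) else -\<infinity>)"

(* Integral of the positive part minus integral of the negative part (e2ennreal truncates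
   negative values to 0). The integral is well defined unless both parts are infinite;
   ereal subtraction then gives \<infinity> - \<infinity> = \<infinity>. For P log w with P \<ge> 0 bounded and w
   integrable, the positive part is finite, since log w \<le> w; and where P vanishes the
   integrand is 0, since 0 * (-\<infinity>) = 0 in ereal. *)
definition ext_integral :: "'a measure \<Rightarrow> ('a \<Rightarrow> ereal) \<Rightarrow> ereal" where
  "ext_integral M f =
     enn2ereal (\<integral>\<^sup>+x. e2ennreal (f x) \<partial>M) - enn2ereal (\<integral>\<^sup>+x. e2ennreal (- f x) \<partial>M)"

end

theory Submission
  imports Defs "HOL-Complex_Analysis.Complex_Analysis"
begin

text \<open>
  Let \<open>\<Psi>\<^sub>N\<close> be the reversed polynomials and \<open>h\<^sub>N = \<parallel>\<Phi>\<^sub>N\<parallel>\<^sup>2 = \<Prod>k<N. 1 - \<bar>\<alpha>\<^sub>k\<bar>\<^sup>2\<close>. The entropy of the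
  Bernstein-Szego weight \<open>w\<^sub>N = h\<^sub>N / \<bar>\<Phi>\<^sub>N\<bar>\<^sup>2\<close>, namely the integral of \<open>- P log w\<^sub>N\<close>, is the link between the
  two sides of the equivalence.

  It is bounded in \<open>N\<close> iff \<open>P log w\<close> is integrable. If \<open>P log w\<close> is integrable, then
  \<open>log x \<le> x\<close> for \<open>x = w / w\<^sub>N\<close> bounds the entropy, since \<open>w / w\<^sub>N\<close> has integral at most 1. Conversely,
  \<open>log x \<le> x - 1\<close> for \<open>x = g w\<^sub>N\<close>, where \<open>g\<close> is a positive trigonometric polynomial, bounds the
  integral of \<open>P log g\<close> by a constant plus the integral of \<open>P g\<close> against \<open>\<mu>\<close>, because \<open>w\<^sub>N\<close> has
  the same moments as \<open>\<mu>\<close> up to order \<open>N\<close>. By approximation this holds for bounded Borel functions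
  \<open>g \<ge> 1\<close>, and one takes for \<open>g\<close> the function \<open>1 / w\<close>, truncated, on a set that carries no singular mass.

  On the other hand \<open>\<Psi>\<^sub>N\<close> is the product over \<open>k < N\<close> of \<open>1 - \<alpha>\<^sub>k z b\<^sub>k\<close> with \<open>b\<^sub>k = \<Phi>\<^sub>k / \<Psi>\<^sub>k\<close>, so the entropy
  is a sum over \<open>k\<close> of Taylor coefficients of \<open>log (1 - \<alpha>\<^sub>k z b\<^sub>k)\<close>. Expanding the Riccati equation of \<open>b\<^sub>k\<close> in
  the size of \<open>\<alpha>\<close>, the quadratic terms add up to \<open>\<bar>Q(S)\<alpha>\<bar>\<^sup>2\<close>, the quartic ones to a multiple of
  \<open>a\<^sub>0 / 2 - (\<Sum>l. (l\<^sup>2 - 1) / 2 * a\<^sub>l) = 0\<close>, up to telescoping terms, and the remaining ones are absolutely summable.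
\<close>

section \<open>Sequences with equal partial sums up to a bounded error\<close>

text \<open>Increments of \<alpha> have weight 2 against weight 1 for \<alpha> itself, so moving one
  index in a quartic monomial leaves an error of weight 5, while the hypotheses make only weight 6
  summable. This is why sequences are compared modulo bounded partial sums: after a symmetrisation
  the first-order errors telescope and the second-order ones have weight 6. The real part of any
  quartic monomial with two conjugated factors then counts as \<open>norm (\<alpha> k) ^ 4\<close>,
  and the proof becomes a count of monomials. In coefficient l of log (1 - \<alpha>_k z b_k) the
  cubic corrections of b_k give l (l - 1) / 2 of them and the square term of the logarithm gives (l
  - 1) / 2, together (l^2 - 1) / 2; the a_0 / 2 is the quartic term of - log (1 - |\<alpha>_k|^2).
  The odd and even formulas of the theorem express that these two cancel. In the measure-theoretic
  half, w_N is tied to \<mu> by moments only, so log w_N is not compared with log w pointwise in the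
  limit; the test functions g replace such a comparison.\<close>

definition bdd_equiv :: "(nat \<Rightarrow> real) \<Rightarrow> (nat \<Rightarrow> real) \<Rightarrow> bool" (infix "\<simeq>" 50) where
  "x \<simeq> y \<longleftrightarrow> Bseq (\<lambda>N. \<Sum>k<N. x k - y k)"

lemma bdd_equiv_refl [simp]: "x \<simeq> x"
  by (simp add: bdd_equiv_def)

lemma bdd_equiv_sym: "x \<simeq> y \<Longrightarrow> y \<simeq> x"
  using Bseq_minus_iff[of "\<lambda>N. \<Sum>k<N. x k - y k"]
  by (simp add: bdd_equiv_def sum_negf[symmetric])

lemma Bseq_add_fun:
  fixes f g :: "nat \<Rightarrow> 'a::real_normed_vector"
  assumes "Bseq f" "Bseq g" shows "Bseq (\<lambda>n. f n + g n)"
proof -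
  obtain C D where "\<And>n. norm (f n) \<le> C" "\<And>n. norm (g n) \<le> D"
    using assms by (auto simp: Bseq_def)
  then show ?thesis
    by (intro BseqI'[of _ "C + D"]) (meson add_mono norm_triangle_ineq order_trans)
qed

lemma bdd_equiv_add:
  assumes "x \<simeq> y" "x' \<simeq> y'" shows "(\<lambda>k. x k + x' k) \<simeq> (\<lambda>k. y k + y' k)"
  using Bseq_add_fun[OF assms[unfolded bdd_equiv_def]]
  by (simp add: bdd_equiv_def sum.distrib[symmetric] algebra_simps)

lemma bdd_equiv_cmult:
  assumes "x \<simeq> y" shows "(\<lambda>k. c * x k) \<simeq> (\<lambda>k. c * y k)"
proof -
  have "Bseq (\<lambda>N. c * (\<Sum>k<N. x k - y k))"
    using assms by (intro Bseq_mult) (simp_all add: bdd_equiv_def)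
  then show ?thesis
    by (simp add: bdd_equiv_def sum_distrib_left right_diff_distrib)
qed

lemma bdd_equiv_trans [trans]:
  assumes "x \<simeq> y" "y \<simeq> z" shows "x \<simeq> z"
  using Bseq_add_fun[OF assms[unfolded bdd_equiv_def]]
  by (simp add: bdd_equiv_def sum.distrib[symmetric])

lemma bdd_equiv_diff:
  assumes "x \<simeq> y" "x' \<simeq> y'" shows "(\<lambda>k. x k - x' k) \<simeq> (\<lambda>k. y k - y' k)"
  using bdd_equiv_add[OF assms(1) bdd_equiv_cmult[OF assms(2), of "-1"]] by simp

lemma bdd_equiv_sum:
  assumes "\<And>i. i \<in> A \<Longrightarrow> x i \<simeq> y i"
  shows "(\<lambda>k. \<Sum>i\<in>A. x i k) \<simeq> (\<lambda>k. \<Sum>i\<in>A. y i k)"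
  using assms by (induction A rule: infinite_finite_induct) (auto intro: bdd_equiv_add)

lemma bdd_equiv_summable:
  assumes "summable (\<lambda>k. x k - y k)" shows "x \<simeq> y"
  using assms unfolding bdd_equiv_def summable_iff_convergent by (rule convergent_imp_Bseq)

lemma bdd_equiv_eventually:
  assumes "\<forall>\<^sub>F k in sequentially. x k = y k" shows "x \<simeq> y"
proof (rule bdd_equiv_summable)
  have "\<forall>\<^sub>F k in sequentially. x k - y k = 0"
    using assms by eventually_elim simp
  then show "summable (\<lambda>k. x k - y k)"
    using summable_cong[of "\<lambda>k. x k - y k" "\<lambda>k. 0"] by simp
qed

text \<open>Successive shifts differ by a telescoping sum, so each partial sum changes by the
  boundary terms \<open>x 0\<close> and \<open>x (N - Suc s)\<close> only. Truncated subtraction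
  makes \<open>x (k - s)\<close> total, reading \<open>x 0\<close> for k \<le> s.\<close>

lemma bdd_equiv_shift:
  assumes "Bseq x" shows "(\<lambda>k. x (k - s)) \<simeq> x"
proof (induction s)
  case (Suc s)
  have *: "(\<Sum>k<N. x (k - Suc s) - x (k - s)) = x 0 - x (N - Suc s)" for N
    by (induction N) (auto simp: Suc_diff_le)
  obtain C where "\<And>k. norm (x k) \<le> C" using assms by (auto simp: Bseq_def)
  then have "norm (x 0 - x (N - Suc s)) \<le> C + C" for N
    by (intro order_trans[OF norm_triangle_ineq4] add_mono)
  then have "(\<lambda>k. x (k - Suc s)) \<simeq> (\<lambda>k. x (k - s))"
    unfolding bdd_equiv_def * by (intro BseqI') auto
  from this Suc show ?case by (rule bdd_equiv_trans)
qed simp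

text \<open>For nonnegative terms an upper bound on the partial sums already is summability. This is
  the passage between an entropy bounded from above and membership in l^2.\<close>

lemma bdd_equiv_summable_iff:
  assumes "x \<simeq> y" "\<And>k. y k \<ge> 0"
  shows "summable y \<longleftrightarrow> (\<exists>K. \<forall>N. (\<Sum>k<N. x k) \<le> K)"
proof
  obtain C where C: "\<And>N. norm ((\<Sum>k<N. x k) - (\<Sum>k<N. y k)) \<le> C"
    using assms(1) by (auto simp: bdd_equiv_def Bseq_def sum_subtractf)
  { assume "summable y"
    then have "(\<Sum>k<N. x k) \<le> suminf y + C" for N
      using C[of N] sum_le_suminf[of y "{..<N}"] assms(2) by auto
    then show "\<exists>K. \<forall>N. (\<Sum>k<N. x k) \<le> K" by blast }
  { assume "\<exists>K. \<forall>N. (\<Sum>k<N. x k) \<le> K"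
    then obtain K where "\<And>N. (\<Sum>k<N. x k) \<le> K" by blast
    then have "(\<Sum>k<N. y k) \<le> K + C" for N
      using C[of N] by (smt (verit) real_norm_def)
    then have "(\<Sum>k\<le>N. y k) \<le> K + C" for N
      unfolding lessThan_Suc_atMost[symmetric] .
    then show "summable y"
      by (intro bounded_imp_summable[of y "K + C"] assms(2)) }
qed

text \<open>With arguments that differ by \<open>O(e\<^sup>2)\<close>, the last term below is \<open>O(e\<^sup>6)\<close>; the first-order
  increments of a quartic monomial thus only contribute telescoping terms.\<close>

lemma Re_quartic:
  "2 * Re (p * q * cnj r * cnj t) = (norm p)\<^sup>2 * (norm q)\<^sup>2 + (norm r)\<^sup>2 * (norm t)\<^sup>2 - (norm (p * q - r * t))\<^sup>2"
  unfolding cmod_power2 by (simp add: algebra_simps power2_eq_square)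

text \<open>The sequence \<open>e\<close> dominates \<open>\<alpha>\<close> with weight 1 and its increments with weight 2; terms of
  total weight 6 are then summable.\<close>

locale slowly_varying =
  fixes \<alpha> :: "nat \<Rightarrow> complex" and e :: "nat \<Rightarrow> real"
  assumes norm_le: "norm (\<alpha> k) \<le> e k"
    and diff_le: "norm (\<alpha> (Suc k) - \<alpha> k) \<le> e (Suc k) ^ 2"
    and half_le: "e k \<le> 2 * e (Suc k)"
    and summable_e: "summable (\<lambda>k. e k ^ 6)"
begin

lemma e_nonneg: "e k \<ge> 0"
  using norm_le[of k] norm_ge_zero order_trans by blast

lemma e_tendsto: "e \<longlonglongrightarrow> 0"
proof -
  have "(\<lambda>k. root 6 (e k ^ 6)) \<longlonglongrightarrow> root 6 0"
    by (intro tendsto_real_root summable_LIMSEQ_zero summable_e)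
  then show ?thesis by (simp add: real_root_power_cancel e_nonneg)
qed

text \<open>Landau's O(e^p). The bound is only eventual because the recursions used below may fail
  at the first few indices, where \<open>k - s\<close> is truncated.\<close>

definition ord :: "nat \<Rightarrow> (nat \<Rightarrow> 'b::real_normed_vector) \<Rightarrow> bool" where
  "ord p f \<longleftrightarrow> (\<exists>C\<ge>0. \<forall>\<^sub>F k in sequentially. norm (f k) \<le> C * e k ^ p)"

lemma ord_add: assumes "ord p f" "ord p g" shows "ord p (\<lambda>k. f k + g k)"
proof -
  obtain C D where "C \<ge> 0" "D \<ge> 0" and ev: "\<forall>\<^sub>F k in sequentially. norm (f k) \<le> C * e k ^ p"
    "\<forall>\<^sub>F k in sequentially. norm (g k) \<le> D * e k ^ p"
    using assms by (auto simp: ord_def)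
  from ev have "\<forall>\<^sub>F k in sequentially. norm (f k + g k) \<le> (C + D) * e k ^ p"
    by eventually_elim (smt (verit) norm_triangle_ineq distrib_right)
  with \<open>C \<ge> 0\<close> \<open>D \<ge> 0\<close> show ?thesis unfolding ord_def by (intro exI[of _ "C + D"]) auto
qed

lemma ord_minus: "ord p f \<Longrightarrow> ord p (\<lambda>k. - f k)"
  by (simp add: ord_def)

lemma ord_diff: "ord p f \<Longrightarrow> ord p g \<Longrightarrow> ord p (\<lambda>k. f k - g k)"
  using ord_add[of p f "\<lambda>k. - g k"] ord_minus[of p g] by simp

lemma ord_zero [simp]: "ord p (\<lambda>k. 0)"
  by (auto simp: ord_def e_nonneg intro!: exI[of _ 0])

lemma ord_sum: "(\<And>i. i \<in> A \<Longrightarrow> ord p (f i)) \<Longrightarrow> ord p (\<lambda>k. \<Sum>i\<in>A. f i k)"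
  by (induction A rule: infinite_finite_induct) (auto intro: ord_add)

lemma ord_mult:
  fixes f g :: "nat \<Rightarrow> 'b::real_normed_algebra"
  assumes "ord p f" "ord q g" shows "ord (p + q) (\<lambda>k. f k * g k)"
proof -
  obtain C D where "C \<ge> 0" "D \<ge> 0" and ev: "\<forall>\<^sub>F k in sequentially. norm (f k) \<le> C * e k ^ p"
    "\<forall>\<^sub>F k in sequentially. norm (g k) \<le> D * e k ^ q"
    using assms by (auto simp: ord_def)
  from ev have "\<forall>\<^sub>F k in sequentially. norm (f k * g k) \<le> (C * D) * e k ^ (p + q)"
  proof eventually_elim
    case (elim k)
    have "norm (f k * g k) \<le> norm (f k) * norm (g k)" by (rule norm_mult_ineq)
    also have "\<dots> \<le> (C * e k ^ p) * (D * e k ^ q)"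
      using elim \<open>C \<ge> 0\<close> by (intro mult_mono) (auto simp: e_nonneg)
    finally show ?case by (simp add: power_add mult_ac)
  qed
  with \<open>C \<ge> 0\<close> \<open>D \<ge> 0\<close> show ?thesis unfolding ord_def by (intro exI[of _ "C * D"]) auto
qed

lemma ord_mult':
  fixes f g :: "nat \<Rightarrow> 'b::real_normed_algebra"
  assumes "ord p f" "ord q g" "p + q = r" shows "ord r (\<lambda>k. f k * g k)"
  using ord_mult[OF assms(1,2)] assms(3) by simp

lemma ord_mono: assumes "ord q f" "p \<le> q" shows "ord p f"
proof -
  obtain C where C: "C \<ge> 0" and ev: "\<forall>\<^sub>F k in sequentially. norm (f k) \<le> C * e k ^ q"
    using assms by (auto simp: ord_def)
  have "\<forall>\<^sub>F k in sequentially. e k < 1" using e_tendsto by (rule order_tendstoD) simp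
  with ev have "\<forall>\<^sub>F k in sequentially. norm (f k) \<le> C * e k ^ p"
    by eventually_elim
      (meson C assms(2) e_nonneg less_imp_le mult_left_mono order_trans power_decreasing)
  with C show ?thesis by (auto simp: ord_def)
qed

lemma ord_const_mult:
  fixes f :: "nat \<Rightarrow> 'b::real_normed_algebra"
  shows "ord p f \<Longrightarrow> ord p (\<lambda>k. c * f k)"
proof -
  assume "ord p f"
  then obtain C where C: "C \<ge> 0" and ev: "\<forall>\<^sub>F k in sequentially. norm (f k) \<le> C * e k ^ p"
    by (auto simp: ord_def)
  from ev have "\<forall>\<^sub>F k in sequentially. norm (c * f k) \<le> (norm c * C) * e k ^ p"
    by eventually_elim
      (metis mult.assoc mult_left_mono norm_ge_zero norm_mult_ineq order_trans)
  with C show ?thesis unfolding ord_def by (intro exI[of _ "norm c * C"]) auto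
qed

lemma ord_cong:
  assumes "\<forall>\<^sub>F k in sequentially. f k = g k" "ord p g" shows "ord p f"
proof -
  obtain C where C: "C \<ge> 0" and ev: "\<forall>\<^sub>F k in sequentially. norm (g k) \<le> C * e k ^ p"
    using assms by (auto simp: ord_def)
  from ev assms(1) have "\<forall>\<^sub>F k in sequentially. norm (f k) \<le> C * e k ^ p"
    by eventually_elim simp
  with C show ?thesis by (auto simp: ord_def)
qed

lemma ord_norm_le:
  assumes "\<And>k. norm (f k) \<le> norm (g k)" "ord p g" shows "ord p f"
  using assms(2) unfolding ord_def
  by (elim exE conjE, intro exI conjI) (auto elim!: eventually_mono intro: order_trans[OF assms(1)])

lemma ord_Re: "ord p f \<Longrightarrow> ord p (\<lambda>k. Re (f k))"
  by (erule ord_norm_le[rotated]) (simp add: abs_Re_le_cmod)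

lemma ord_cnj: "ord p f \<Longrightarrow> ord p (\<lambda>k. cnj (f k))"
  by (erule ord_norm_le[rotated]) simp

text \<open>This is the purpose of \<open>half_le\<close>: one step back multiplies the constant by
  \<open>2 ^ p\<close> and keeps the order.\<close>

lemma ord_shift: "ord p f \<Longrightarrow> ord p (\<lambda>k. f (k - s))"
proof (induction s)
  case (Suc s)
  then obtain C where C: "C \<ge> 0" and ev: "\<forall>\<^sub>F k in sequentially. norm (f (k - s)) \<le> C * e k ^ p"
    by (auto simp: ord_def)
  have "\<forall>\<^sub>F k in sequentially. norm (f (k - Suc s)) \<le> (C * 2 ^ p) * e k ^ p"
  proof (subst eventually_sequentially_Suc[symmetric], use ev in eventually_elim)
    case (elim k)
    have "norm (f (Suc k - Suc s)) \<le> C * e k ^ p" using elim by simp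
    also have "\<dots> \<le> C * (2 * e (Suc k)) ^ p"
      using C by (intro mult_left_mono power_mono half_le e_nonneg)
    finally show ?case by (simp add: power_mult_distrib)
  qed
  with C show ?case unfolding ord_def by (intro exI[of _ "C * 2 ^ p"]) auto
qed simp

lemma bdd_equiv_ord: assumes "ord 6 (\<lambda>k. x k - y k)" shows "x \<simeq> y"
proof (rule bdd_equiv_summable)
  obtain C where "\<forall>\<^sub>F k in sequentially. norm (x k - y k) \<le> C * e k ^ 6"
    using assms by (auto simp: ord_def)
  then show "summable (\<lambda>k. x k - y k)"
    by (rule summable_comparison_test_ev) (intro summable_mult summable_e)
qed

lemma ord_alpha: "ord 1 (\<lambda>k. \<alpha> (k - s))"
  by (rule ord_shift, unfold ord_def, rule exI[of _ 1]) (simp add: norm_le)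

lemma ord_alpha_diff0: "ord 2 (\<lambda>k. \<alpha> (k - s) - \<alpha> k)"
proof (induction s)
  case (Suc s)
  have "ord 2 (\<lambda>k. \<alpha> k - \<alpha> (k - 1))"
    unfolding ord_def
  proof (intro exI[of _ 1] conjI)
    show "\<forall>\<^sub>F k in sequentially. norm (\<alpha> k - \<alpha> (k - 1)) \<le> 1 * e k ^ 2"
      by (subst eventually_sequentially_Suc[symmetric]) (simp add: diff_le)
  qed simp
  from ord_shift[OF this, of s] Suc show ?case
    using ord_diff[of 2 "\<lambda>k. \<alpha> (k - s) - \<alpha> k" "\<lambda>k. \<alpha> (k - s) - \<alpha> (k - s - 1)"]
    by simp
qed simp

lemma ord_alpha_diff: "ord 2 (\<lambda>k. \<alpha> (k - s) - \<alpha> (k - t))"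
  using ord_diff[OF ord_alpha_diff0[of s] ord_alpha_diff0[of t]] by simp

lemma Bseq_ord: assumes "ord p x" shows "Bseq x"
proof -
  obtain C where "\<forall>\<^sub>F k in sequentially. norm (x k) \<le> C * e k ^ p"
    using assms by (auto simp: ord_def)
  moreover have "Bseq (\<lambda>k. C * e k ^ p)"
    by (rule convergent_imp_Bseq, rule convergentI) (rule tendsto_mult_left, rule tendsto_power, rule e_tendsto)
  ultimately show ?thesis
    by (intro Bseq_eventually_mono[of x "\<lambda>k. C * e k ^ p"])
      (auto elim!: eventually_mono intro: order_trans[OF _ abs_ge_self])
qed

text \<open>The identity |p|^2 - |q|^2 = Re ((p - q) cnj (p + q)) combines the weight 2 of an
  increment with the weight 1 of \<alpha>.\<close>

lemma norm_square_diff_ord: "ord 3 (\<lambda>k. (norm (\<alpha> (k - s)))\<^sup>2 - (norm (\<alpha> (k - t)))\<^sup>2)"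
proof -
  have eq: "(norm p)\<^sup>2 - (norm q)\<^sup>2 = Re ((p - q) * cnj (p + q))" for p q :: complex
    unfolding cmod_power2 by (simp add: algebra_simps power2_eq_square)
  have "ord (2 + 1) (\<lambda>k. (\<alpha> (k - s) - \<alpha> (k - t)) * cnj (\<alpha> (k - s) + \<alpha> (k - t)))"
    by (intro ord_mult ord_alpha_diff ord_cnj ord_add ord_alpha)
  from ord_Re[OF this] show ?thesis by (simp add: eq)
qed

text \<open>Replacing the indices one by one would leave errors of weight 5. Instead
  \<open>Re_quartic\<close> expresses the monomial through squared moduli, and x^2 y^2 = (x^4 + y^4)
  / 2 - (x^2 - y^2)^2 / 2 separates these; both remainders are squares of quantities of weight 3.
  What is left are shifts of \<open>norm (\<alpha> k) ^ 4\<close>, which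
  \<open>bdd_equiv_shift\<close> identifies.\<close>

lemma quartic_equiv:
  "(\<lambda>k. Re (\<alpha> (k - a) * \<alpha> (k - b) * cnj (\<alpha> (k - c)) * cnj (\<alpha> (k - d)))) \<simeq> (\<lambda>k. norm (\<alpha> k) ^ 4)"
proof -
  have B: "Bseq (\<lambda>k. norm (\<alpha> k) ^ 4)"
  proof -
    have "ord 1 (\<lambda>k. norm (\<alpha> k))" using ord_alpha[of 0] by (simp add: ord_def)
    from ord_mult[OF ord_mult[OF this this] ord_mult[OF this this]] show ?thesis
      by (intro Bseq_ord[of 4]) (simp add: eval_nat_numeral mult.assoc)
  qed
  have N: "(\<lambda>k. norm (\<alpha> (k - s)) ^ 4) \<simeq> (\<lambda>k. norm (\<alpha> k) ^ 4)" for s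
    using bdd_equiv_shift[OF B] .
  have two: "(\<lambda>k. (norm (\<alpha> (k - s)))\<^sup>2 * (norm (\<alpha> (k - t)))\<^sup>2) \<simeq> (\<lambda>k. norm (\<alpha> k) ^ 4)" for s t
  proof -
    have "ord (3 + 3) (\<lambda>k. ((norm (\<alpha> (k - s)))\<^sup>2 - (norm (\<alpha> (k - t)))\<^sup>2) * ((norm (\<alpha> (k - s)))\<^sup>2 - (norm (\<alpha> (k - t)))\<^sup>2))"
      by (intro ord_mult norm_square_diff_ord)
    from ord_const_mult[OF this, of "- (1/2)"]
    have "(\<lambda>k. (norm (\<alpha> (k - s)))\<^sup>2 * (norm (\<alpha> (k - t)))\<^sup>2) \<simeq>
        (\<lambda>k. 1/2 * norm (\<alpha> (k - s)) ^ 4 + 1/2 * norm (\<alpha> (k - t)) ^ 4)"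
    proof (intro bdd_equiv_ord, goal_cases)
      case 1
      have *: "x\<^sup>2 * y\<^sup>2 - (1/2 * x ^ 4 + 1/2 * y ^ 4) = - (1/2) * ((x\<^sup>2 - y\<^sup>2) * (x\<^sup>2 - y\<^sup>2))" for x y :: real
        by algebra
      show ?case using 1 unfolding * by simp
    qed
    also have "\<dots> \<simeq> (\<lambda>k. 1/2 * norm (\<alpha> k) ^ 4 + 1/2 * norm (\<alpha> k) ^ 4)"
      by (intro bdd_equiv_add bdd_equiv_cmult N)
    finally show ?thesis by simp
  qed
  have "ord 3 (\<lambda>k. \<alpha> (k - a) * \<alpha> (k - b) - \<alpha> (k - c) * \<alpha> (k - d))"
  proof -
    have "ord 3 (\<lambda>k. (\<alpha> (k - a) - \<alpha> (k - c)) * \<alpha> (k - b))"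
      "ord 3 (\<lambda>k. \<alpha> (k - c) * (\<alpha> (k - b) - \<alpha> (k - d)))"
      by (rule ord_mult'[OF ord_alpha_diff ord_alpha], simp,
          rule ord_mult'[OF ord_alpha ord_alpha_diff], simp)
    from ord_add[OF this] show ?thesis by (simp add: algebra_simps)
  qed
  then have "ord 3 (\<lambda>k. norm (\<alpha> (k - a) * \<alpha> (k - b) - \<alpha> (k - c) * \<alpha> (k - d)))"
    by (simp add: ord_def)
  from ord_mult[OF this this]
  have "ord 6 (\<lambda>k. (norm (\<alpha> (k - a) * \<alpha> (k - b) - \<alpha> (k - c) * \<alpha> (k - d)))\<^sup>2)"
    by (simp add: power2_eq_square)
  from ord_const_mult[OF this, of "- (1/2)"]
  have "(\<lambda>k. Re (\<alpha> (k - a) * \<alpha> (k - b) * cnj (\<alpha> (k - c)) * cnj (\<alpha> (k - d)))) \<simeq>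
     (\<lambda>k. 1/2 * ((norm (\<alpha> (k - a)))\<^sup>2 * (norm (\<alpha> (k - b)))\<^sup>2) + 1/2 * ((norm (\<alpha> (k - c)))\<^sup>2 * (norm (\<alpha> (k - d)))\<^sup>2))"
  proof (intro bdd_equiv_ord, goal_cases)
    case 1
    have *: "Re (p * q * cnj r * cnj t) - (1/2 * ((norm p)\<^sup>2 * (norm q)\<^sup>2) + 1/2 * ((norm r)\<^sup>2 * (norm t)\<^sup>2))
      = - (1/2) * (norm (p * q - r * t))\<^sup>2" for p q r t
      using Re_quartic[of p q r t] by linarith
    show ?case using 1 unfolding * .
  qed
  also have "\<dots> \<simeq> (\<lambda>k. 1/2 * norm (\<alpha> k) ^ 4 + 1/2 * norm (\<alpha> k) ^ 4)"
    by (intro bdd_equiv_add bdd_equiv_cmult two)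
  finally show ?thesis by simp
qed

end

section \<open>Riccati recursion for Taylor coefficients, and the logarithm expanded up to weight
  6\<close>

locale schur_riccati = slowly_varying +
  fixes b f :: "nat \<Rightarrow> complex fps"
  assumes riccati: "b (Suc k) = fps_X * b k - fps_const (cnj (\<alpha> k)) + fps_const (\<alpha> k) * fps_X * b k * b (Suc k)"
    and log_ode: "fps_deriv (f k) = - fps_deriv (fps_const (\<alpha> k) * fps_X * b k)
                    + fps_const (\<alpha> k) * fps_X * b k * fps_deriv (f k)"
begin

lemma b_0: "fps_nth (b (Suc k)) 0 = - cnj (\<alpha> k)"
  by (subst riccati) (simp add: mult.assoc)

lemma b_Suc: "fps_nth (b (Suc k)) (Suc m) = fps_nth (b k) m
    + \<alpha> k * (\<Sum>i\<le>m. fps_nth (b k) i * fps_nth (b (Suc k)) (m - i))"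
  by (subst riccati) (simp add: mult.assoc, simp add: fps_mult_nth atLeast0AtMost)

lemma b_0': "k \<ge> 1 \<Longrightarrow> fps_nth (b k) 0 = - cnj (\<alpha> (k - 1))"
  using b_0[of "k - 1"] by simp

lemma b_Suc': "k \<ge> 1 \<Longrightarrow> fps_nth (b k) (Suc m) = fps_nth (b (k - 1)) m
    + \<alpha> (k - 1) * (\<Sum>i\<le>m. fps_nth (b (k - 1)) i * fps_nth (b k) (m - i))"
  using b_Suc[of "k - 1"] by simp

text \<open>Coefficient \<open>Suc m\<close> depends only on coefficients up to m of both
  \<open>b (k - 1)\<close> and \<open>b k\<close>, so strong induction on m, for all k at once,
  closes. The nonlinear term has weight 3.\<close>

lemma ord_b: "ord 1 (\<lambda>k. fps_nth (b (k - s)) m)"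
proof -
  have "ord 1 (\<lambda>k. fps_nth (b k) m)"
  proof (induction m rule: less_induct)
    case (less m)
    show ?case
    proof (cases m)
      case 0
      show ?thesis unfolding 0
        by (rule ord_cong[OF _ ord_minus[OF ord_cnj[OF ord_alpha[of 1]]]])
          (auto intro!: eventually_sequentiallyI[of 1] simp: b_0')
    next
      case (Suc m')
      have "ord 1 (\<lambda>k. fps_nth (b (k - 1)) m'
        + \<alpha> (k - 1) * (\<Sum>i\<le>m'. fps_nth (b (k - 1)) i * fps_nth (b k) (m' - i)))"
      proof (intro ord_add)
        show "ord 1 (\<lambda>k. fps_nth (b (k - 1)) m')"
          using less[of m'] Suc by (intro ord_shift[of 1 "\<lambda>k. fps_nth (b k) m'"]) simp
        have "ord 2 (\<lambda>k. fps_nth (b (k - 1)) i * fps_nth (b k) (m' - i))" if "i \<le> m'" for i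
          using less[of i] less[of "m' - i"] that Suc
          by (intro ord_mult'[of 1 _ 1] ord_shift[of 1 "\<lambda>k. fps_nth (b k) i"]) auto
        then have "ord 3 (\<lambda>k. \<alpha> (k - 1) * (\<Sum>i\<le>m'. fps_nth (b (k - 1)) i * fps_nth (b k) (m' - i)))"
          by (intro ord_mult'[OF ord_alpha ord_sum]) auto
        then show "ord 1 (\<lambda>k. \<alpha> (k - 1) * (\<Sum>i\<le>m'. fps_nth (b (k - 1)) i * fps_nth (b k) (m' - i)))"
          by (rule ord_mono) simp
      qed
      then show ?thesis unfolding Suc
        by (rule ord_cong[rotated]) (auto intro!: eventually_sequentiallyI[of 1] simp: b_Suc'[unfolded One_nat_def])
    qed
  qed
  then show ?thesis by (rule ord_shift)
qed

text \<open>Without its product term the Riccati recursion gives coefficient m of \<open>b k\<close>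
  the value \<open>- cnj (\<alpha> (k - Suc m))\<close>; this is the deviation from it, of weight
  3.\<close>

definition b_corr :: "nat \<Rightarrow> nat \<Rightarrow> complex" where
  "b_corr m k = fps_nth (b k) m + cnj (\<alpha> (k - Suc m))"

lemma b_corr_0: "k \<ge> 1 \<Longrightarrow> b_corr 0 k = 0"
  by (simp add: b_corr_def b_0'[unfolded One_nat_def])

lemma b_corr_Suc: "k \<ge> 1 \<Longrightarrow> b_corr (Suc m) k = b_corr m (k - 1)
    + (\<Sum>i\<le>m. \<alpha> (k - 1) * fps_nth (b (k - 1)) i * fps_nth (b k) (m - i))"
  by (simp add: b_corr_def b_Suc' sum_distrib_left mult_ac)

lemma ord_b_corr: "ord 3 (\<lambda>k. b_corr m (k - s))"
proof -
  have "ord 3 (b_corr m)"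
  proof (induction m)
    case 0
    show ?case
      by (rule ord_cong[OF _ ord_zero]) (auto intro!: eventually_sequentiallyI[of 1] simp: b_corr_0)
  next
    case (Suc m)
    have "ord 3 (\<lambda>k. b_corr m (k - 1) + (\<Sum>i\<le>m. \<alpha> (k - 1) * fps_nth (b (k - 1)) i * fps_nth (b k) (m - i)))"
      using ord_b[of 0, simplified] Suc
      by (intro ord_add ord_shift[of 3 "b_corr m"] ord_sum ord_mult'[of 2 _ 1 _ 3] ord_mult'[of 1 _ 1 _ 2] ord_alpha ord_b) auto
    then show ?case
      by (rule ord_cong[rotated]) (auto intro!: eventually_sequentiallyI[of 1] simp: b_corr_Suc)
  qed
  then show ?thesis by (rule ord_shift)
qed

text \<open>Replacing both coefficients by their linear parts changes their product by terms of
  weight 3 + 1, hence the whole monomial by weight 6. The minus signs of the two linear parts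
  cancel.\<close>

lemma b_quartic:
  "(\<lambda>k. Re (\<alpha> (k - s) * \<alpha> (k - t) * fps_nth (b (k - u)) i * fps_nth (b (k - v)) j)) \<simeq> (\<lambda>k. norm (\<alpha> k) ^ 4)"
proof -
  let ?b = "\<lambda>i k. fps_nth (b k) i" and ?a = "\<lambda>i k. cnj (\<alpha> (k - Suc i))"
  have "?b i (k - u) * ?b j (k - v) - ?a i (k - u) * ?a j (k - v)
      = b_corr i (k - u) * ?b j (k - v) - ?a i (k - u) * b_corr j (k - v)" for k
    by (simp add: b_corr_def algebra_simps)
  moreover have "ord 4 (\<lambda>k. b_corr i (k - u) * ?b j (k - v) - ?a i (k - u) * b_corr j (k - v))"
    unfolding diff_diff_left
    by (intro ord_diff ord_mult'[OF ord_b_corr ord_b] ord_mult'[OF ord_cnj[OF ord_alpha] ord_b_corr]) simp_all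
  ultimately have "ord 4 (\<lambda>k. ?b i (k - u) * ?b j (k - v) - ?a i (k - u) * ?a j (k - v))"
    by simp
  from ord_Re[OF ord_mult'[OF ord_mult'[OF ord_alpha[of s] ord_alpha[of t] refl] this refl]]
  have "ord 6 (\<lambda>k. Re (\<alpha> (k - s) * \<alpha> (k - t) * ?b i (k - u) * ?b j (k - v))
      - Re (\<alpha> (k - s) * \<alpha> (k - t) * ?a i (k - u) * ?a j (k - v)))"
    by (simp add: algebra_simps)
  then have "(\<lambda>k. Re (\<alpha> (k - s) * \<alpha> (k - t) * ?b i (k - u) * ?b j (k - v))) \<simeq>
      (\<lambda>k. Re (\<alpha> (k - s) * \<alpha> (k - t) * ?a i (k - u) * ?a j (k - v)))"
    by (rule bdd_equiv_ord)
  also have "\<dots> \<simeq> (\<lambda>k. norm (\<alpha> k) ^ 4)"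
    unfolding diff_diff_left by (rule quartic_equiv)
  finally show ?thesis .
qed

text \<open>Passing from m to \<open>Suc m\<close> adds m + 1 cubic products, each of which becomes,
  after multiplication by \<open>\<alpha> k\<close>, a quartic monomial worth
  \<open>norm (\<alpha> k) ^ 4\<close>; hence 1 + ... + m. The shift s is arbitrary because
  \<open>b_corr_Suc\<close> goes one index back.\<close>

lemma b_corr_quartic:
  "(\<lambda>k. Re (\<alpha> k * b_corr m (k - s))) \<simeq> (\<lambda>k. real (m * (m + 1)) / 2 * norm (\<alpha> k) ^ 4)"
proof (induction m arbitrary: s)
  case 0
  have "\<forall>\<^sub>F k in sequentially. Re (\<alpha> k * b_corr 0 (k - s)) = 0"
    by (auto intro!: eventually_sequentiallyI[of "Suc s"] simp: b_corr_0)
  from bdd_equiv_eventually[OF this] show ?case by simp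
next
  case (Suc m)
  have "(\<lambda>k. Re (\<alpha> k * b_corr (Suc m) (k - s))) \<simeq>
    (\<lambda>k. Re (\<alpha> k * b_corr m (k - Suc s)) + (\<Sum>i\<le>m. Re (\<alpha> (k - 0) * \<alpha> (k - Suc s) * fps_nth (b (k - Suc s)) i * fps_nth (b (k - s)) (m - i))))"
  proof (rule bdd_equiv_eventually, rule eventually_sequentiallyI[of "Suc s"])
    fix k assume "k \<ge> Suc s"
    then show "Re (\<alpha> k * b_corr (Suc m) (k - s)) =
      Re (\<alpha> k * b_corr m (k - Suc s)) + (\<Sum>i\<le>m. Re (\<alpha> (k - 0) * \<alpha> (k - Suc s) * fps_nth (b (k - Suc s)) i * fps_nth (b (k - s)) (m - i)))"
      by (simp add: b_corr_Suc distrib_left sum_distrib_left mult.assoc del: times_complex.sel)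
  qed
  also have "\<dots> \<simeq> (\<lambda>k. real (m * (m + 1)) / 2 * norm (\<alpha> k) ^ 4 + (\<Sum>i\<le>m. norm (\<alpha> k) ^ 4))"
    by (intro bdd_equiv_add bdd_equiv_sum Suc b_quartic)
  finally show ?case by (simp add: field_simps)
qed

text \<open>By \<open>log_ode\<close>, f is log (1 - U) up to a constant, where U = \<alpha> z b has
  weight 2, so f = - U - U^2 / 2 up to weight 6. Coefficient l of U is
  \<open>- \<alpha> k * cnj (\<alpha> (k - l))\<close> plus a correction worth l (l - 1) / 2 by
  \<open>b_corr_quartic\<close>, and U^2 / 2 is worth (l - 1) / 2; together (l^2 - 1) / 2.\<close>

lemma f_equiv:
  assumes "l \<ge> 1"
  shows "(\<lambda>k. Re (fps_nth (f k) l)) \<simeq>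
    (\<lambda>k. Re (\<alpha> k * cnj (\<alpha> (k - l))) - ((real l)\<^sup>2 - 1) / 2 * norm (\<alpha> k) ^ 4)"
proof -
  define U where "U k = fps_const (\<alpha> k) * fps_X * b k" for k
  have U_0: "fps_nth (U k) 0 = 0" and U_Suc: "fps_nth (U k) (Suc j) = \<alpha> k * fps_nth (b k) j" for k j
    by (simp_all add: U_def mult.assoc)
  have ord_U: "ord 2 (\<lambda>k. fps_nth (U k) j)" for j
    by (cases j) (use ord_alpha[of 0] ord_b[of 0] in \<open>auto simp: U_0 U_Suc intro!: ord_mult'[of 1 _ 1 _ 2]\<close>)
  define g where "g k = fps_deriv (f k)" for k
  have g: "g k = - fps_deriv (U k) + U k * g k" for k
    using log_ode[of k] by (simp add: g_def U_def)
  have ord_g: "ord 2 (\<lambda>k. fps_nth (g k) j)" for j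
  proof (induction j rule: less_induct)
    case (less j)
    have eq: "fps_nth (g k) j = - (of_nat (Suc j) * fps_nth (U k) (Suc j)) + (\<Sum>i\<in>{1..j}. fps_nth (U k) i * fps_nth (g k) (j - i))" for k
      by (subst g) (simp add: fps_mult_nth sum.atLeast_Suc_atMost U_0)
    have "ord 4 (\<lambda>k. fps_nth (U k) i * fps_nth (g k) (j - i))" if "i \<in> {1..j}" for i
      using that by (intro ord_mult'[of 2 _ 2 _ 4] ord_U less) auto
    then show ?case unfolding eq
      by (intro ord_add ord_minus ord_const_mult ord_U ord_sum) (auto intro: ord_mono[of 4])
  qed
  \<comment> \<open>Checking the expansion on derivatives avoids composing power series: g = - U' +
    U g makes the derivative of f + U + U^2 / 2 equal to U^2 g, of weight 4 + 2.\<close>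
  have "fps_deriv (f k + U k + fps_const (1/2) * (U k * U k)) = U k * U k * g k" for k
  proof -
    have "fps_deriv (f k + U k + fps_const (1/2) * (U k * U k)) = g k + fps_deriv (U k) + U k * fps_deriv (U k)"
    proof -
      have "fps_const (1/2) * (2 * x) = x" for x :: "complex fps"
        by (simp add: numeral_fps_const flip: mult.assoc)
      from this[of "U k * fps_deriv (U k)"] show ?thesis
        by (simp add: g_def algebra_simps flip: mult_2)
    qed
    also have "\<dots> = U k * (g k + fps_deriv (U k))"
      by (subst (1) g) (simp add: algebra_simps)
    also have "\<dots> = U k * (U k * g k)"
      by (subst (1) g) simp
    finally show ?thesis by (simp add: mult.assoc)
  qed
  note deriv = this
  have *: "of_nat l * fps_nth (f k + U k + fps_const (1/2) * (U k * U k)) l = fps_nth (U k * U k * g k) (l - 1)" for k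
    using assms by (simp only: deriv[symmetric] fps_deriv_nth) simp
  have eq: "fps_nth (f k) l + fps_nth (U k) l + (1/2) * (\<Sum>i=0..l. fps_nth (U k) i * fps_nth (U k) (l - i))
      = (1 / of_nat l) * (\<Sum>i=0..l-1. (\<Sum>j=0..i. fps_nth (U k) j * fps_nth (U k) (i - j)) * fps_nth (g k) (l - 1 - i))" for k
    using *[of k, unfolded fps_add_nth fps_mult_left_const_nth, unfolded fps_mult_nth] assms
    by (simp add: field_simps)
  have "ord 6 (\<lambda>k. fps_nth (f k) l + fps_nth (U k) l + (1/2) * (\<Sum>i=0..l. fps_nth (U k) i * fps_nth (U k) (l - i)))"
    unfolding eq
    by (intro ord_const_mult ord_sum ord_mult'[of 4 _ 2 _ 6] ord_mult'[of 2 _ 2 _ 4] ord_U ord_g) simp_all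
  from ord_Re[OF this]
  have "(\<lambda>k. Re (fps_nth (f k) l)) \<simeq> (\<lambda>k. - Re (fps_nth (U k) l) - (1/2) * (\<Sum>i=0..l. Re (fps_nth (U k) i * fps_nth (U k) (l - i))))"
    by (intro bdd_equiv_ord) (simp add: algebra_simps del: times_complex.sel)
  also have "\<dots> = (\<lambda>k. Re (\<alpha> k * cnj (\<alpha> (k - l))) - Re (\<alpha> k * b_corr (l - 1) (k - 0))
        - (1/2) * (\<Sum>i=1..l-1. Re (\<alpha> (k - 0) * \<alpha> (k - 0) * fps_nth (b (k - 0)) (i - 1) * fps_nth (b (k - 0)) (l - i - 1))))"
  proof (intro ext arg_cong2[where f = minus] arg_cong2[where f = times] refl, goal_cases)
    case (1 k)
    show ?case using assms U_Suc[of k "l - 1"] by (simp add: b_corr_def algebra_simps)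
  next
    case (2 k)
    \<comment> \<open>U has no constant term, so the two end terms vanish and l - 1 products
      remain.\<close>
    have "(\<Sum>i=0..l. Re (fps_nth (U k) i * fps_nth (U k) (l - i))) = (\<Sum>i=1..l-1. Re (fps_nth (U k) i * fps_nth (U k) (l - i)))"
      using assms by (intro sum.mono_neutral_right) (auto simp: U_0 not_less_eq_eq le_Suc_eq)
    also have "\<dots> = (\<Sum>i=1..l-1. Re (\<alpha> (k - 0) * \<alpha> (k - 0) * fps_nth (b (k - 0)) (i - 1) * fps_nth (b (k - 0)) (l - i - 1)))"
    proof (intro sum.cong refl arg_cong[where f = Re])
      fix i assume "i \<in> {1..l-1}"
      then obtain i' j' where "i = Suc i'" "l - i = Suc j'"
        by (metis Suc_diff_Suc Suc_le_eq Suc_pred' atLeastAtMost_iff le_imp_less_Suc less_one linorder_not_le One_nat_def assms Suc_diff_1)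
      then show "fps_nth (U k) i * fps_nth (U k) (l - i) = \<alpha> (k - 0) * \<alpha> (k - 0) * fps_nth (b (k - 0)) (i - 1) * fps_nth (b (k - 0)) (l - i - 1)"
        by (simp add: U_Suc)
    qed
    finally show ?case .
  qed
  also have "\<dots> \<simeq> (\<lambda>k. Re (\<alpha> k * cnj (\<alpha> (k - l))) - real ((l - 1) * (l - 1 + 1)) / 2 * norm (\<alpha> k) ^ 4
        - (1/2) * (\<Sum>i=1..l-1. norm (\<alpha> k) ^ 4))"
    by (intro bdd_equiv_diff bdd_equiv_cmult bdd_equiv_sum b_quartic b_corr_quartic bdd_equiv_refl)
  also have "\<dots> = (\<lambda>k. Re (\<alpha> k * cnj (\<alpha> (k - l))) - ((real l)\<^sup>2 - 1) / 2 * norm (\<alpha> k) ^ 4)"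
    using assms by (intro ext) (simp add: of_nat_diff power2_eq_square field_simps del: times_complex.sel)
  finally show ?thesis .
qed

end

section \<open>Majorant sequence and autocorrelations of the coefficients\<close>

lemma cmod_square_eq_Re: "(cmod z)\<^sup>2 = Re (z * cnj z)"
  unfolding cmod_power2 by (simp add: power2_eq_square)

lemma sum_rotate3: "(\<Sum>i\<in>A. \<Sum>j\<in>B. \<Sum>l\<in>C. g i j l) = (\<Sum>l\<in>C. \<Sum>i\<in>A. \<Sum>j\<in>B. g i j l)"
proof -
  have "(\<Sum>i\<in>A. \<Sum>j\<in>B. \<Sum>l\<in>C. g i j l) = (\<Sum>i\<in>A. \<Sum>l\<in>C. \<Sum>j\<in>B. g i j l)"
    by (intro sum.cong refl sum.swap)
  also have "\<dots> = (\<Sum>l\<in>C. \<Sum>i\<in>A. \<Sum>j\<in>B. g i j l)"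
    by (rule sum.swap)
  finally show ?thesis .
qed

lemma sum_select:
  fixes p :: "nat \<Rightarrow> real"
  assumes "d \<le> n" shows "x * p d = (\<Sum>l\<le>n. (if d = l then x else 0) * p l)"
proof -
  have "(\<Sum>l\<le>n. (if d = l then x else 0) * p l) = (\<Sum>l\<le>n. if d = l then x * p l else 0)"
    by (intro sum.cong) auto
  then show ?thesis using assms by simp
qed

text \<open>The constant 2^5 of the convexity inequality for t^6 arises as 2^3 from the square, once
  cubed, times 4 from the cube.\<close>

lemma sixth_power_convex:
  fixes u v :: real
  assumes "u \<ge> 0" "v \<ge> 0"
  shows "(u + v) ^ 6 \<le> 32 * u ^ 6 + 32 * v ^ 6"
proof -
  have cube: "(A + B) ^ 3 \<le> 4 * (A ^ 3 + B ^ 3)" if "A \<ge> 0" "B \<ge> 0" for A B :: real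
  proof -
    have "4 * (A ^ 3 + B ^ 3) - (A + B) ^ 3 = 3 * (A + B) * (A - B)\<^sup>2" by algebra
    moreover have "\<dots> \<ge> 0" using that by simp
    ultimately show ?thesis by linarith
  qed
  have "(u + v)\<^sup>2 \<le> 2 * u\<^sup>2 + 2 * v\<^sup>2"
    using sum_squares_bound[of u v] by (simp add: power2_eq_square algebra_simps)
  then have "((u + v)\<^sup>2) ^ 3 \<le> (2 * u\<^sup>2 + 2 * v\<^sup>2) ^ 3" by (intro power_mono) simp_all
  also have "\<dots> \<le> 4 * ((2 * u\<^sup>2) ^ 3 + (2 * v\<^sup>2) ^ 3)" by (rule cube) simp_all
  finally show ?thesis by (simp add: power_mult_distrib flip: power_mult)
qed

text \<open>The square root of the increment balances the two hypotheses: its sixth power is the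
  cube of the increment, and its square is the bound that \<open>diff_le\<close> asks for.\<close>

lemma slowly_varying_exists:
  assumes "summable (\<lambda>k. norm (\<alpha> k) ^ 6)" "summable (\<lambda>k. norm (\<alpha> (Suc k) - \<alpha> k) ^ 3)"
  obtains e where "slowly_varying \<alpha> e"
proof -
  define d where "d k = norm (\<alpha> k - \<alpha> (k - 1))" for k
  define x where "x k = norm (\<alpha> k) + sqrt (d k)" for k
  \<comment> \<open>a geometrically weighted sum over the past, so that going one step back costs only a factor 2\<close>
  define e where "e = rec_nat (x 0) (\<lambda>k y. x (Suc k) + y / 2)"
  have e_0: "e 0 = x 0" and e_Suc: "e (Suc k) = x (Suc k) + e k / 2" for k
    by (simp_all add: e_def)
  have x_nonneg: "x k \<ge> 0" for k by (simp add: x_def d_def)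
  have e_nonneg: "e k \<ge> 0" for k by (induction k) (auto simp: e_0 e_Suc x_nonneg)
  have x_le: "x k \<le> e k" for k by (cases k) (auto simp: e_0 e_Suc e_nonneg)
  have "summable (\<lambda>k. d (Suc k) ^ 3)" using assms(2) by (simp add: d_def)
  then have d: "summable (\<lambda>k. d k ^ 3)" by (subst (asm) summable_Suc_iff)
  have sx: "summable (\<lambda>k. x k ^ 6)"
  proof (rule summable_comparison_test')
    show "summable (\<lambda>k. 32 * norm (\<alpha> k) ^ 6 + 32 * d k ^ 3)"
      by (intro summable_add summable_mult assms(1) d)
    have "sqrt (d k) ^ 6 = d k ^ 3" for k
      using power_mult[of "sqrt (d k)" 2 3] by (simp add: d_def)
    then show "norm (x k ^ 6) \<le> 32 * norm (\<alpha> k) ^ 6 + 32 * d k ^ 3" for k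
      using sixth_power_convex[of "norm (\<alpha> k)" "sqrt (d k)"] by (simp add: x_def d_def)
  qed
  \<comment> \<open>The extra \<open>e N ^ 6\<close> on the left closes the induction:
    \<open>e (Suc N) ^ 6\<close> is at most 32 x^6 + 32 (e / 2)^6, and doubling turns the last term
    into e^6 because 2 * 32 = 2^6.\<close>
  have bound: "(\<Sum>k<N. e (Suc k) ^ 6) + e N ^ 6 \<le> 64 * (\<Sum>k<N. x (Suc k) ^ 6) + x 0 ^ 6" for N
  proof (induction N)
    case (Suc N)
    have "2 * e (Suc N) ^ 6 \<le> 64 * x (Suc N) ^ 6 + e N ^ 6"
      using sixth_power_convex[of "x (Suc N)" "e N / 2"] x_nonneg e_nonneg
      by (simp add: e_Suc power_divide)
    with Suc show ?case by simp
  qed (simp add: e_0)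
  have "summable (\<lambda>k. e (Suc k) ^ 6)"
  proof (rule bounded_imp_summable)
    fix N
    have "(\<Sum>k\<le>N. e (Suc k) ^ 6) \<le> 64 * (\<Sum>k<Suc N. x (Suc k) ^ 6) + x 0 ^ 6"
      using bound[of "Suc N"] e_nonneg[of "Suc N"] unfolding lessThan_Suc_atMost by (smt (verit) zero_le_power)
    also have "\<dots> \<le> 64 * (\<Sum>k. x (Suc k) ^ 6) + x 0 ^ 6"
      using sx by (intro add_mono mult_left_mono sum_le_suminf) (auto simp: summable_Suc_iff[of "\<lambda>k. x k ^ 6"] x_nonneg)
    finally show "(\<Sum>k\<le>N. e (Suc k) ^ 6) \<le> 64 * (\<Sum>k. x (Suc k) ^ 6) + x 0 ^ 6" .
  qed simp
  then have "summable (\<lambda>k. e k ^ 6)" by (subst (asm) summable_Suc_iff)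
  moreover have "norm (\<alpha> k) \<le> e k" for k
    using x_le[of k] by (rule order_trans[rotated]) (simp add: x_def d_def)
  moreover have "norm (\<alpha> (Suc k) - \<alpha> k) \<le> e (Suc k) ^ 2" for k
  proof -
    have "sqrt (d (Suc k)) \<le> e (Suc k)"
      using x_le[of "Suc k"] by (rule order_trans[rotated]) (simp add: x_def)
    then have "d (Suc k) \<le> e (Suc k) ^ 2" by (rule sqrt_le_D)
    then show ?thesis by (simp add: d_def)
  qed
  moreover have "e k \<le> 2 * e (Suc k)" for k by (simp add: e_Suc x_nonneg)
  ultimately have "slowly_varying \<alpha> e" by unfold_locales
  then show ?thesis by (rule that)
qed

text \<open>Both bounds compare derivatives: minus the expression inside the absolute value has
  derivative t^2 / (1 - t), which lies between 0 and 2 t^2 on [0, 1/2].\<close>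

lemma ln_one_minus_third_order:
  fixes x :: real assumes "0 \<le> x" "x \<le> 1/2"
  shows "\<bar>ln (1 - x) + x + x\<^sup>2 / 2\<bar> \<le> x ^ 3"
proof -
  let ?g = "\<lambda>t::real. - ln (1 - t) - t - t\<^sup>2 / 2"
  have d: "(?g has_real_derivative t\<^sup>2 / (1 - t)) (at t)" if "t \<le> 1/2" for t
    using that by (auto intro!: derivative_eq_intros simp: field_simps power2_eq_square)
  have "?g 0 \<le> ?g x"
    using assms by (intro DERIV_nonneg_imp_nondecreasing[of 0 x ?g])
      (auto intro!: exI[of _ "_\<^sup>2 / (1 - _)"] d)
  moreover have "(\<lambda>t. t ^ 3 - ?g t) 0 \<le> (\<lambda>t. t ^ 3 - ?g t) x"
  proof (rule DERIV_nonneg_imp_nondecreasing[OF assms(1)])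
    fix t assume t: "0 \<le> t" "t \<le> x"
    have "t\<^sup>2 / (1 - t) \<le> t\<^sup>2 / (1/2)" using t assms by (intro divide_left_mono) auto
    also have "\<dots> \<le> 3 * t\<^sup>2" by simp
    finally show "\<exists>y. ((\<lambda>t. t ^ 3 - ?g t) has_real_derivative y) (at t) \<and> 0 \<le> y"
      using t assms by (intro exI[of _ "3 * t\<^sup>2 - t\<^sup>2 / (1 - t)"] conjI DERIV_diff d)
        (auto intro!: derivative_eq_intros)
  qed
  ultimately show ?thesis by simp
qed

context slowly_varying
begin

lemma ord_corr: "ord 2 (\<lambda>k. Re (\<alpha> k * cnj (\<alpha> (k - l))))"
  using ord_alpha[of 0] by (intro ord_Re ord_mult'[of 1 _ 1] ord_cnj ord_alpha) simp_all

lemma ln_equiv: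
  "(\<lambda>k. - ln (1 - (norm (\<alpha> k))\<^sup>2)) \<simeq> (\<lambda>k. (norm (\<alpha> k))\<^sup>2 + 1/2 * norm (\<alpha> k) ^ 4)"
proof (rule bdd_equiv_ord, unfold ord_def, intro exI[of _ 1] conjI)
  have "\<forall>\<^sub>F k in sequentially. e k < 1/2" using e_tendsto by (rule order_tendstoD) simp
  then show "\<forall>\<^sub>F k in sequentially. norm (- ln (1 - (norm (\<alpha> k))\<^sup>2) - ((norm (\<alpha> k))\<^sup>2 + 1/2 * norm (\<alpha> k) ^ 4)) \<le> 1 * e k ^ 6"
  proof eventually_elim
    case (elim k)
    have "(norm (\<alpha> k))\<^sup>2 \<le> (1/2)\<^sup>2" using elim norm_le[of k] by (intro power_mono) auto
    then have "\<bar>ln (1 - (norm (\<alpha> k))\<^sup>2) + (norm (\<alpha> k))\<^sup>2 + ((norm (\<alpha> k))\<^sup>2)\<^sup>2 / 2\<bar> \<le> ((norm (\<alpha> k))\<^sup>2) ^ 3"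
      by (intro ln_one_minus_third_order) (auto simp: power2_eq_square)
    also have "\<dots> = norm (\<alpha> k) ^ 6" by (simp flip: power_mult)
    also have "\<dots> \<le> e k ^ 6" by (intro power_mono norm_le) simp
    also have "((norm (\<alpha> k))\<^sup>2)\<^sup>2 = norm (\<alpha> k) ^ 4" by (simp flip: power_mult)
    finally show ?case by (simp add: abs_le_iff)
  qed
qed simp

text \<open>The real part of \<open>\<alpha> (k + i) * cnj (\<alpha> (k + j))\<close> is symmetric
  in i and j, so it depends on their distance, written \<open>(i - j) + (j - i)\<close> in natural
  numbers, and on the larger index \<open>k + max i j\<close>; moving the latter back to k is free
  up to \<open>\<simeq>\<close>.\<close>

lemma shift_poly_equiv:
  "(\<lambda>k. (norm (shift_poly n b \<alpha> k))\<^sup>2) \<simeq>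
   (\<lambda>k. \<Sum>l\<le>n. (\<Sum>i\<le>n. \<Sum>j\<le>n. if (i - j) + (j - i) = l then b i * b j else 0) * Re (\<alpha> k * cnj (\<alpha> (k - l))))"
proof -
  let ?p = "\<lambda>l k. Re (\<alpha> k * cnj (\<alpha> (k - l)))"
  have iter: "(left_shift ^^ l) x k = x (k + l)" for l x k
    by (induction l arbitrary: x k) (auto simp: left_shift_def funpow_swap1)
  \<comment> \<open>A forward shift is undone by a backward one except at finitely many indices, so
    \<open>bdd_equiv_shift\<close> serves for both directions.\<close>
  have fwd: "(\<lambda>k. x (k + s)) \<simeq> x" if "Bseq x" for x s
  proof -
    have "(\<lambda>k. x (k - s + s)) \<simeq> (\<lambda>k. x (k + s))"
      using Bseq_ignore_initial_segment[OF that, of s] by (intro bdd_equiv_shift)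
    moreover have "(\<lambda>k. x (k - s + s)) \<simeq> x"
      by (rule bdd_equiv_eventually, rule eventually_sequentiallyI[of s]) simp
    ultimately show ?thesis by (blast intro: bdd_equiv_trans bdd_equiv_sym)
  qed
  have eq: "Re (\<alpha> (k + i) * cnj (\<alpha> (k + j))) = ?p ((i - j) + (j - i)) (k + max i j)" for k i j
  proof (cases "j \<le> i")
    case True
    then show ?thesis by (simp add: max_def)
  next
    case False
    then show ?thesis by (simp add: max_def mult.commute)
  qed
  have eq1: "(\<lambda>k. (norm (shift_poly n b \<alpha> k))\<^sup>2) = (\<lambda>k. \<Sum>i\<le>n. \<Sum>j\<le>n. (b i * b j) * ?p ((i - j) + (j - i)) (k + max i j))"
  proof
    fix k
    have "(norm (shift_poly n b \<alpha> k))\<^sup>2 = Re (shift_poly n b \<alpha> k * cnj (shift_poly n b \<alpha> k))"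
      by (rule cmod_square_eq_Re)
    also have "\<dots> = (\<Sum>i\<le>n. \<Sum>j\<le>n. Re (complex_of_real (b i) * \<alpha> (k + i) * (complex_of_real (b j) * cnj (\<alpha> (k + j)))))"
      by (simp add: shift_poly_def iter cnj_sum sum_product Re_sum)
    also have "\<dots> = (\<Sum>i\<le>n. \<Sum>j\<le>n. (b i * b j) * Re (\<alpha> (k + i) * cnj (\<alpha> (k + j))))"
      by (intro sum.cong refl) (simp add: algebra_simps)
    finally show "(norm (shift_poly n b \<alpha> k))\<^sup>2 = (\<Sum>i\<le>n. \<Sum>j\<le>n. (b i * b j) * ?p ((i - j) + (j - i)) (k + max i j))"
      unfolding eq .
  qed
  have "(\<lambda>k. \<Sum>i\<le>n. \<Sum>j\<le>n. (b i * b j) * ?p ((i - j) + (j - i)) k) = (\<lambda>k. \<Sum>i\<le>n. \<Sum>j\<le>n. \<Sum>l\<le>n. (if (i - j) + (j - i) = l then b i * b j else 0) * ?p l k)"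
  proof (intro ext sum.cong refl, goal_cases)
    case (1 k i j)
    then have "(i - j) + (j - i) \<le> n" by (cases "i \<le> j") auto
    from sum_select[OF this, of "b i * b j" "\<lambda>l. ?p l k"] show ?case .
  qed
  also have "\<dots> = (\<lambda>k. \<Sum>l\<le>n. \<Sum>i\<le>n. \<Sum>j\<le>n. (if (i - j) + (j - i) = l then b i * b j else 0) * ?p l k)"
    by (intro ext sum_rotate3)
  finally have eq2: "(\<lambda>k. \<Sum>i\<le>n. \<Sum>j\<le>n. (b i * b j) * ?p ((i - j) + (j - i)) k)
      = (\<lambda>k. \<Sum>l\<le>n. (\<Sum>i\<le>n. \<Sum>j\<le>n. if (i - j) + (j - i) = l then b i * b j else 0) * ?p l k)"
    by (simp only: sum_distrib_right)
  show ?thesis unfolding eq1 eq2[symmetric]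
    by (intro bdd_equiv_sum bdd_equiv_cmult fwd Bseq_ord[OF ord_corr])
qed

end

text \<open>Here the condition on \<open>a\<close> enters: the total quartic coefficient is
  \<open>a 0 / 2\<close>, from the logarithm of 1 - |\<alpha>|^2, minus the weighted sum from
  \<open>f_equiv\<close>, and this is zero.\<close>

lemma (in schur_riccati) step_equiv:
  assumes "a 0 / 2 = (\<Sum>l=1..n. ((real l)\<^sup>2 - 1) / 2 * a l)"
  shows "(\<lambda>k. (\<Sum>l=1..n. a l * Re (fps_nth (f k) l)) + a 0 * (- ln (1 - (norm (\<alpha> k))\<^sup>2)))
     \<simeq> (\<lambda>k. \<Sum>l\<le>n. a l * Re (\<alpha> k * cnj (\<alpha> (k - l))))"
proof -
  let ?p = "\<lambda>l k. Re (\<alpha> k * cnj (\<alpha> (k - l)))"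
  have "(\<lambda>k. (\<Sum>l=1..n. a l * Re (fps_nth (f k) l)) + a 0 * (- ln (1 - (norm (\<alpha> k))\<^sup>2)))
     \<simeq> (\<lambda>k. (\<Sum>l=1..n. a l * (?p l k - ((real l)\<^sup>2 - 1) / 2 * norm (\<alpha> k) ^ 4))
         + a 0 * ((norm (\<alpha> k))\<^sup>2 + 1/2 * norm (\<alpha> k) ^ 4))"
    by (intro bdd_equiv_add bdd_equiv_sum bdd_equiv_cmult ln_equiv f_equiv) auto
  also have "\<dots> = (\<lambda>k. \<Sum>l\<le>n. a l * ?p l k)"
  proof
    fix k
    have "?p 0 k = (norm (\<alpha> k))\<^sup>2" by (simp only: cmod_square_eq_Re diff_zero)
    moreover have "(\<Sum>l\<le>n. a l * ?p l k) = a 0 * ?p 0 k + (\<Sum>l=1..n. a l * ?p l k)"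
      by (simp add: sum.atLeast_Suc_atMost atMost_atLeast0 del: times_complex.sel)
    moreover have "(\<Sum>l=1..n. a l * (?p l k - ((real l)\<^sup>2 - 1) / 2 * norm (\<alpha> k) ^ 4))
      = (\<Sum>l=1..n. a l * ?p l k) - (\<Sum>l=1..n. ((real l)\<^sup>2 - 1) / 2 * a l) * norm (\<alpha> k) ^ 4"
      unfolding sum_distrib_right sum_subtractf[symmetric]
      by (intro sum.cong refl) (simp add: algebra_simps del: times_complex.sel)
    ultimately show "(\<Sum>l=1..n. a l * (?p l k - ((real l)\<^sup>2 - 1) / 2 * norm (\<alpha> k) ^ 4))
         + a 0 * ((norm (\<alpha> k))\<^sup>2 + 1/2 * norm (\<alpha> k) ^ 4) = (\<Sum>l\<le>n. a l * ?p l k)"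
      unfolding assms[symmetric] by (simp add: algebra_simps del: times_complex.sel)
  qed
  finally show ?thesis .
qed

section \<open>Uniqueness of cosine coefficients\<close>

lemma poly_eq_0_on_circle:
  fixes p :: "complex poly"
  assumes "\<And>\<theta>. poly p (cis \<theta>) = 0" shows "p = 0"
proof -
  have "x = Re (cis (arccos x)) \<and> cis (arccos x) \<in> {z. poly p z = 0}" if "x \<in> {-1..1}" for x
    using that assms by simp
  then have "{-1..1} \<subseteq> Re ` {z. poly p z = 0}" by blast
  moreover have "infinite {-1..1::real}" by (rule infinite_Icc) simp
  ultimately have "infinite {z. poly p z = 0}" by (metis finite_imageI finite_subset)
  then show "p = 0" using poly_roots_finite by blast
qed

lemma cos_poly_eq_0_imp:
  assumes "\<And>\<theta>. cos_poly n c \<theta> = 0" "l \<le> n" shows "c l = 0"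
proof -
  \<comment> \<open>On the circle p is 2 z^n times the cosine sum. For l = 0 the two monomials
    coincide, whence a factor 2 at coefficient n.\<close>
  define p :: "complex poly" where "p = (\<Sum>m\<le>n. monom (of_real (c m)) (n + m) + monom (of_real (c m)) (n - m))"
  have "poly p (cis \<theta>) = 0" for \<theta>
  proof -
    have "poly p (cis \<theta>) = (\<Sum>m\<le>n. of_real (c m) * (cis (real (n + m) * \<theta>) + cis (real (n - m) * \<theta>)))"
      by (simp only: p_def poly_sum poly_add poly_monom Complex.DeMoivre distrib_left)
    also have "\<dots> = (\<Sum>m\<le>n. cis (real n * \<theta>) * 2 * of_real (c m * cos (real m * \<theta>)))"
    proof (intro sum.cong refl)
      fix m assume "m \<in> {..n}"
      then have "cis (real (n + m) * \<theta>) + cis (real (n - m) * \<theta>) = cis (real n * \<theta>) * (cis (real m * \<theta>) + cis (- (real m * \<theta>)))"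
        by (simp add: distrib_left cis_mult algebra_simps of_nat_diff)
      also have "\<dots> = cis (real n * \<theta>) * 2 * of_real (cos (real m * \<theta>))"
        by (simp add: complex_eq_iff)
      finally show "of_real (c m) * (cis (real (n + m) * \<theta>) + cis (real (n - m) * \<theta>))
          = cis (real n * \<theta>) * 2 * of_real (c m * cos (real m * \<theta>))" by simp
    qed
    also have "\<dots> = cis (real n * \<theta>) * 2 * of_real (cos_poly n c \<theta>)"
      by (simp add: cos_poly_def sum_distrib_left)
    finally show ?thesis using assms(1) by simp
  qed
  then have "p = 0" by (rule poly_eq_0_on_circle)
  then have "0 = coeff p (n + l)" by simp
  also have "\<dots> = (\<Sum>m\<le>n. (if m = l then of_real (c m) else 0) + (if m = 0 \<and> l = 0 then of_real (c m) else 0))"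
    unfolding p_def coeff_sum coeff_add coeff_monom by (intro sum.cong refl) auto
  also have "\<dots> = (if l = 0 then 2 else 1) * of_real (c l)"
    using assms(2) by (auto simp: sum.distrib)
  finally show ?thesis by (auto split: if_splits)
qed

text \<open>Multiplying out |Q|^2 gives a second cosine polynomial, and cosine coefficients are
  unique. For l \<ge> 1 the pairs with i - j = l and with j - i = l are both counted.\<close>

lemma cos_poly_coeffs:
  assumes "\<And>\<theta>. (cmod (\<Sum>l\<le>n. of_real (b l) * cis \<theta> ^ l))\<^sup>2 = cos_poly n a \<theta>" "l \<le> n"
  shows "a l = (\<Sum>i\<le>n. \<Sum>j\<le>n. if (i - j) + (j - i) = l then b i * b j else 0)"
proof -
  let ?A = "\<lambda>l. \<Sum>i\<le>n. \<Sum>j\<le>n. if (i - j) + (j - i) = l then b i * b j else 0"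
  have eq: "cos_poly n a \<theta> = cos_poly n ?A \<theta>" for \<theta>
  proof -
    have "(cmod (\<Sum>l\<le>n. of_real (b l) * cis \<theta> ^ l))\<^sup>2
       = Re ((\<Sum>l\<le>n. of_real (b l) * cis \<theta> ^ l) * cnj (\<Sum>l\<le>n. of_real (b l) * cis \<theta> ^ l))"
      by (rule cmod_square_eq_Re)
    also have "\<dots> = (\<Sum>i\<le>n. \<Sum>j\<le>n. Re (complex_of_real (b i) * cis \<theta> ^ i * (complex_of_real (b j) * cnj (cis \<theta> ^ j))))"
      by (simp add: cnj_sum sum_product Re_sum)
    also have "\<dots> = (\<Sum>i\<le>n. \<Sum>j\<le>n. b i * b j * cos (real ((i - j) + (j - i)) * \<theta>))"
    proof (intro sum.cong refl)
      fix i j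
      have "complex_of_real (b i) * cis \<theta> ^ i * (complex_of_real (b j) * cnj (cis \<theta> ^ j))
          = of_real (b i * b j) * cis (real i * \<theta> - real j * \<theta>)"
        by (simp add: Complex.DeMoivre cis_cnj cis_mult)
      then have "Re (complex_of_real (b i) * cis \<theta> ^ i * (complex_of_real (b j) * cnj (cis \<theta> ^ j))) = b i * b j * cos (real i * \<theta> - real j * \<theta>)"
        by (simp only: Re_complex_of_real Im_complex_of_real times_complex.sel cis.sel)
      also have "cos (real i * \<theta> - real j * \<theta>) = cos (real ((i - j) + (j - i)) * \<theta>)"
        using cos_minus[of "real i * \<theta> - real j * \<theta>"]
        by (cases "j \<le> i") (auto simp: of_nat_diff algebra_simps)
      finally show "Re (complex_of_real (b i) * cis \<theta> ^ i * (complex_of_real (b j) * cnj (cis \<theta> ^ j))) = b i * b j * cos (real ((i - j) + (j - i)) * \<theta>)" .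
    qed
    also have "\<dots> = (\<Sum>i\<le>n. \<Sum>j\<le>n. \<Sum>l\<le>n. (if (i - j) + (j - i) = l then b i * b j else 0) * cos (real l * \<theta>))"
      by (intro sum.cong refl) (simp add: if_distrib if_distribR sum.delta' cong: if_cong)
    also have "\<dots> = (\<Sum>l\<le>n. \<Sum>i\<le>n. \<Sum>j\<le>n. (if (i - j) + (j - i) = l then b i * b j else 0) * cos (real l * \<theta>))"
      by (rule sum_rotate3)
    finally show ?thesis using assms(1) by (simp add: cos_poly_def sum_distrib_right)
  qed
  have "cos_poly n (\<lambda>l. a l - ?A l) \<theta> = 0" for \<theta>
    using eq[of \<theta>] by (simp add: cos_poly_def left_diff_distrib sum_subtractf)
  from cos_poly_eq_0_imp[OF this assms(2)] show ?thesis by simp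
qed

section \<open>Integrals over the circle\<close>

lemma angle_measure_density:
  "angle_measure = density lborel (\<lambda>x. ennreal (indicator {0..2*pi} x / (2*pi)))"
proof -
  have "indicator {0..2*pi} x / emeasure lborel {0..2*pi} = ennreal (indicator {0..2*pi} x / (2*pi))" for x :: real
    by (auto simp: indicator_def divide_ennreal[symmetric] simp flip: ennreal_1)
  then show ?thesis by (simp add: uniform_measure_def)
qed

lemma prob_space_angle: "prob_space angle_measure"
  by (rule prob_space_uniform_measure) auto

lemma integral_angle:
  fixes f :: "real \<Rightarrow> 'a::euclidean_space"
  assumes cont: "continuous_on UNIV f"
  shows "integrable angle_measure f"
    "(LINT \<theta>|angle_measure. f \<theta>) = (1 / (2*pi)) *\<^sub>R integral {0..2*pi} f"
proof -
  note assms = continuous_on_subset[OF cont subset_UNIV] borel_measurable_continuous_onI[OF cont]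
  have si: "set_integrable lborel {0..2*pi} f"
    unfolding set_integrable_def using assms by (intro borel_integrable_compact) auto
  then have "integrable lborel (\<lambda>x. (1 / (2*pi)) *\<^sub>R (indicator {0..2*pi} x *\<^sub>R f x))"
    unfolding set_integrable_def by (rule integrable_scaleR_right)
  then show "integrable angle_measure f"
    unfolding angle_measure_density using assms
    by (subst integrable_density) (auto simp: field_simps)
  have "(LINT \<theta>|angle_measure. f \<theta>) = (LINT x|lborel. (indicator {0..2*pi} x / (2*pi)) *\<^sub>R f x)"
    unfolding angle_measure_density using assms by (intro integral_density) auto
  also have "\<dots> = (LINT x|lborel. (1 / (2*pi)) *\<^sub>R (indicator {0..2*pi} x *\<^sub>R f x))"
    by (intro Bochner_Integration.integral_cong refl) simp
  also have "\<dots> = (1 / (2*pi)) *\<^sub>R (LINT x:{0..2*pi}|lborel. f x)"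
    unfolding set_lebesgue_integral_def by (rule integral_scaleR_right)
  also have "(LINT x:{0..2*pi}|lborel. f x) = integral {0..2*pi} f"
    using si by (rule set_borel_integral_eq_integral)
  finally show "(LINT \<theta>|angle_measure. f \<theta>) = (1 / (2*pi)) *\<^sub>R integral {0..2*pi} f" .
qed

lemma continuous_on_cis_comp:
  assumes "continuous_on (sphere 0 1) G" shows "continuous_on UNIV (\<lambda>\<theta>. G (cis \<theta>))"
  by (rule continuous_on_compose2[OF assms]) (auto intro!: continuous_intros)

text \<open>Cauchy's formula on the boundary circle itself, for which continuity on the closed disc
  suffices; there z^(-l-1) dz is i z^(-l) d\<theta>.\<close>

lemma integral_circle_coeff:
  assumes "continuous_on (cball 0 1) G" "G holomorphic_on ball 0 1" "G has_fps_expansion g"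
  shows "(LINT \<theta>|angle_measure. G (cis \<theta>) * cis (- (real l * \<theta>))) = fps_nth g l"
proof -
  have "((\<lambda>u. G u / (u - 0) ^ Suc l) has_contour_integral (2 * pi * \<i> / fact l) * (deriv ^^ l) G 0) (circlepath 0 1)"
    using assms by (intro Cauchy_has_contour_integral_higher_derivative_circlepath) auto
  then have "((\<lambda>t. G (cis t) / cis t ^ Suc l * \<i> * cis t) has_integral (2 * pi * \<i> / fact l) * (deriv ^^ l) G 0) {0..2*pi}"
    by (simp add: circlepath_def has_contour_integral_part_circlepath_iff)
  moreover have "(deriv ^^ l) G 0 = fact l * fps_nth g l"
    using fps_nth_fps_expansion[OF assms(3), of l] by simp
  moreover have "G (cis t) / cis t ^ Suc l * \<i> * cis t = \<i> * (G (cis t) * cis (- (real l * t)))" for t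
    by (simp add: Complex.DeMoivre field_simps cis_mult flip: cis_inverse)
  ultimately have "((\<lambda>t. \<i> * (G (cis t) * cis (- (real l * t)))) has_integral (2 * pi * \<i>) * fps_nth g l) {0..2*pi}"
    by (simp add: mult.assoc)
  then have "((\<lambda>t. - \<i> * (\<i> * (G (cis t) * cis (- (real l * t))))) has_integral - \<i> * ((2 * pi * \<i>) * fps_nth g l)) {0..2*pi}"
    by (rule has_integral_mult_right)
  moreover have *: "- \<i> * (\<i> * z) = z" "- \<i> * ((2 * pi * \<i>) * z) = (2 * pi) * z" for z :: complex
    by (simp_all add: algebra_simps)
  ultimately have "((\<lambda>t. G (cis t) * cis (- (real l * t))) has_integral (2 * pi) * fps_nth g l) {0..2*pi}"
    unfolding * by blast
  then have "integral {0..2*pi} (\<lambda>t. G (cis t) * cis (- (real l * t))) = (2 * pi) * fps_nth g l"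
    by (rule integral_unique)
  moreover have "continuous_on UNIV (\<lambda>t. G (cis t) * cis (- (real l * t)))"
    by (intro continuous_intros continuous_on_cis_comp continuous_on_subset[OF assms(1)]) auto
  ultimately show ?thesis
    by (subst integral_angle) (auto simp: scaleR_conv_of_real)
qed

lemma integral_circle_mean:
  assumes "continuous_on (cball 0 1) G" "G holomorphic_on ball 0 1"
  shows "(LINT \<theta>|angle_measure. G (cis \<theta>)) = G 0"
proof -
  have "G analytic_on {0}"
    using assms(2) by (auto simp: analytic_at intro!: exI[of _ "ball 0 1"])
  then have "G has_fps_expansion fps_expansion G 0" by (rule analytic_at_imp_has_fps_expansion_0)
  from integral_circle_coeff[OF assms this, of 0] has_fps_expansion_imp_0_eq_fps_nth_0[OF this]
  show ?thesis by simp
qed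

text \<open>Of the two exponentials in the cosine, e^(i l \<theta>) pairs with z^l G, which vanishes
  at 0, and the other one reads off coefficient l. The cosine being real, the real part can be taken
  at the end.\<close>

lemma integral_circle_cos:
  assumes "continuous_on (cball 0 1) G" "G holomorphic_on ball 0 1" "G has_fps_expansion g" "l \<ge> 1"
  shows "(LINT \<theta>|angle_measure. cos (real l * \<theta>) * Re (G (cis \<theta>))) = Re (fps_nth g l) / 2"
proof -
  have cG: "continuous_on UNIV (\<lambda>\<theta>. G (cis \<theta>))"
    by (intro continuous_on_cis_comp continuous_on_subset[OF assms(1)]) auto
  have 1: "(LINT \<theta>|angle_measure. G (cis \<theta>) * cis (real l * \<theta>)) = 0"
  proof -
    have "continuous_on (cball 0 1) (\<lambda>z. G z * z ^ l)" "(\<lambda>z. G z * z ^ l) holomorphic_on ball 0 1"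
      by (intro continuous_intros holomorphic_intros assms)+
    from integral_circle_mean[OF this] show ?thesis
      using assms(4) by (simp add: Complex.DeMoivre power_0_left)
  qed
  have "(LINT \<theta>|angle_measure. cos (real l * \<theta>) * Re (G (cis \<theta>)))
     = (LINT \<theta>|angle_measure. Re (1/2 * (G (cis \<theta>) * cis (real l * \<theta>) + G (cis \<theta>) * cis (- (real l * \<theta>)))))"
    by (intro Bochner_Integration.integral_cong refl) (simp add: field_simps)
  also have "\<dots> = Re (LINT \<theta>|angle_measure. 1/2 * (G (cis \<theta>) * cis (real l * \<theta>) + G (cis \<theta>) * cis (- (real l * \<theta>))))"
    by (intro integral_Re integral_angle continuous_intros cG)
  also have "(LINT \<theta>|angle_measure. 1/2 * (G (cis \<theta>) * cis (real l * \<theta>) + G (cis \<theta>) * cis (- (real l * \<theta>))))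
     = 1/2 * (LINT \<theta>|angle_measure. G (cis \<theta>) * cis (real l * \<theta>) + G (cis \<theta>) * cis (- (real l * \<theta>)))"
    by (rule integral_mult_right_zero)
  also have "\<dots> = 1/2 * ((LINT \<theta>|angle_measure. G (cis \<theta>) * cis (real l * \<theta>)) + (LINT \<theta>|angle_measure. G (cis \<theta>) * cis (- (real l * \<theta>))))"
    by (subst Bochner_Integration.integral_add) (intro integral_angle continuous_intros cG refl)+
  finally show ?thesis unfolding 1 integral_circle_coeff[OF assms(1-3)] by simp
qed

lemma sets_circle_borel_cong: "sets M = sets circle_borel \<Longrightarrow> space M = sphere 0 1"
  by (drule sets_eq_imp_space_eq) (simp add: circle_borel_def space_restrict_space)

lemma borel_measurable_circle:
  assumes "sets M = sets circle_borel" "f \<in> borel_measurable borel"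
  shows "f \<in> borel_measurable M"
  using assms by (simp add: measurable_cong_sets[OF assms(1) refl] circle_borel_def measurable_restrict_space1)

lemma integrable_circle:
  fixes f :: "complex \<Rightarrow> 'a::{banach, second_countable_topology}"
  assumes "finite_measure M" "sets M = sets circle_borel" "continuous_on (sphere 0 1) f"
  shows "integrable M f"
proof -
  have "f \<in> borel_measurable M"
    unfolding measurable_cong_sets[OF assms(2) refl] circle_borel_def
    using assms(3) by (rule borel_measurable_continuous_on_restrict)
  moreover have "bounded (f ` sphere 0 1)"
    by (intro compact_imp_bounded compact_continuous_image assms(3)) simp
  then obtain B where "\<forall>x\<in>sphere 0 1. norm (f x) \<le> B" by (auto simp: bounded_iff)
  then have "AE x in M. norm (f x) \<le> B"
    using sets_circle_borel_cong[OF assms(2)] by (intro AE_I2) auto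
  ultimately show ?thesis
    by (intro finite_measure.integrable_const_bound[OF assms(1)])
qed

lemma cis_measurable: "cis \<in> measurable angle_measure circle_borel"
  unfolding circle_borel_def
proof (rule measurable_restrict_space2)
  have "cis \<in> borel_measurable borel"
    by (intro borel_measurable_continuous_onI continuous_intros)
  then show "cis \<in> borel_measurable angle_measure"
    by (simp add: uniform_measure_def cong: measurable_cong_sets)
qed simp

section \<open>The Szego recursion\<close>

lemma poly_eq_on_circle:
  fixes p q :: "complex poly"
  assumes "\<And>z. norm z = 1 \<Longrightarrow> poly p z = poly q z" shows "p = q"
  using poly_eq_0_on_circle[of "p - q"] assms by simp

lemma poly_reverse_circle:
  assumes "norm z = 1"
  shows "poly (reflect_poly (map_poly cnj p)) z = z ^ degree p * cnj (poly p z)"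
proof -
  have "z \<noteq> 0" "inverse z = cnj z"
    using assms by (auto intro!: inverse_unique simp: complex_norm_square[symmetric])
  then show ?thesis
    by (simp add: poly_reflect_poly_nz poly_map_poly_cnj degree_map_poly)
qed

lemma continuous_on_poly_compose [continuous_intros]: "continuous_on A f \<Longrightarrow> continuous_on A (\<lambda>z. poly p (f z :: complex))"
  by (rule continuous_on_compose2[OF continuous_on_poly[OF continuous_on_id]]) auto

text \<open>Commonly written \<Phi>_k with a star. \<open>reflect_poly\<close> reverses with respect
  to the actual degree, which is k because \<open>\<Phi> k\<close> is monic of degree k.\<close>

definition reversed :: "(nat \<Rightarrow> complex poly) \<Rightarrow> nat \<Rightarrow> complex poly" where
  "reversed \<Phi> k = reflect_poly (map_poly cnj (\<Phi> k))"

text \<open>The bound on \<alpha> is left to \<open>szego_recursion\<close>: for a measure it is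
  deduced from \<open>norm_step\<close>, which rests on the recursion alone.\<close>

locale verblunsky_recursion =
  fixes \<Phi> :: "nat \<Rightarrow> complex poly" and \<alpha> :: "nat \<Rightarrow> complex"
  assumes degree_\<Phi>: "degree (\<Phi> k) = k" and lead_\<Phi>: "lead_coeff (\<Phi> k) = 1"
    and recursion: "\<Phi> (Suc k) = pCons 0 (\<Phi> k) - smult (cnj (\<alpha> k)) (reversed \<Phi> k)"
begin

abbreviation "\<Psi> \<equiv> reversed \<Phi>"

lemma \<Psi>_circle: "norm z = 1 \<Longrightarrow> poly (\<Psi> k) z = z ^ k * cnj (poly (\<Phi> k) z)"
  by (simp add: reversed_def poly_reverse_circle degree_\<Phi>)

lemma norm_\<Psi>_circle: "norm z = 1 \<Longrightarrow> norm (poly (\<Psi> k) z) = norm (poly (\<Phi> k) z)"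
  by (simp add: \<Psi>_circle norm_mult norm_power)

lemma \<Phi>_0: "\<Phi> 0 = 1"
  using degree_\<Phi>[of 0] lead_\<Phi>[of 0] by (metis degree_eq_zeroE coeff_pCons_0 one_pCons)

lemma \<Psi>_0: "\<Psi> 0 = 1"
  by (rule poly_eq_on_circle) (simp add: \<Psi>_circle \<Phi>_0)

lemma \<Phi>_Suc: "poly (\<Phi> (Suc k)) z = z * poly (\<Phi> k) z - cnj (\<alpha> k) * poly (\<Psi> k) z"
  by (subst recursion) simp

text \<open>The conjugate of \<open>\<Phi>_Suc\<close> on the circle, where cnj z = 1 / z; agreement
  there is agreement of polynomials.\<close>

lemma \<Psi>_Suc: "poly (\<Psi> (Suc k)) z = poly (\<Psi> k) z - \<alpha> k * z * poly (\<Phi> k) z"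
proof -
  have "\<Psi> (Suc k) = \<Psi> k - smult (\<alpha> k) (pCons 0 (\<Phi> k))"
  proof (rule poly_eq_on_circle)
    fix z :: complex assume z: "norm z = 1"
    then have zz: "z * cnj z = 1" "cnj z * z = 1" by (simp_all add: complex_norm_square[symmetric] mult.commute)
    have "z ^ k * cnj (z ^ k) = 1" using zz by (simp add: power_mult_distrib[symmetric])
    then have zk: "z ^ k * (cnj (z ^ k) * x) = x" for x by (simp flip: mult.assoc)
    have "poly (\<Psi> (Suc k)) z = z ^ k * (z * cnj z) * cnj (poly (\<Phi> k) z) - \<alpha> k * z * (z ^ k * (cnj (z ^ k) * poly (\<Phi> k) z))"
      using z by (simp add: \<Psi>_circle \<Phi>_Suc algebra_simps)
    also have "\<dots> = poly (\<Psi> k) z - \<alpha> k * z * poly (\<Phi> k) z"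
      unfolding zz zk using z by (simp add: \<Psi>_circle)
    finally show "poly (\<Psi> (Suc k)) z = poly (\<Psi> k - smult (\<alpha> k) (pCons 0 (\<Phi> k))) z"
      by (simp add: mult.assoc)
  qed
  then show ?thesis by (simp add: mult.assoc)
qed

lemma \<Psi>_at_0: "poly (\<Psi> k) 0 = 1"
  by (induction k) (simp_all add: \<Psi>_0 \<Psi>_Suc)

text \<open>Pythagoras for z \<Phi>_k = \<Phi>_(k+1) + cnj \<alpha>_k \<Psi>_k, where z \<Phi>_k and
  \<Psi>_k both have the modulus of \<Phi>_k on the circle. The measure is arbitrary because the
  step serves \<mu> and the Bernstein-Szego measures alike.\<close>

lemma norm_step:
  assumes "finite_measure M" "sets M = sets circle_borel"
    and "(\<integral>z. cnj (poly (\<Psi> k) z) * poly (\<Phi> (Suc k)) z \<partial>M) = 0"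
  shows "(\<integral>z. (norm (poly (\<Phi> (Suc k)) z))\<^sup>2 \<partial>M) = (1 - (norm (\<alpha> k))\<^sup>2) * (\<integral>z. (norm (poly (\<Phi> k) z))\<^sup>2 \<partial>M)"
proof -
  note int = integrable_circle[OF assms(1,2)]
  have sp: "space M = sphere 0 1" by (rule sets_circle_borel_cong[OF assms(2)])
  have "(\<integral>z. Re (\<alpha> k * (cnj (poly (\<Psi> k) z) * poly (\<Phi> (Suc k)) z)) \<partial>M) = Re (\<integral>z. \<alpha> k * (cnj (poly (\<Psi> k) z) * poly (\<Phi> (Suc k)) z) \<partial>M)"
    by (intro integral_Re int continuous_intros)
  also have "\<dots> = 0" using assms(3) by simp
  finally have 0: "(\<integral>z. Re (\<alpha> k * (cnj (poly (\<Psi> k) z) * poly (\<Phi> (Suc k)) z)) \<partial>M) = 0" .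
  have "(\<integral>z. (norm (poly (\<Phi> k) z))\<^sup>2 \<partial>M) = (\<integral>z. ((norm (poly (\<Phi> (Suc k)) z))\<^sup>2 + (norm (\<alpha> k))\<^sup>2 * (norm (poly (\<Phi> k) z))\<^sup>2)
        + 2 * Re (\<alpha> k * (cnj (poly (\<Psi> k) z) * poly (\<Phi> (Suc k)) z)) \<partial>M)"
  proof (intro Bochner_Integration.integral_cong refl)
    fix z assume "z \<in> space M"
    then have z: "norm z = 1" by (simp add: sp)
    define p s where "p = poly (\<Phi> (Suc k)) z" and "s = poly (\<Psi> k) z"
    have "(norm (poly (\<Phi> k) z))\<^sup>2 = (norm (z * poly (\<Phi> k) z))\<^sup>2" using z by (simp add: norm_mult)
    also have "z * poly (\<Phi> k) z = p + cnj (\<alpha> k) * s" by (simp add: p_def s_def \<Phi>_Suc)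
    also have "(norm (p + cnj (\<alpha> k) * s))\<^sup>2 = (norm p)\<^sup>2 + (norm (\<alpha> k))\<^sup>2 * (norm s)\<^sup>2 + 2 * Re (\<alpha> k * (cnj s * p))"
      unfolding cmod_power2 by (simp add: algebra_simps power2_eq_square)
    finally show "(norm (poly (\<Phi> k) z))\<^sup>2 = ((norm (poly (\<Phi> (Suc k)) z))\<^sup>2 + (norm (\<alpha> k))\<^sup>2 * (norm (poly (\<Phi> k) z))\<^sup>2)
        + 2 * Re (\<alpha> k * (cnj (poly (\<Psi> k) z) * poly (\<Phi> (Suc k)) z))"
      using norm_\<Psi>_circle[OF z, of k] by (simp add: p_def s_def)
  qed
  also have "\<dots> = (\<integral>z. (norm (poly (\<Phi> (Suc k)) z))\<^sup>2 \<partial>M) + (norm (\<alpha> k))\<^sup>2 * (\<integral>z. (norm (poly (\<Phi> k) z))\<^sup>2 \<partial>M)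
       + 2 * (\<integral>z. Re (\<alpha> k * (cnj (poly (\<Psi> k) z) * poly (\<Phi> (Suc k)) z)) \<partial>M)"
  proof -
    have I: "integrable M (\<lambda>z. (norm (poly (\<Phi> (Suc k)) z))\<^sup>2)" "integrable M (\<lambda>z. (norm (\<alpha> k))\<^sup>2 * (norm (poly (\<Phi> k) z))\<^sup>2)"
      "integrable M (\<lambda>z. 2 * Re (\<alpha> k * (cnj (poly (\<Psi> k) z) * poly (\<Phi> (Suc k)) z)))"
      by (intro int continuous_intros)+
    show ?thesis
      by (simp only: Bochner_Integration.integral_add[OF Bochner_Integration.integrable_add[OF I(1,2)] I(3)]
          Bochner_Integration.integral_add[OF I(1,2)] integral_mult_right_zero)
  qed
  finally show ?thesis unfolding 0 by (simp add: algebra_simps)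
qed

end

locale szego_recursion = verblunsky_recursion +
  assumes norm_\<alpha>: "norm (\<alpha> k) < 1"
begin

text \<open>The two parts need each other: |x - \<alpha> y|^2 - |y - cnj \<alpha> x|^2 = (1 -
  |\<alpha>|^2) (|x|^2 - |y|^2) propagates the inequality, and the inequality together with
  |\<alpha>| < 1 keeps \<Psi> from vanishing. Thus \<Phi>_k / \<Psi>_k is a Schur function, up to
  the boundary.\<close>

lemma disc_bounds:
  assumes "norm z \<le> 1"
  shows "poly (\<Psi> k) z \<noteq> 0 \<and> norm (poly (\<Phi> k) z) \<le> norm (poly (\<Psi> k) z)"
proof (induction k)
  case (Suc k)
  define x y where "x = poly (\<Psi> k) z" and "y = z * poly (\<Phi> k) z"
  have "norm y \<le> 1 * norm (poly (\<Phi> k) z)" unfolding y_def norm_mult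
    using assms by (intro mult_right_mono) auto
  with Suc have x: "x \<noteq> 0" and y: "norm y \<le> norm x" by (auto simp: x_def)
  have "norm (\<alpha> k * y) < norm x"
    using norm_\<alpha>[of k] x y
    by (metis mult_left_mono mult_strict_right_mono norm_ge_zero norm_mult zero_less_norm_iff mult_1 order_le_less_trans)
  then have 1: "x - \<alpha> k * y \<noteq> 0" by auto
  have eq: "(norm (x - \<alpha> k * y))\<^sup>2 - (norm (y - cnj (\<alpha> k) * x))\<^sup>2 = (1 - (norm (\<alpha> k))\<^sup>2) * ((norm x)\<^sup>2 - (norm y)\<^sup>2)"
    unfolding cmod_power2 by (simp add: algebra_simps power2_eq_square)
  have "(1 - (norm (\<alpha> k))\<^sup>2) * ((norm x)\<^sup>2 - (norm y)\<^sup>2) \<ge> 0"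
    using norm_\<alpha>[of k] y by (intro mult_nonneg_nonneg) (auto simp: power_le_one less_imp_le)
  with eq have "(norm (y - cnj (\<alpha> k) * x))\<^sup>2 \<le> (norm (x - \<alpha> k * y))\<^sup>2" by linarith
  then have "norm (y - cnj (\<alpha> k) * x) \<le> norm (x - \<alpha> k * y)"
    by (rule power2_le_imp_le) simp
  with 1 show ?case by (simp add: x_def y_def \<Phi>_Suc \<Psi>_Suc mult.assoc)
qed (simp add: \<Phi>_0 \<Psi>_0)

lemmas \<Psi>_nonzero = disc_bounds[THEN conjunct1]

lemma \<Phi>_nonzero_circle: "norm z = 1 \<Longrightarrow> poly (\<Phi> k) z \<noteq> 0"
  using norm_\<Psi>_circle[of z k] \<Psi>_nonzero[of z k] by auto

definition h :: "nat \<Rightarrow> real" where "h N = (\<Prod>k<N. 1 - (norm (\<alpha> k))\<^sup>2)"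

lemma rho_pos: "1 - (norm (\<alpha> k))\<^sup>2 > 0"
  using norm_\<alpha>[of k] by (simp add: power_less_one_iff abs_square_less_1)

lemma h_pos: "h N > 0"
  unfolding h_def by (intro prod_pos rho_pos)

end

section \<open>The entropy of the Bernstein-Szego weights\<close>

context szego_recursion
begin

definition schur_fps :: "nat \<Rightarrow> complex fps" where
  "schur_fps k = fps_of_poly (\<Phi> k) * inverse (fps_of_poly (\<Psi> k))"

lemma fps_\<Psi>_nz: "fps_nth (fps_of_poly (\<Psi> k)) 0 \<noteq> 0"
  using \<Psi>_at_0[of k] by (simp add: poly_0_coeff_0)

lemma schur_fps_mult: "schur_fps k * fps_of_poly (\<Psi> k) = fps_of_poly (\<Phi> k)"
  by (simp add: schur_fps_def mult.assoc inverse_mult_eq_1[OF fps_\<Psi>_nz])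

lemma fps_\<Phi>_Suc: "fps_of_poly (\<Phi> (Suc k)) = fps_X * fps_of_poly (\<Phi> k) - fps_const (cnj (\<alpha> k)) * fps_of_poly (\<Psi> k)"
  by (subst recursion) (simp add: fps_of_poly_diff fps_of_poly_smult fps_of_poly_pCons mult.commute)

lemma fps_\<Psi>_Suc: "fps_of_poly (\<Psi> (Suc k)) = fps_of_poly (\<Psi> k) - fps_const (\<alpha> k) * fps_X * fps_of_poly (\<Phi> k)"
proof -
  have "\<Psi> (Suc k) = \<Psi> k - smult (\<alpha> k) (pCons 0 (\<Phi> k))"
    by (rule poly_eq_on_circle) (simp add: \<Psi>_Suc)
  then show ?thesis by (simp add: fps_of_poly_diff fps_of_poly_smult fps_of_poly_pCons mult_ac)
qed

text \<open>The quotient \<Phi>_(k+1) / \<Psi>_(k+1) with both recursions inserted and \<Psi>_k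
  cancelled, cleared of its denominator so that coefficients can be read off.\<close>

lemma schur_fps_riccati:
  "schur_fps (Suc k) = fps_X * schur_fps k - fps_const (cnj (\<alpha> k)) + fps_const (\<alpha> k) * fps_X * schur_fps k * schur_fps (Suc k)"
proof -
  let ?b = "schur_fps k" and ?b' = "schur_fps (Suc k)" and ?S = "fps_of_poly (\<Psi> k)"
  have "?b' * fps_of_poly (\<Psi> (Suc k)) = fps_of_poly (\<Phi> (Suc k))" by (rule schur_fps_mult)
  then have "?b' * (?S - fps_const (\<alpha> k) * fps_X * (?b * ?S)) = fps_X * (?b * ?S) - fps_const (cnj (\<alpha> k)) * ?S"
    unfolding fps_\<Phi>_Suc fps_\<Psi>_Suc schur_fps_mult .
  then have "(?b' - (fps_X * ?b - fps_const (cnj (\<alpha> k)) + fps_const (\<alpha> k) * fps_X * ?b * ?b')) * ?S = 0"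
    by (simp add: algebra_simps)
  moreover have "?S \<noteq> 0" using fps_\<Psi>_nz[of k] by auto
  ultimately show ?thesis by simp
qed

definition schur_arg :: "nat \<Rightarrow> complex \<Rightarrow> complex" where
  "schur_arg k z = \<alpha> k * z * (poly (\<Phi> k) z / poly (\<Psi> k) z)"

definition log_step :: "nat \<Rightarrow> complex \<Rightarrow> complex" where
  "log_step k z = Ln (1 - schur_arg k z)"

text \<open>Strictness on the closed disc keeps \<open>1 - schur_arg k z\<close> in the right
  half-plane, so the principal branch in \<open>log_step\<close> is continuous up to the
  circle.\<close>

lemma norm_schur_arg: assumes "norm z \<le> 1" shows "norm (schur_arg k z) < 1"
proof -
  have "norm z * (norm (poly (\<Phi> k) z) / norm (poly (\<Psi> k) z)) \<le> 1 * 1"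
    using disc_bounds[OF assms, of k] assms by (intro mult_mono) (auto simp: divide_le_eq_1)
  then have "norm (\<alpha> k) * (norm z * (norm (poly (\<Phi> k) z) / norm (poly (\<Psi> k) z))) \<le> norm (\<alpha> k) * 1"
    by (intro mult_left_mono) auto
  with norm_\<alpha>[of k] show ?thesis by (simp add: schur_arg_def norm_mult norm_divide mult.assoc)
qed

lemma Re_one_minus_schur_arg: assumes "norm z \<le> 1" shows "Re (1 - schur_arg k z) > 0"
  using norm_schur_arg[OF assms, of k] complex_Re_le_cmod[of "schur_arg k z"] by simp

lemma schur_arg_not_nonpos: assumes "norm z \<le> 1" shows "1 - schur_arg k z \<notin> \<real>\<^sub>\<le>\<^sub>0"
  using Re_one_minus_schur_arg[OF assms, of k] by (auto simp: complex_nonpos_Reals_iff)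

lemma poly_holomorphic: "(\<lambda>z. poly p z) holomorphic_on S" for p :: "complex poly"
  by (meson holomorphic_on_def field_differentiable_def poly_DERIV field_differentiable_at_within)

lemma schur_arg_holomorphic: "schur_arg k holomorphic_on ball 0 1"
  unfolding schur_arg_def[abs_def] using \<Psi>_nonzero
  by (intro holomorphic_intros poly_holomorphic) auto

lemma schur_arg_continuous: "continuous_on (cball 0 1) (schur_arg k)"
  unfolding schur_arg_def[abs_def] using \<Psi>_nonzero
  by (intro continuous_intros) auto

lemma log_step_holomorphic: "log_step k holomorphic_on ball 0 1"
  unfolding log_step_def[abs_def] using schur_arg_not_nonpos
  by (intro holomorphic_intros schur_arg_holomorphic) auto

lemma log_step_continuous: "continuous_on (cball 0 1) (log_step k)"
  unfolding log_step_def[abs_def] using schur_arg_not_nonpos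
  by (intro continuous_intros schur_arg_continuous) auto

definition log_fps :: "nat \<Rightarrow> complex fps" where
  "log_fps k = fps_expansion (log_step k) 0"

lemma log_step_expansion: "log_step k has_fps_expansion log_fps k"
  unfolding log_fps_def using log_step_holomorphic[of k]
  by (intro analytic_at_imp_has_fps_expansion_0) (auto simp: analytic_at intro!: exI[of _ "ball 0 1"])

lemma poly_expansion: "(\<lambda>z. poly p z) has_fps_expansion fps_of_poly p" for p :: "complex poly"
proof (induction p)
  case (pCons c p)
  have "(\<lambda>z. c + z * poly p z) has_fps_expansion fps_const c + fps_X * fps_of_poly p"
    by (intro has_fps_expansion_add has_fps_expansion_const has_fps_expansion_mult has_fps_expansion_fps_X pCons.IH)
  then show ?case by (simp add: fps_of_poly_pCons mult.commute add.commute)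
qed simp

lemma schur_arg_expansion: "schur_arg k has_fps_expansion fps_const (\<alpha> k) * fps_X * schur_fps k"
proof -
  have "(\<lambda>z. \<alpha> k * z * (poly (\<Phi> k) z * inverse (poly (\<Psi> k) z))) has_fps_expansion fps_const (\<alpha> k) * fps_X * schur_fps k"
    unfolding schur_fps_def
    by (intro has_fps_expansion_mult has_fps_expansion_inverse poly_expansion fps_\<Psi>_nz
        has_fps_expansion_const has_fps_expansion_fps_X)
  then show ?thesis by (simp add: schur_arg_def[abs_def] divide_inverse)
qed

text \<open>The relation (1 - U) f' = - U' holds for the analytic functions near 0 and passes to
  their unique expansions, so no series has to be substituted into the logarithm.\<close>

lemma log_fps_ode:
  "fps_deriv (log_fps k) = - fps_deriv (fps_const (\<alpha> k) * fps_X * schur_fps k)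
     + fps_const (\<alpha> k) * fps_X * schur_fps k * fps_deriv (log_fps k)"
proof -
  let ?U = "fps_const (\<alpha> k) * fps_X * schur_fps k"
  have e1: "(\<lambda>z. - deriv (schur_arg k) z + schur_arg k z * deriv (log_step k) z) has_fps_expansion
      - fps_deriv ?U + ?U * fps_deriv (log_fps k)"
    by (intro has_fps_expansion_add has_fps_expansion_minus has_fps_expansion_mult has_fps_expansion_deriv
        schur_arg_expansion log_step_expansion)
  have e2: "eventually (\<lambda>z. - deriv (schur_arg k) z + schur_arg k z * deriv (log_step k) z = deriv (log_step k) z) (nhds 0)"
  proof (rule eventually_mono[OF eventually_nhds_in_open[of "ball 0 1"]])
    fix z :: complex assume z: "z \<in> ball 0 1"
    then have nz: "norm z \<le> 1" by simp
    have "schur_arg k field_differentiable at z"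
      using schur_arg_holomorphic z by (meson holomorphic_on_imp_differentiable_at open_ball)
    then have d: "(schur_arg k has_field_derivative deriv (schur_arg k) z) (at z)"
      by (simp add: DERIV_deriv_iff_field_differentiable)
    have "(log_step k has_field_derivative - deriv (schur_arg k) z / (1 - schur_arg k z)) (at z)"
      unfolding log_step_def[abs_def] using schur_arg_not_nonpos[OF nz, of k]
      by (auto intro!: derivative_eq_intros d simp: divide_inverse mult.commute)
    then have "deriv (log_step k) z = - deriv (schur_arg k) z / (1 - schur_arg k z)"
      by (rule DERIV_imp_deriv)
    moreover have "1 - schur_arg k z \<noteq> 0" using schur_arg_not_nonpos[OF nz, of k] by auto
    ultimately show "- deriv (schur_arg k) z + schur_arg k z * deriv (log_step k) z = deriv (log_step k) z"
      by (simp add: field_simps)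
  qed auto
  from has_fps_expansion_cong[OF e2 refl, THEN iffD1, OF e1]
  have "deriv (log_step k) has_fps_expansion - fps_deriv ?U + ?U * fps_deriv (log_fps k)" .
  with has_fps_expansion_deriv[OF log_step_expansion[of k]] show ?thesis
    by (rule fps_expansion_unique_complex)
qed

lemma log_step_0: "log_step k 0 = 0"
  by (simp add: log_step_def schur_arg_def)

text \<open>On the circle |\<Phi>| = |\<Psi>|, and \<Psi>_(N+1) is \<Psi>_N times
  \<open>1 - schur_arg N z\<close>. Only real parts of logarithms are added, so branches do not
  interfere.\<close>

lemma ln_\<Phi>:
  assumes z: "norm z = 1"
  shows "ln ((norm (poly (\<Phi> N) z))\<^sup>2 / h N) = (\<Sum>k<N. 2 * Re (log_step k z) - ln (1 - (norm (\<alpha> k))\<^sup>2))"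
proof (induction N)
  case 0
  show ?case by (simp add: \<Phi>_0 h_def)
next
  case (Suc N)
  have nz: "norm z \<le> 1" using z by simp
  have 1: "1 - schur_arg N z \<noteq> 0" using schur_arg_not_nonpos[OF nz, of N] by auto
  have "poly (\<Psi> (Suc N)) z = poly (\<Psi> N) z * (1 - schur_arg N z)"
    using \<Psi>_nonzero[OF nz, of N] by (simp add: \<Psi>_Suc schur_arg_def field_simps)
  then have "(norm (poly (\<Phi> (Suc N)) z))\<^sup>2 = (norm (poly (\<Phi> N) z))\<^sup>2 * (norm (1 - schur_arg N z))\<^sup>2"
    using z by (simp add: norm_\<Psi>_circle[symmetric] norm_mult power_mult_distrib)
  then have "(norm (poly (\<Phi> (Suc N)) z))\<^sup>2 / h (Suc N)
      = ((norm (poly (\<Phi> N) z))\<^sup>2 / h N) * ((norm (1 - schur_arg N z))\<^sup>2 / (1 - (norm (\<alpha> N))\<^sup>2))"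
    by (simp add: h_def)
  moreover have "(norm (poly (\<Phi> N) z))\<^sup>2 / h N > 0"
    using \<Phi>_nonzero_circle[OF z, of N] h_pos[of N] by simp
  moreover have "(norm (1 - schur_arg N z))\<^sup>2 > 0" using 1 by simp
  ultimately have "ln ((norm (poly (\<Phi> (Suc N)) z))\<^sup>2 / h (Suc N)) = ln ((norm (poly (\<Phi> N) z))\<^sup>2 / h N)
      + (ln ((norm (1 - schur_arg N z))\<^sup>2) - ln (1 - (norm (\<alpha> N))\<^sup>2))"
    using rho_pos[of N] by (simp only: ln_mult_pos ln_divide_pos divide_pos_pos)
  also have "ln ((norm (1 - schur_arg N z))\<^sup>2) = 2 * Re (log_step N z)"
    using 1 by (simp add: log_step_def ln_realpow)
  finally show ?case using Suc by simp
qed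

text \<open>The factor 2 cancels the 1/2 of \<open>integral_circle_cos\<close>, and
  \<open>log_step k 0 = 0\<close> leaves only c at frequency zero.\<close>

lemma integral_step:
  "(LINT \<theta>|angle_measure. cos_poly n a \<theta> * (2 * Re (log_step k (cis \<theta>)) + c))
     = (\<Sum>l=1..n. a l * Re (fps_nth (log_fps k) l)) + a 0 * c"
proof -
  define G where "G z = 2 * log_step k z + of_real c" for z
  have contG: "continuous_on (cball 0 1) G" and holG: "G holomorphic_on ball 0 1"
    unfolding G_def by (intro continuous_intros log_step_continuous holomorphic_intros log_step_holomorphic)+
  have cG: "continuous_on UNIV (\<lambda>\<theta>. G (cis \<theta>))"
    by (intro continuous_on_cis_comp continuous_on_subset[OF contG]) auto
  have fpsG: "G has_fps_expansion fps_const 2 * log_fps k + fps_const (of_real c)"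
    unfolding G_def by (intro has_fps_expansion_add has_fps_expansion_mult has_fps_expansion_const log_step_expansion)
  have "(LINT \<theta>|angle_measure. cos_poly n a \<theta> * (2 * Re (log_step k (cis \<theta>)) + c))
     = (LINT \<theta>|angle_measure. (\<Sum>l\<le>n. a l * (cos (real l * \<theta>) * Re (G (cis \<theta>)))))"
    by (intro Bochner_Integration.integral_cong refl) (simp add: cos_poly_def G_def sum_distrib_right mult_ac)
  also have "\<dots> = (\<Sum>l\<le>n. (LINT \<theta>|angle_measure. a l * (cos (real l * \<theta>) * Re (G (cis \<theta>)))))"
    by (intro Bochner_Integration.integral_sum integral_angle continuous_intros cG)
  also have "\<dots> = (\<Sum>l\<le>n. a l * (LINT \<theta>|angle_measure. cos (real l * \<theta>) * Re (G (cis \<theta>))))"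
    by (simp only: integral_mult_right_zero)
  also have "\<dots> = a 0 * (LINT \<theta>|angle_measure. Re (G (cis \<theta>))) + (\<Sum>l=1..n. a l * (LINT \<theta>|angle_measure. cos (real l * \<theta>) * Re (G (cis \<theta>))))"
    by (simp add: atMost_atLeast0 sum.atLeast_Suc_atMost)
  also have "(LINT \<theta>|angle_measure. Re (G (cis \<theta>))) = Re (LINT \<theta>|angle_measure. G (cis \<theta>))"
    by (intro integral_Re integral_angle cG)
  also have "(LINT \<theta>|angle_measure. G (cis \<theta>)) = G 0"
    by (rule integral_circle_mean[OF contG holG])
  also have "Re (G 0) = c" by (simp add: G_def log_step_0)
  also have "(\<Sum>l=1..n. a l * (LINT \<theta>|angle_measure. cos (real l * \<theta>) * Re (G (cis \<theta>)))) = (\<Sum>l=1..n. a l * Re (fps_nth (log_fps k) l))"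
  proof (intro sum.cong refl arg_cong2[where f = times], goal_cases)
    case (1 l)
    then show ?case by (subst integral_circle_cos[OF contG holG fpsG]) auto
  qed
  finally show ?thesis by simp
qed

lemma entropy_sum:
  "(LINT \<theta>|angle_measure. cos_poly n a \<theta> * ln ((norm (poly (\<Phi> N) (cis \<theta>)))\<^sup>2 / h N))
    = (\<Sum>k<N. (\<Sum>l=1..n. a l * Re (fps_nth (log_fps k) l)) + a 0 * (- ln (1 - (norm (\<alpha> k))\<^sup>2)))"
proof -
  have "(LINT \<theta>|angle_measure. cos_poly n a \<theta> * ln ((norm (poly (\<Phi> N) (cis \<theta>)))\<^sup>2 / h N))
     = (LINT \<theta>|angle_measure. (\<Sum>k<N. cos_poly n a \<theta> * (2 * Re (log_step k (cis \<theta>)) + - ln (1 - (norm (\<alpha> k))\<^sup>2))))"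
    by (intro Bochner_Integration.integral_cong refl) (simp add: ln_\<Phi> sum_distrib_left)
  also have "\<dots> = (\<Sum>k<N. (LINT \<theta>|angle_measure. cos_poly n a \<theta> * (2 * Re (log_step k (cis \<theta>)) + - ln (1 - (norm (\<alpha> k))\<^sup>2))))"
  proof (intro Bochner_Integration.integral_sum integral_angle continuous_intros)
    show "continuous_on UNIV (cos_poly n a)"
      unfolding cos_poly_def[abs_def] by (intro continuous_intros)
    show "continuous_on UNIV (\<lambda>\<theta>. log_step k (cis \<theta>))" for k
      by (intro continuous_on_cis_comp continuous_on_subset[OF log_step_continuous]) auto
  qed
  finally show ?thesis by (simp only: integral_step)
qed

lemma entropy_equiv:
  assumes "summable (\<lambda>k. norm (\<alpha> k) ^ 6)" "summable (\<lambda>k. norm (\<alpha> (Suc k) - \<alpha> k) ^ 3)"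
    and "a 0 / 2 = (\<Sum>l=1..n. ((real l)\<^sup>2 - 1) / 2 * a l)"
    and "\<And>\<theta>. (cmod (\<Sum>l\<le>n. of_real (b l) * cis \<theta> ^ l))\<^sup>2 = cos_poly n a \<theta>"
  shows "in_lp 2 (shift_poly n b \<alpha>) \<longleftrightarrow>
     (\<exists>K. \<forall>N. (LINT \<theta>|angle_measure. cos_poly n a \<theta> * ln ((norm (poly (\<Phi> N) (cis \<theta>)))\<^sup>2 / h N)) \<le> K)"
proof -
  obtain e where "slowly_varying \<alpha> e" using slowly_varying_exists[OF assms(1,2)] by blast
  then interpret slowly_varying \<alpha> e .
  interpret schur_riccati \<alpha> e schur_fps log_fps
    by unfold_locales (rule schur_fps_riccati log_fps_ode)+
  have "(\<lambda>k. (norm (shift_poly n b \<alpha> k))\<^sup>2) \<simeq> (\<lambda>k. \<Sum>l\<le>n. a l * Re (\<alpha> k * cnj (\<alpha> (k - l))))"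
  proof -
    have "(\<Sum>l\<le>n. (\<Sum>i\<le>n. \<Sum>j\<le>n. if (i - j) + (j - i) = l then b i * b j else 0) * x l) = (\<Sum>l\<le>n. a l * x l)" for x
      by (intro sum.cong refl) (simp add: cos_poly_coeffs[OF assms(4)])
    with shift_poly_equiv[of n b] show ?thesis by (simp only:)
  qed
  from bdd_equiv_trans[OF step_equiv[OF assms(3)] bdd_equiv_sym[OF this]]
  show ?thesis unfolding in_lp_def entropy_sum by (rule bdd_equiv_summable_iff) simp
qed

end

section \<open>Orthogonal polynomials of a measure on the circle\<close>

text \<open>Restricting the hypothesis to nonzero coefficients matters in
  \<open>recursion_verblunsky\<close>, where the constant term is absent and orthogonality to 1 is
  not at hand.\<close>

lemma integral_cnj_poly:
  assumes "finite_measure M" "sets M = sets circle_borel" "continuous_on (sphere 0 1) f"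
    and "\<And>j. j \<le> degree p \<Longrightarrow> coeff p j \<noteq> 0 \<Longrightarrow> (\<integral>z. cnj (z ^ j) * f z \<partial>M) = 0"
  shows "(\<integral>z. cnj (poly p z) * f z \<partial>M) = 0"
proof -
  have "(\<integral>z. cnj (poly p z) * f z \<partial>M) = (\<integral>z. (\<Sum>j\<le>degree p. cnj (coeff p j) * (cnj (z ^ j) * f z)) \<partial>M)"
    by (simp add: poly_altdef cnj_sum sum_distrib_right mult.assoc)
  also have "\<dots> = (\<Sum>j\<le>degree p. (\<integral>z. cnj (coeff p j) * (cnj (z ^ j) * f z) \<partial>M))"
    by (intro Bochner_Integration.integral_sum integrable_circle assms(1,2) continuous_intros assms(3))
  also have "\<dots> = (\<Sum>j\<le>degree p. cnj (coeff p j) * (\<integral>z. cnj (z ^ j) * f z \<partial>M))"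
    by (simp only: integral_mult_right_zero)
  also have "\<dots> = 0" using assms(4) by (intro sum.neutral) auto
  finally show ?thesis .
qed

lemma cnj_power_mult:
  assumes "norm z = 1" "j \<le> k" shows "cnj (z ^ j) * z ^ k = z ^ (k - j)"
proof -
  have "cnj z * z = 1" using assms(1) by (simp add: complex_norm_square[symmetric] mult.commute)
  then have "cnj (z ^ j) * z ^ j = 1" by (simp add: power_mult_distrib[symmetric])
  moreover have "z ^ k = z ^ j * z ^ (k - j)" using assms(2) by (simp flip: power_add)
  ultimately show ?thesis by (simp flip: mult.assoc)
qed

locale circle_opuc =
  fixes \<mu> :: "complex measure" and \<Phi> :: "nat \<Rightarrow> complex poly"
  assumes prob_on_circle: "prob_on_circle \<mu>" and infinite_support: "infinite (msupport \<mu>)"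
    and monic_orthogonal: "monic_orthogonal_polynomials \<mu> \<Phi>"
begin

lemma prob_space_\<mu>: "prob_space \<mu>" and sets_\<mu>: "sets \<mu> = sets circle_borel"
  using prob_on_circle by (auto simp: prob_on_circle_def)

lemma finite_\<mu>: "finite_measure \<mu>"
  using prob_space_\<mu> by (simp add: prob_space_def)

lemma space_\<mu>: "space \<mu> = sphere 0 1"
  by (rule sets_circle_borel_cong[OF sets_\<mu>])

lemma degree_monic: "degree (\<Phi> k) = k" and lead_monic: "lead_coeff (\<Phi> k) = 1"
  and orthogonal: "j \<noteq> k \<Longrightarrow> (\<integral>z. cnj (poly (\<Phi> j) z) * poly (\<Phi> k) z \<partial>\<mu>) = 0"
  using monic_orthogonal unfolding monic_orthogonal_polynomials_def by blast+

lemma split_lead: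
  assumes "p \<noteq> 0"
  obtains r where "p = smult (lead_coeff p) (\<Phi> (degree p)) + r" "r = 0 \<or> degree r < degree p"
proof -
  define r where "r = p - smult (lead_coeff p) (\<Phi> (degree p))"
  have "degree r \<le> degree p" unfolding r_def
    by (intro degree_diff_le order.trans[OF degree_smult_le]) (auto simp: degree_monic)
  moreover have "coeff r (degree p) = 0"
    using lead_monic[of "degree p"] by (simp add: r_def degree_monic)
  ultimately have "r = 0 \<or> degree r < degree p" by (rule eq_zero_or_degree_less)
  then show ?thesis using that[of r] by (simp add: r_def)
qed

lemma orthogonal_lower:
  assumes "degree p < k" shows "(\<integral>z. cnj (poly p z) * poly (\<Phi> k) z \<partial>\<mu>) = 0"
  using assms
proof (induction "degree p" arbitrary: p rule: less_induct)
  case less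
  show ?case
  proof (cases "p = 0")
    case False
    then obtain r where r: "p = smult (lead_coeff p) (\<Phi> (degree p)) + r" "r = 0 \<or> degree r < degree p"
      by (rule split_lead)
    have "(\<integral>z. cnj (poly p z) * poly (\<Phi> k) z \<partial>\<mu>) =
        (\<integral>z. cnj (lead_coeff p) * (cnj (poly (\<Phi> (degree p)) z) * poly (\<Phi> k) z) + cnj (poly r z) * poly (\<Phi> k) z \<partial>\<mu>)"
      by (subst r(1)) (simp add: algebra_simps)
    also have "\<dots> = cnj (lead_coeff p) * (\<integral>z. cnj (poly (\<Phi> (degree p)) z) * poly (\<Phi> k) z \<partial>\<mu>) + (\<integral>z. cnj (poly r z) * poly (\<Phi> k) z \<partial>\<mu>)"
      by (subst Bochner_Integration.integral_add)
        (auto intro!: integrable_circle finite_\<mu> sets_\<mu> continuous_intros)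
    also have "(\<integral>z. cnj (poly r z) * poly (\<Phi> k) z \<partial>\<mu>) = 0"
      using r(2) less by (cases "r = 0") auto
    finally show ?thesis using less.prems by (simp add: orthogonal)
  qed simp
qed

lemma orthogonal_power: "j < k \<Longrightarrow> (\<integral>z. cnj (z ^ j) * poly (\<Phi> k) z \<partial>\<mu>) = 0"
  using orthogonal_lower[of "monom 1 j" k] by (simp add: poly_monom degree_monom_eq)

text \<open>A nonzero polynomial has finitely many zeros, so some point of the support is not one of
  them; the open set of non-zeros around it has positive mass.\<close>

lemma nondegenerate:
  assumes "(\<integral>z. (norm (poly p z))\<^sup>2 \<partial>\<mu>) = 0" shows "p = 0"
proof (rule ccontr)
  assume "p \<noteq> 0"
  then have "finite {z. poly p z = 0}" by (rule poly_roots_finite)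
  with infinite_support have "\<not> msupport \<mu> \<subseteq> {z. poly p z = 0}" using finite_subset by blast
  then obtain z where z: "z \<in> msupport \<mu>" "poly p z \<noteq> 0" by blast
  define U where "U = {z. poly p z \<noteq> 0}"
  have "U = - (poly p -` {0})" by (auto simp: U_def)
  moreover have "closed (poly p -` {0})" by (intro continuous_closed_vimage) auto
  ultimately have "open U" by auto
  have ae: "AE z in \<mu>. (norm (poly p z))\<^sup>2 = 0"
    using assms by (subst (asm) integral_nonneg_eq_0_iff_AE)
      (auto intro!: integrable_circle finite_\<mu> sets_\<mu> continuous_intros)
  have U: "U \<inter> space \<mu> \<in> sets \<mu>"
    using \<open>open U\<close> unfolding sets_\<mu> space_\<mu> circle_borel_def sets_restrict_space
    by (intro image_eqI[of _ _ U]) auto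
  have "{z \<in> space \<mu>. \<not> (norm (poly p z))\<^sup>2 = 0} = U \<inter> space \<mu>" by (auto simp: U_def)
  from AE_iff_measurable[OF U this] ae have "emeasure \<mu> (U \<inter> space \<mu>) = 0" by simp
  moreover have "emeasure \<mu> (U \<inter> space \<mu>) > 0"
    using z \<open>open U\<close> by (auto simp: msupport_def U_def)
  ultimately show False by simp
qed

text \<open>The difference D of the two sides has degree at most k, vanishes at 0 by the choice of
  c, and is orthogonal to z, ..., z^k. It is therefore orthogonal to itself, and
  \<open>nondegenerate\<close> applies.\<close>

lemma recursion_verblunsky:
  "\<Phi> (Suc k) = pCons 0 (\<Phi> k) - smult (cnj (verblunsky \<Phi> k)) (reversed \<Phi> k)"
proof -
  define c where "c = cnj (verblunsky \<Phi> k)"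
  define D where "D = \<Phi> (Suc k) - pCons 0 (\<Phi> k) + smult c (reversed \<Phi> k)"
  have rev: "poly (reversed \<Phi> k) z = z ^ k * cnj (poly (\<Phi> k) z)" if "norm z = 1" for z
    using that by (simp add: reversed_def poly_reverse_circle degree_monic)
  have "poly (reversed \<Phi> k) 0 = 1"
    using lead_monic[of k] by (simp add: reversed_def poly_reflect_poly_0 degree_map_poly coeff_map_poly)
  then have "poly D 0 = 0" by (simp add: D_def c_def verblunsky_def)
  then have D_0: "coeff D 0 = 0" by (simp only: poly_0_coeff_0)
  have "degree (\<Phi> (Suc k) - pCons 0 (\<Phi> k)) \<le> Suc k"
    by (intro degree_diff_le order.trans[OF degree_pCons_le]) (auto simp: degree_monic)
  moreover have "coeff (\<Phi> (Suc k) - pCons 0 (\<Phi> k)) (Suc k) = 0"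
    using lead_monic[of k] lead_monic[of "Suc k"] by (simp add: degree_monic)
  ultimately have "degree (\<Phi> (Suc k) - pCons 0 (\<Phi> k)) \<le> k"
    by (metis eq_zero_or_degree_less degree_0 le0 less_Suc_eq_le)
  moreover have "degree (reversed \<Phi> k) \<le> k"
    using degree_reflect_poly_le[of "map_poly cnj (\<Phi> k)"] by (simp add: reversed_def degree_map_poly degree_monic)
  ultimately have deg: "degree D \<le> k"
    unfolding D_def by (intro degree_add_le order.trans[OF degree_smult_le]) auto
  note int = integrable_circle[OF finite_\<mu> sets_\<mu>]
  have mono: "(\<integral>z. cnj (z ^ j) * poly D z \<partial>\<mu>) = 0" if j: "1 \<le> j" "j \<le> k" for j
  proof -
    have a: "(\<integral>z. cnj (z ^ j) * poly (\<Phi> (Suc k)) z \<partial>\<mu>) = 0"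
      using j by (intro orthogonal_power) simp
    have "(\<integral>z. cnj (z ^ j) * (z * poly (\<Phi> k) z) \<partial>\<mu>) = (\<integral>z. cnj (z ^ (j - 1)) * poly (\<Phi> k) z \<partial>\<mu>)"
    proof (intro Bochner_Integration.integral_cong refl)
      fix z assume "z \<in> space \<mu>"
      then have "norm z = 1" by (simp add: space_\<mu>)
      then have "cnj z * z = 1" by (simp add: complex_norm_square[symmetric] mult.commute)
      have "cnj (z ^ j) = cnj (z ^ (j - 1)) * cnj z" using j by (cases j) (simp_all add: mult.commute)
      then have "cnj (z ^ j) * (z * poly (\<Phi> k) z) = cnj (z ^ (j - 1)) * (cnj z * z) * poly (\<Phi> k) z"
        by (simp only: mult.assoc)
      then show "cnj (z ^ j) * (z * poly (\<Phi> k) z) = cnj (z ^ (j - 1)) * poly (\<Phi> k) z"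
        by (simp only: \<open>cnj z * z = 1\<close> mult_1_right)
    qed
    also have "\<dots> = 0" using j by (intro orthogonal_power) simp
    finally have b: "(\<integral>z. cnj (z ^ j) * (z * poly (\<Phi> k) z) \<partial>\<mu>) = 0" .
    \<comment> \<open>On the circle \<open>cnj (z ^ j)\<close> times \<Psi>_k is the conjugate of
      \<open>cnj (z ^ (k - j))\<close> times \<Phi>_k; j \<ge> 1 gives k - j < k.\<close>
    have "(\<integral>z. cnj (z ^ j) * poly (reversed \<Phi> k) z \<partial>\<mu>) = (\<integral>z. cnj (cnj (z ^ (k - j)) * poly (\<Phi> k) z) \<partial>\<mu>)"
      using j by (intro Bochner_Integration.integral_cong refl)
        (simp add: rev space_\<mu> cnj_power_mult flip: mult.assoc complex_cnj_power)
    also have "\<dots> = cnj (\<integral>z. cnj (z ^ (k - j)) * poly (\<Phi> k) z \<partial>\<mu>)"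
      by (rule Bochner_Integration.integral_cnj)
    also have "\<dots> = 0" using j by (subst orthogonal_power) auto
    finally have c: "(\<integral>z. cnj (z ^ j) * poly (reversed \<Phi> k) z \<partial>\<mu>) = 0" .
    have "(\<integral>z. cnj (z ^ j) * poly D z \<partial>\<mu>) = (\<integral>z. (cnj (z ^ j) * poly (\<Phi> (Suc k)) z - cnj (z ^ j) * (z * poly (\<Phi> k) z))
        + c * (cnj (z ^ j) * poly (reversed \<Phi> k) z) \<partial>\<mu>)"
      by (simp add: D_def algebra_simps)
    also have "\<dots> = (\<integral>z. cnj (z ^ j) * poly (\<Phi> (Suc k)) z \<partial>\<mu>) - (\<integral>z. cnj (z ^ j) * (z * poly (\<Phi> k) z) \<partial>\<mu>)
        + c * (\<integral>z. cnj (z ^ j) * poly (reversed \<Phi> k) z \<partial>\<mu>)"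
    proof -
      have I: "integrable \<mu> (\<lambda>z. cnj (z ^ j) * poly (\<Phi> (Suc k)) z)" "integrable \<mu> (\<lambda>z. cnj (z ^ j) * (z * poly (\<Phi> k) z))"
        "integrable \<mu> (\<lambda>z. c * (cnj (z ^ j) * poly (reversed \<Phi> k) z))"
        by (intro int continuous_intros)+
      show ?thesis
        by (simp only: Bochner_Integration.integral_add[OF Bochner_Integration.integrable_diff[OF I(1,2)] I(3)]
          Bochner_Integration.integral_diff[OF I(1,2)] integral_mult_right_zero)
    qed
    finally show ?thesis by (simp add: a b c del: complex_cnj_power)
  qed
  have "(\<integral>z. cnj (poly D z) * poly D z \<partial>\<mu>) = 0"
  proof (rule integral_cnj_poly[OF finite_\<mu> sets_\<mu>])
    fix j assume "j \<le> degree D" "coeff D j \<noteq> 0"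
    then show "(\<integral>z. cnj (z ^ j) * poly D z \<partial>\<mu>) = 0"
      using D_0 deg by (intro mono) (cases j, auto)
  qed (intro continuous_intros)
  moreover have "complex_of_real ((norm z)\<^sup>2) = cnj z * z" for z
    by (simp only: complex_norm_square mult.commute)
  ultimately have "complex_of_real (\<integral>z. (norm (poly D z))\<^sup>2 \<partial>\<mu>) = 0"
    by (simp only: integral_complex_of_real[symmetric])
  then have "D = 0" by (intro nondegenerate) (simp only: of_real_eq_0_iff)
  moreover have "\<Phi> (Suc k) = D + (pCons 0 (\<Phi> k) - smult c (reversed \<Phi> k))"
    by (simp add: D_def)
  ultimately show ?thesis unfolding c_def by simp
qed

sublocale verblunsky_recursion \<Phi> "verblunsky \<Phi>"
  using degree_monic lead_monic recursion_verblunsky by unfold_locales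

lemma norm_step_\<mu>:
  "(\<integral>z. (norm (poly (\<Phi> (Suc k)) z))\<^sup>2 \<partial>\<mu>) = (1 - (norm (verblunsky \<Phi> k))\<^sup>2) * (\<integral>z. (norm (poly (\<Phi> k) z))\<^sup>2 \<partial>\<mu>)"
proof (rule norm_step[OF finite_\<mu> sets_\<mu>], rule orthogonal_lower)
  show "degree (reversed \<Phi> k) < Suc k"
    using degree_reflect_poly_le[of "map_poly cnj (\<Phi> k)"] by (simp add: reversed_def degree_map_poly degree_monic)
qed

lemma norm_pos: "(\<integral>z. (norm (poly (\<Phi> k) z))\<^sup>2 \<partial>\<mu>) > 0"
proof -
  have "\<Phi> k \<noteq> 0" using lead_monic[of k] by auto
  then have "(\<integral>z. (norm (poly (\<Phi> k) z))\<^sup>2 \<partial>\<mu>) \<noteq> 0" using nondegenerate by blast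
  moreover have "(\<integral>z. (norm (poly (\<Phi> k) z))\<^sup>2 \<partial>\<mu>) \<ge> 0" by (intro integral_nonneg_AE) auto
  ultimately show ?thesis by linarith
qed

sublocale szego_recursion \<Phi> "verblunsky \<Phi>"
proof
  fix k
  have "1 - (norm (verblunsky \<Phi> k))\<^sup>2 > 0"
    using norm_step_\<mu>[of k] norm_pos[of k] norm_pos[of "Suc k"] by (simp add: zero_less_mult_iff)
  then have "(norm (verblunsky \<Phi> k))\<^sup>2 < 1\<^sup>2" by simp
  then show "norm (verblunsky \<Phi> k) < 1" by (rule power2_less_imp_less) simp
qed

lemma h_eq: "(\<integral>z. (norm (poly (\<Phi> k) z))\<^sup>2 \<partial>\<mu>) = h k"
proof (induction k)
  case 0
  then show ?case using prob_space.prob_space[OF prob_space_\<mu>] by (simp add: h_def \<Phi>_0)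
next
  case (Suc k)
  then show ?case by (simp add: norm_step_\<mu> h_def)
qed

end

section \<open>Bernstein-Szego measures and moment matching\<close>

context szego_recursion
begin

definition bs_weight :: "nat \<Rightarrow> complex \<Rightarrow> real" where
  "bs_weight N z = h N / (norm (poly (\<Phi> N) z))\<^sup>2"

definition bs_measure :: "nat \<Rightarrow> complex measure" where
  "bs_measure N = distr (density angle_measure (\<lambda>\<theta>. ennreal (bs_weight N (cis \<theta>)))) circle_borel cis"

lemma sets_bs: "sets (bs_measure N) = sets circle_borel"
  by (simp add: bs_measure_def)

lemma bs_weight_pos: "norm z = 1 \<Longrightarrow> bs_weight N z > 0"
  using h_pos[of N] \<Phi>_nonzero_circle[of z N] by (simp add: bs_weight_def)

lemma continuous_bs_weight: "continuous_on (sphere 0 1) (bs_weight N)"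
  unfolding bs_weight_def by (intro continuous_intros) (auto simp: \<Phi>_nonzero_circle)

lemma borel_bs_weight: "(\<lambda>\<theta>. bs_weight N (cis \<theta>)) \<in> borel_measurable borel"
  by (intro borel_measurable_continuous_onI continuous_on_cis_comp continuous_bs_weight)

lemma integral_bs:
  fixes f :: "complex \<Rightarrow> 'a::euclidean_space"
  assumes "continuous_on (sphere 0 1) f"
  shows "(\<integral>z. f z \<partial>bs_measure N) = (LINT \<theta>|angle_measure. bs_weight N (cis \<theta>) *\<^sub>R f (cis \<theta>))"
proof -
  have "f \<in> borel_measurable circle_borel"
    unfolding circle_borel_def using assms by (rule borel_measurable_continuous_on_restrict)
  then have "(\<integral>z. f z \<partial>bs_measure N) = (LINT \<theta>|density angle_measure (\<lambda>\<theta>. ennreal (bs_weight N (cis \<theta>))). f (cis \<theta>))"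
    unfolding bs_measure_def using cis_measurable by (intro integral_distr) auto
  also have "\<dots> = (LINT \<theta>|angle_measure. bs_weight N (cis \<theta>) *\<^sub>R f (cis \<theta>))"
    using borel_bs_weight borel_measurable_continuous_onI[OF continuous_on_cis_comp[OF assms]]
    by (intro integral_density) (auto simp: bs_weight_pos less_imp_le uniform_measure_def)
  finally show ?thesis .
qed

lemma finite_bs: "finite_measure (bs_measure N)"
proof
  have i: "integrable angle_measure (\<lambda>\<theta>. bs_weight N (cis \<theta>))"
    by (intro integral_angle continuous_on_cis_comp continuous_bs_weight)
  have m: "(\<lambda>\<theta>. ennreal (bs_weight N (cis \<theta>))) \<in> borel_measurable angle_measure"
    using borel_bs_weight[of N] by (simp add: uniform_measure_def)
  have "emeasure (bs_measure N) (space (bs_measure N)) = emeasure (density angle_measure (\<lambda>\<theta>. ennreal (bs_weight N (cis \<theta>)))) UNIV"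
    unfolding bs_measure_def using cis_measurable
    by (simp only: space_distr, subst emeasure_distr[OF _ sets.top])
      (auto simp: circle_borel_def space_restrict_space vimage_def)
  also have "\<dots> = (\<integral>\<^sup>+\<theta>. ennreal (bs_weight N (cis \<theta>)) \<partial>angle_measure)"
    using m by (subst emeasure_density) auto
  also have "\<dots> = ennreal (LINT \<theta>|angle_measure. bs_weight N (cis \<theta>))"
    by (intro nn_integral_eq_integral i AE_I2) (simp add: bs_weight_pos less_imp_le)
  finally show "emeasure (bs_measure N) (space (bs_measure N)) \<noteq> \<infinity>" by simp
qed

lemma space_bs: "space (bs_measure N) = sphere 0 1"
  by (rule sets_circle_borel_cong[OF sets_bs])

lemma degree_\<Psi>_le: "degree (\<Psi> k) \<le> k"
  using degree_reflect_poly_le[of "map_poly cnj (\<Phi> k)"] by (simp add: reversed_def degree_map_poly degree_\<Phi>)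

text \<open>The induction goes down from N, where the weight is explicit. The step inverts the
  recursion: (1 - |\<alpha>_k|^2) z \<Phi>_k = \<Phi>_(k+1) + cnj \<alpha>_k \<Psi>_(k+1).\<close>

lemma bs_orthogonal:
  assumes "k \<le> N" "j < k"
  shows "(\<integral>z. cnj (z ^ j) * poly (\<Phi> k) z \<partial>bs_measure N) = 0"
  using assms
proof (induction arbitrary: j rule: inc_induct)
  case base
  \<comment> \<open>The weight cancels \<Phi>_N and leaves its conjugate in the denominator, which
    is \<Psi>_N up to a power of z. The result is analytic in the disc and vanishes at 0 because j <
    N.\<close>
  define G where "G z = of_real (h N) * z ^ (N - j) / poly (\<Psi> N) z" for z
  have "(\<integral>z. cnj (z ^ j) * poly (\<Phi> N) z \<partial>bs_measure N)
      = (LINT \<theta>|angle_measure. bs_weight N (cis \<theta>) *\<^sub>R (cnj (cis \<theta> ^ j) * poly (\<Phi> N) (cis \<theta>)))"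
    by (intro integral_bs continuous_intros)
  also have "\<dots> = (LINT \<theta>|angle_measure. G (cis \<theta>))"
  proof (intro Bochner_Integration.integral_cong refl)
    fix \<theta>
    define z where "z = cis \<theta>"
    have z: "norm z = 1" by (simp add: z_def)
    have nz: "poly (\<Phi> N) z \<noteq> 0" by (rule \<Phi>_nonzero_circle[OF z])
    have "z \<noteq> 0" using z by auto
    have "bs_weight N z *\<^sub>R (cnj (z ^ j) * poly (\<Phi> N) z) = of_real (h N) * cnj (z ^ j) / cnj (poly (\<Phi> N) z)"
    proof -
      have "complex_of_real (bs_weight N z) = of_real (h N) / (poly (\<Phi> N) z * cnj (poly (\<Phi> N) z))"
        by (simp only: bs_weight_def of_real_divide complex_norm_square)
      then show ?thesis using nz by (simp add: scaleR_conv_of_real del: complex_cnj_power)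
    qed
    also have "\<dots> = of_real (h N) * (cnj (z ^ j) * z ^ N) / (z ^ N * cnj (poly (\<Phi> N) z))"
      using \<open>z \<noteq> 0\<close> by (simp add: field_simps)
    also have "\<dots> = G z"
      using cnj_power_mult[OF z, of j N] base by (simp add: G_def \<Psi>_circle[OF z] del: complex_cnj_power)
    finally show "bs_weight N (cis \<theta>) *\<^sub>R (cnj (cis \<theta> ^ j) * poly (\<Phi> N) (cis \<theta>)) = G (cis \<theta>)"
      by (simp add: z_def)
  qed
  also have "\<dots> = G 0"
    unfolding G_def
  proof (rule integral_circle_mean)
    show "continuous_on (cball 0 1) (\<lambda>z. of_real (h N) * z ^ (N - j) / poly (\<Psi> N) z)"
      by (intro continuous_intros) (auto simp: \<Psi>_nonzero)
    show "(\<lambda>z. of_real (h N) * z ^ (N - j) / poly (\<Psi> N) z) holomorphic_on ball 0 1"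
      by (intro holomorphic_intros poly_holomorphic) (auto simp: \<Psi>_nonzero)
  qed
  also have "\<dots> = 0" using base by (simp add: G_def)
  finally show ?case .
next
  case (step k)
  let ?I = "\<lambda>f. (\<integral>z. f z \<partial>bs_measure N) :: complex"
  note int = integrable_circle[OF finite_bs sets_bs]
  define r where "r = 1 - \<alpha> k * cnj (\<alpha> k)"
  have "r = of_real (1 - (norm (\<alpha> k))\<^sup>2)"
    unfolding r_def by (simp only: complex_norm_square[symmetric] of_real_diff of_real_1)
  then have "r \<noteq> 0" using rho_pos[of k] by (simp only: of_real_eq_0_iff)
  have "r * ?I (\<lambda>z. cnj (z ^ j) * poly (\<Phi> k) z)
      = ?I (\<lambda>z. r * (cnj (z ^ j) * poly (\<Phi> k) z))"
    by (rule integral_mult_right_zero[symmetric])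
  also have "\<dots> = ?I (\<lambda>z. cnj (z ^ Suc j) * poly (\<Phi> (Suc k)) z + cnj (\<alpha> k) * cnj (cnj (z ^ (k - j)) * poly (\<Phi> (Suc k)) z))"
  proof (intro Bochner_Integration.integral_cong refl)
    fix z assume "z \<in> space (bs_measure N)"
    then have z: "norm z = 1" by (simp add: space_bs)
    have "cnj (z ^ Suc j) * z = cnj (z ^ j)"
      using cnj_power_mult[OF z, of 1 1] by (simp add: mult.assoc mult.commute[of "cnj z"])
    then have "r * (cnj (z ^ j) * poly (\<Phi> k) z) = r * ((cnj (z ^ Suc j) * z) * poly (\<Phi> k) z)"
      by (simp only:)
    also have "\<dots> = cnj (z ^ Suc j) * (r * (z * poly (\<Phi> k) z))"
      by (simp only: mult_ac)
    also have "r * (z * poly (\<Phi> k) z) = poly (\<Phi> (Suc k)) z + cnj (\<alpha> k) * poly (\<Psi> (Suc k)) z"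
      by (simp add: r_def \<Phi>_Suc \<Psi>_Suc algebra_simps)
    also have "cnj (z ^ Suc j) * (poly (\<Phi> (Suc k)) z + cnj (\<alpha> k) * poly (\<Psi> (Suc k)) z)
       = cnj (z ^ Suc j) * poly (\<Phi> (Suc k)) z + cnj (\<alpha> k) * (cnj (z ^ Suc j) * z ^ Suc k * cnj (poly (\<Phi> (Suc k)) z))"
      by (simp only: \<Psi>_circle[OF z] distrib_left mult.assoc mult.left_commute[of "cnj (z ^ Suc j)" "cnj (\<alpha> k)"])
    also have "cnj (z ^ Suc j) * z ^ Suc k = z ^ (k - j)"
      using cnj_power_mult[OF z, of "Suc j" "Suc k"] step by simp
    finally show "r * (cnj (z ^ j) * poly (\<Phi> k) z) =
       cnj (z ^ Suc j) * poly (\<Phi> (Suc k)) z + cnj (\<alpha> k) * cnj (cnj (z ^ (k - j)) * poly (\<Phi> (Suc k)) z)"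
      by (simp only: complex_cnj_mult complex_cnj_cnj)
  qed
  also have "\<dots> = ?I (\<lambda>z. cnj (z ^ Suc j) * poly (\<Phi> (Suc k)) z) + cnj (\<alpha> k) * cnj (?I (\<lambda>z. cnj (z ^ (k - j)) * poly (\<Phi> (Suc k)) z))"
  proof -
    have I: "integrable (bs_measure N) (\<lambda>z. cnj (z ^ Suc j) * poly (\<Phi> (Suc k)) z)"
      "integrable (bs_measure N) (\<lambda>z. cnj (\<alpha> k) * cnj (cnj (z ^ (k - j)) * poly (\<Phi> (Suc k)) z))"
      by (intro int continuous_intros)+
    show ?thesis
      by (simp only: Bochner_Integration.integral_add[OF I] integral_mult_right_zero Bochner_Integration.integral_cnj)
  qed
  also have "\<dots> = 0"
    using step.IH[of "Suc j"] step.IH[of "k - j"] step.prems by (simp del: complex_cnj_power)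
  finally show ?case
    using \<open>r \<noteq> 0\<close> by (metis mult_eq_0_iff)
qed

text \<open>At k = N the weight cancels the integrand; going down, \<open>norm_step\<close> is
  solved for the lower norm.\<close>

lemma bs_norm:
  assumes "k \<le> N"
  shows "(\<integral>z. (norm (poly (\<Phi> k) z))\<^sup>2 \<partial>bs_measure N) = h k"
  using assms
proof (induction rule: inc_induct)
  case base
  have "(\<integral>z. (norm (poly (\<Phi> N) z))\<^sup>2 \<partial>bs_measure N)
     = (LINT \<theta>|angle_measure. bs_weight N (cis \<theta>) *\<^sub>R (norm (poly (\<Phi> N) (cis \<theta>)))\<^sup>2)"
    by (intro integral_bs continuous_intros)
  also have "\<dots> = (LINT \<theta>|angle_measure. h N)"
    by (intro Bochner_Integration.integral_cong refl) (simp add: bs_weight_def \<Phi>_nonzero_circle)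
  also have "\<dots> = h N" using prob_space.prob_space[OF prob_space_angle] by simp
  finally show ?case .
next
  case (step k)
  have "(\<integral>z. cnj (poly (\<Psi> k) z) * poly (\<Phi> (Suc k)) z \<partial>bs_measure N) = 0"
    using step degree_\<Psi>_le[of k]
    by (intro integral_cnj_poly finite_bs sets_bs continuous_intros bs_orthogonal) auto
  from norm_step[OF finite_bs sets_bs this] step.IH
  have "h (Suc k) = (1 - (norm (\<alpha> k))\<^sup>2) * (\<integral>z. (norm (poly (\<Phi> k) z))\<^sup>2 \<partial>bs_measure N)" by simp
  then show ?case using rho_pos[of k] by (simp add: h_def)
qed

lemma bs_total: "(\<integral>z. 1 \<partial>bs_measure N) = (1::real)"
  using bs_norm[of 0 N] by (simp add: \<Phi>_0 h_def)

end

context circle_opuc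
begin

text \<open>Expanding in the \<Phi>_d reduces to the integrals of \<Phi>_d itself, which vanish
  under both measures for d \<ge> 1; for d = 0 both masses are 1.\<close>

lemma moments_poly:
  assumes "degree p \<le> N"
  shows "(\<integral>z. poly p z \<partial>bs_measure N) = (\<integral>z. poly p z \<partial>\<mu>)"
  using assms
proof (induction "degree p" arbitrary: p rule: less_induct)
  case less
  show ?case
  proof (cases "p = 0")
    case False
    define d where "d = degree p"
    obtain r where r: "p = smult (lead_coeff p) (\<Phi> d) + r" "r = 0 \<or> degree r < d"
      using False unfolding d_def by (rule split_lead)
    have eq: "(\<integral>z. poly p z \<partial>M) = lead_coeff p * (\<integral>z. poly (\<Phi> d) z \<partial>M) + (\<integral>z. poly r z \<partial>M)"
      if "finite_measure M" "sets M = sets circle_borel" for M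
    proof -
      have I: "integrable M (\<lambda>z. lead_coeff p * poly (\<Phi> d) z)" "integrable M (\<lambda>z. poly r z)"
        by (intro integrable_circle that continuous_intros)+
      have "(\<integral>z. poly p z \<partial>M) = (\<integral>z. lead_coeff p * poly (\<Phi> d) z + poly r z \<partial>M)"
        using arg_cong[OF r(1), of "\<lambda>q. poly q _"]
        by (intro Bochner_Integration.integral_cong refl) (simp only: poly_add poly_smult)
      also have "\<dots> = lead_coeff p * (\<integral>z. poly (\<Phi> d) z \<partial>M) + (\<integral>z. poly r z \<partial>M)"
        by (simp only: Bochner_Integration.integral_add[OF I] integral_mult_right_zero)
      finally show ?thesis .
    qed
    have "(\<integral>z. poly r z \<partial>bs_measure N) = (\<integral>z. poly r z \<partial>\<mu>)"
      using r(2) less by (cases "r = 0") (auto simp: d_def)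
    moreover have "(\<integral>z. poly (\<Phi> d) z \<partial>bs_measure N) = (\<integral>z. poly (\<Phi> d) z \<partial>\<mu>)"
    proof (cases "d = 0")
      case True
      have "measure (bs_measure N) (space (bs_measure N)) = 1" using bs_total[of N] by simp
      then show ?thesis using True prob_space.prob_space[OF prob_space_\<mu>] by (simp add: \<Phi>_0)
    next
      case False
      then show ?thesis
        using bs_orthogonal[of d N 0] orthogonal_power[of 0 d] less.prems by (simp add: d_def)
    qed
    ultimately show ?thesis
      by (simp only: eq[OF finite_\<mu> sets_\<mu>] eq[OF finite_bs sets_bs])
  qed (simp add: poly_0[abs_def])
qed

text \<open>Negative powers are conjugates of positive ones on the circle, so the measures agree at
  all frequencies between -N and N.\<close>

lemma moments_laurent:
  assumes "degree p \<le> N" "d \<le> N"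
  shows "(\<integral>z. cnj (z ^ d) * poly p z \<partial>bs_measure N) = (\<integral>z. cnj (z ^ d) * poly p z \<partial>\<mu>)"
proof -
  have pow: "(\<integral>z. z ^ i \<partial>bs_measure N) = (\<integral>z. z ^ i \<partial>\<mu>)" if "i \<le> N" for i
    using moments_poly[of "monom 1 i" N] that by (simp add: poly_monom degree_monom_eq)
  have mono: "(\<integral>z. cnj (z ^ d) * z ^ i \<partial>bs_measure N) = (\<integral>z. cnj (z ^ d) * z ^ i \<partial>\<mu>)" if "i \<le> N" for i
  proof (cases "d \<le> i")
    case True
    have "(\<integral>z. cnj (z ^ d) * z ^ i \<partial>M) = (\<integral>z. z ^ (i - d) \<partial>M)" if "space M = sphere 0 1" for M
      using True that by (intro Bochner_Integration.integral_cong refl cnj_power_mult) auto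
    then show ?thesis using that pow[of "i - d"] by (simp add: space_\<mu> space_bs)
  next
    case False
    have "(\<integral>z. cnj (z ^ d) * z ^ i \<partial>M) = (\<integral>z. cnj (z ^ (d - i)) \<partial>M)" if "space M = sphere 0 1" for M
    proof (intro Bochner_Integration.integral_cong refl)
      fix z assume "z \<in> space M"
      then have "cnj (z ^ i) * z ^ d = z ^ (d - i)" using False that by (intro cnj_power_mult) auto
      from arg_cong[OF this, of cnj] show "cnj (z ^ d) * z ^ i = cnj (z ^ (d - i))"
        by (simp only: complex_cnj_cnj complex_cnj_mult mult.commute[of "z ^ i"])
    qed
    then show ?thesis using assms(2) pow[of "d - i"] by (simp add: space_\<mu> space_bs del: complex_cnj_power)
  qed
  have expand: "(\<integral>z. cnj (z ^ d) * poly p z \<partial>M) = (\<Sum>i\<le>degree p. coeff p i * (\<integral>z. cnj (z ^ d) * z ^ i \<partial>M))"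
    if "finite_measure M" "sets M = sets circle_borel" for M
  proof -
    have "(\<integral>z. cnj (z ^ d) * poly p z \<partial>M) = (\<integral>z. (\<Sum>i\<le>degree p. coeff p i * (cnj (z ^ d) * z ^ i)) \<partial>M)"
      by (simp add: poly_altdef sum_distrib_left mult_ac del: complex_cnj_power)
    also have "\<dots> = (\<Sum>i\<le>degree p. (\<integral>z. coeff p i * (cnj (z ^ d) * z ^ i) \<partial>M))"
      by (intro Bochner_Integration.integral_sum integrable_circle that continuous_intros)
    finally show ?thesis by (simp only: integral_mult_right_zero)
  qed
  show ?thesis
    unfolding expand[OF finite_\<mu> sets_\<mu>] expand[OF finite_bs sets_bs]
    using assms(1) by (intro sum.cong refl arg_cong2[where f = times] mono) auto
qed

end

section \<open>Approximation by continuous functions in the mean\<close>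

lemma regular_approx:
  fixes M :: "'a::{second_countable_topology, complete_space} measure"
  assumes "finite_measure M" "sets M = sets borel" "B \<in> sets borel" "\<epsilon> > 0"
  obtains K U where "compact K" "open U" "K \<subseteq> B" "B \<subseteq> U" "measure M (U - K) < \<epsilon>"
proof -
  interpret finite_measure M by fact
  have "emeasure M B < emeasure M B + ennreal (\<epsilon>/2)"
    using assms(4) by (simp add: emeasure_eq_measure ennreal_less_iff flip: ennreal_plus)
  then have "(INF U \<in> {U. B \<subseteq> U \<and> open U}. emeasure M U) < emeasure M B + ennreal (\<epsilon>/2)"
    using outer_regular[OF assms(2) _ assms(3)] by simp
  then obtain U where U: "B \<subseteq> U" "open U" "emeasure M U < emeasure M B + ennreal (\<epsilon>/2)"
    by (auto simp: INF_less_iff)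
  have UM: "U \<in> sets M" and BM: "B \<in> sets M" using U assms by auto
  have "measure M U < measure M B + \<epsilon>/2"
    using U(3) assms(4) by (simp add: emeasure_eq_measure ennreal_less_iff flip: ennreal_plus)
  moreover obtain K where K: "K \<subseteq> B" "compact K" "measure M B - \<epsilon>/2 < measure M K"
  \<comment> \<open>\<open>ennreal\<close> truncates negative numbers to 0, which would spoil the
    strict inequality; in that case the empty set already suffices.\<close>
  proof (cases "measure M B - \<epsilon>/2 < 0")
    case True
    then show ?thesis by (intro that[of "{}"]) auto
  next
    case False
    then have "ennreal (measure M B - \<epsilon>/2) < emeasure M B"
      using assms(4) by (simp add: emeasure_eq_measure ennreal_less_iff)
    also have "\<dots> = (SUP K \<in> {K. K \<subseteq> B \<and> compact K}. emeasure M K)"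
      using assms by (intro inner_regular) auto
    finally obtain K where "K \<subseteq> B" "compact K" "ennreal (measure M B - \<epsilon>/2) < emeasure M K"
      by (auto simp: less_SUP_iff)
    then show ?thesis using False by (intro that[of K]) (auto simp: emeasure_eq_measure ennreal_less_iff)
  qed
  moreover have "measure M (U - K) = measure M U - measure M K"
    using K U UM assms by (intro finite_measure_Diff) (auto simp: compact_imp_closed)
  ultimately show ?thesis using U by (intro that[of K U]) auto
qed

text \<open>Urysohn functions between a compact and an open set approximate indicators, and
  \<open>integrable_induct\<close> carries this over to sums and dominated limits.\<close>

lemma L1_approx_continuous:
  fixes M :: "'a::euclidean_space measure" and f :: "'a \<Rightarrow> real"
  assumes "finite_measure M" "sets M = sets borel" "integrable M f" "\<epsilon> > 0"
  shows "\<exists>g. continuous_on UNIV g \<and> integrable M g \<and> (\<integral>x. \<bar>f x - g x\<bar> \<partial>M) < \<epsilon>"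
  using assms(3,4)
proof (induction arbitrary: \<epsilon> rule: integrable_induct)
  case (base A c)
  interpret finite_measure M by fact
  \<comment> \<open>The added 1 covers c = 0 and makes |c| \<delta> < \<epsilon> strict.\<close>
  define \<delta> where "\<delta> = \<epsilon> / (\<bar>c\<bar> + 1)"
  have "\<delta> > 0" using base by (simp add: \<delta>_def)
  from base have "A \<in> sets borel" using assms(2) by simp
  from regular_approx[OF assms(1,2) this \<open>\<delta> > 0\<close>]
  obtain K U where KU: "compact K" "open U" "K \<subseteq> A" "A \<subseteq> U" "measure M (U - K) < \<delta>" by blast
  obtain \<phi> :: "'a \<Rightarrow> real" where \<phi>: "continuous_on UNIV \<phi>" "\<And>x. \<phi> x \<in> closed_segment 1 0"
    "\<And>x. \<phi> x = 1 \<longleftrightarrow> x \<in> K" "\<And>x. \<phi> x = 0 \<longleftrightarrow> x \<in> - U"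
    using KU by (rule_tac Urysohn_strong[of K "- U" 1 0]) (auto simp: compact_imp_closed)
  have r: "0 \<le> \<phi> x" "\<phi> x \<le> 1" for x using \<phi>(2)[of x] by (auto simp: closed_segment_eq_real_ivl)
  have mU: "U - K \<in> sets M" using KU assms(2) by (auto simp: compact_imp_closed)
  have m\<phi>: "\<phi> \<in> borel_measurable M"
    using borel_measurable_continuous_onI[OF \<phi>(1)] by (simp add: measurable_cong_sets[OF assms(2) refl])
  have i\<phi>: "integrable M \<phi>"
    using r by (intro integrable_const_bound[of _ 1] m\<phi>) auto
  have "(\<integral>x. \<bar>indicator A x *\<^sub>R c - c * \<phi> x\<bar> \<partial>M) \<le> (\<integral>x. \<bar>c\<bar> * indicator (U - K) x \<partial>M)"
  proof (rule integral_mono)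
    show "integrable M (\<lambda>x. \<bar>indicator A x *\<^sub>R c - c * \<phi> x\<bar>)"
      using base i\<phi> by (intro integrable_abs Bochner_Integration.integrable_diff integrable_scaleR_left integrable_mult_right) auto
    show "integrable M (\<lambda>x. \<bar>c\<bar> * indicator (U - K) x)"
      using mU by (intro integrable_mult_right) (auto simp: emeasure_eq_measure)
    fix x
    have "indicator A x *\<^sub>R c - c * \<phi> x = c * (indicator A x - \<phi> x)" by (simp add: algebra_simps)
    moreover have "\<bar>indicator A x - \<phi> x\<bar> \<le> indicator (U - K) x"
      using r[of x] \<phi>(3)[of x] \<phi>(4)[of x] KU(3,4) by (auto simp: indicator_def)
    ultimately show "\<bar>indicator A x *\<^sub>R c - c * \<phi> x\<bar> \<le> \<bar>c\<bar> * indicator (U - K) x"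
      by (simp add: abs_mult mult_left_mono)
  qed
  also have "\<dots> = \<bar>c\<bar> * measure M (U - K)" using mU by simp
  also have "\<dots> \<le> \<bar>c\<bar> * \<delta>" using KU(5) by (intro mult_left_mono) auto
  also have "\<dots> < \<epsilon>" using base(3) by (simp add: \<delta>_def field_simps)
  finally show ?case using \<phi>(1) i\<phi> by (intro exI[of _ "\<lambda>x. c * \<phi> x"] conjI continuous_intros integrable_mult_right) auto
next
  case (add f1 f2)
  have "\<epsilon>/2 > 0" using add.prems by simp
  from add.IH(1)[OF this] add.IH(2)[OF this] obtain g1 g2 where g:
    "continuous_on UNIV g1" "integrable M g1" "(\<integral>x. \<bar>f1 x - g1 x\<bar> \<partial>M) < \<epsilon>/2"
    "continuous_on UNIV g2" "integrable M g2" "(\<integral>x. \<bar>f2 x - g2 x\<bar> \<partial>M) < \<epsilon>/2" by blast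
  have "(\<integral>x. \<bar>(f1 x + f2 x) - (g1 x + g2 x)\<bar> \<partial>M) \<le> (\<integral>x. \<bar>f1 x - g1 x\<bar> + \<bar>f2 x - g2 x\<bar> \<partial>M)"
    using add.hyps g by (intro integral_mono) auto
  also have "\<dots> = (\<integral>x. \<bar>f1 x - g1 x\<bar> \<partial>M) + (\<integral>x. \<bar>f2 x - g2 x\<bar> \<partial>M)"
    using add.hyps g by (intro Bochner_Integration.integral_add) auto
  also have "\<dots> < \<epsilon>" using g by simp
  finally show ?case using g by (intro exI[of _ "\<lambda>x. g1 x + g2 x"] conjI continuous_intros) auto
next
  case (lim f s)
  have "(\<lambda>i. \<integral>x. \<bar>f x - s i x\<bar> \<partial>M) \<longlonglongrightarrow> (\<integral>x. 0 \<partial>M)"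
  \<comment> \<open>The approximants of \<open>integrable_induct\<close> satisfy |s i x| \<le> 2 |f
    x|, which yields the majorant 3 |f|.\<close>
  proof (rule integral_dominated_convergence[where w = "\<lambda>x. 3 * \<bar>f x\<bar>"])
    show "AE x in M. (\<lambda>i. \<bar>f x - s i x\<bar>) \<longlonglongrightarrow> 0"
    proof (rule AE_I2)
      fix x assume "x \<in> space M"
      from tendsto_diff[OF tendsto_const lim.hyps(2)[OF this], of "f x"]
      show "(\<lambda>i. \<bar>f x - s i x\<bar>) \<longlonglongrightarrow> 0" by (intro tendsto_rabs_zero) simp
    qed
    show "AE x in M. norm \<bar>f x - s i x\<bar> \<le> 3 * \<bar>f x\<bar>" for i
    proof (rule AE_I2)
      fix x assume "x \<in> space M"
      from lim.hyps(3)[OF this, of i] show "norm \<bar>f x - s i x\<bar> \<le> 3 * \<bar>f x\<bar>" by simp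
    qed
  qed (use lim in auto)
  then have "(\<lambda>i. \<integral>x. \<bar>f x - s i x\<bar> \<partial>M) \<longlonglongrightarrow> 0" by simp
  then have "\<forall>\<^sub>F i in sequentially. (\<integral>x. \<bar>f x - s i x\<bar> \<partial>M) < \<epsilon>/2"
    using lim.prems by (intro order_tendstoD) auto
  then obtain i where i: "(\<integral>x. \<bar>f x - s i x\<bar> \<partial>M) < \<epsilon>/2"
    by (auto simp: eventually_sequentially)
  obtain g where g: "continuous_on UNIV g" "integrable M g" "(\<integral>x. \<bar>s i x - g x\<bar> \<partial>M) < \<epsilon>/2"
    using lim.IH[of "\<epsilon>/2" i] lim.prems by auto
  have "(\<integral>x. \<bar>f x - g x\<bar> \<partial>M) \<le> (\<integral>x. \<bar>f x - s i x\<bar> + \<bar>s i x - g x\<bar> \<partial>M)"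
    using lim.hyps g by (intro integral_mono) auto
  also have "\<dots> = (\<integral>x. \<bar>f x - s i x\<bar> \<partial>M) + (\<integral>x. \<bar>s i x - g x\<bar> \<partial>M)"
    using lim.hyps g by (intro Bochner_Integration.integral_add) auto
  also have "\<dots> < \<epsilon>" using i g by simp
  finally show ?case using g by auto
qed

text \<open>Serves to approximate in the mean of two measures with one continuous function: an error
  that is small for the sum is small for both.\<close>

definition sum_measure :: "'a measure \<Rightarrow> 'a measure \<Rightarrow> 'a measure" where
  "sum_measure M N = measure_of (space M) (sets M) (\<lambda>A. emeasure M A + emeasure N A)"

lemma sets_sum_measure [simp]: "sets (sum_measure M N) = sets M"
  by (simp add: sum_measure_def)

lemma space_sum_measure [simp]: "space (sum_measure M N) = space M"
  by (simp add: sum_measure_def)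

lemma emeasure_sum_measure:
  assumes "sets N = sets M" "A \<in> sets M"
  shows "emeasure (sum_measure M N) A = emeasure M A + emeasure N A"
  unfolding sum_measure_def
proof (rule emeasure_measure_of_sigma)
  show "positive (sets M) (\<lambda>A. emeasure M A + emeasure N A)" by (simp add: positive_def)
  show "countably_additive (sets M) (\<lambda>A. emeasure M A + emeasure N A)"
  proof (rule countably_additiveI)
    fix A :: "nat \<Rightarrow> _" assume A: "range A \<subseteq> sets M" "disjoint_family A"
    have "(\<Sum>i. emeasure M (A i) + emeasure N (A i)) = (\<Sum>i. emeasure M (A i)) + (\<Sum>i. emeasure N (A i))"
      by (intro suminf_add[symmetric] summableI)
    then show "(\<Sum>i. emeasure M (A i) + emeasure N (A i)) = emeasure M (\<Union>i. A i) + emeasure N (\<Union>i. A i)"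
      using A assms(1) by (simp add: suminf_emeasure)
  qed
qed (use assms in \<open>auto simp: sets.sigma_algebra_axioms\<close>)

lemma sum_measure_ge:
  assumes "sets N = sets M" shows "M \<le> sum_measure M N" "N \<le> sum_measure M N"
  using assms by (auto simp: le_measure emeasure_sum_measure)

lemma integral_mono_measure:
  fixes f :: "'a \<Rightarrow> real"
  assumes "sets M = sets N" "M \<le> N" "integrable N f" "\<And>x. f x \<ge> 0"
  shows "integrable M f" "integral\<^sup>L M f \<le> integral\<^sup>L N f"
proof -
  have m: "f \<in> borel_measurable M"
    using assms(3) by (simp add: measurable_cong_sets[OF assms(1) refl])
  have le: "(\<integral>\<^sup>+x. f x \<partial>M) \<le> (\<integral>\<^sup>+x. f x \<partial>N)" by (rule nn_integral_mono_measure[OF assms(1,2)])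
  have fin: "(\<integral>\<^sup>+x. f x \<partial>N) < \<infinity>"
    using assms(3,4) by (subst nn_integral_eq_integral) auto
  show i: "integrable M f" using m le fin assms(4) by (intro integrableI_nonneg) auto
  from le show "integral\<^sup>L M f \<le> integral\<^sup>L N f"
    using assms(3,4) i by (simp add: nn_integral_eq_integral)
qed

lemma L1_approx_circle:
  fixes f :: "complex \<Rightarrow> real"
  assumes "finite_measure M" "sets M = sets circle_borel" "finite_measure N" "sets N = sets circle_borel"
    and "f \<in> borel_measurable borel" "\<And>z. \<bar>f z\<bar> \<le> B" "\<epsilon> > 0"
  obtains g where "continuous_on UNIV g" "(\<integral>z. \<bar>f z - g z\<bar> \<partial>M) < \<epsilon>" "(\<integral>z. \<bar>f z - g z\<bar> \<partial>N) < \<epsilon>"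
proof -
  define S where "S = sum_measure M N"
  have sN: "sets N = sets M" using assms by simp
  have sS: "sets S = sets circle_borel" by (simp add: S_def assms)
  have finS: "finite_measure S"
  proof
    have "emeasure S (space S) = emeasure M (space M) + emeasure N (space M)"
      unfolding S_def by (simp add: emeasure_sum_measure[OF sN])
    also have "space M = space N" using sN by (rule sets_eq_imp_space_eq[symmetric])
    finally show "emeasure S (space S) \<noteq> \<infinity>"
      using finite_measure.emeasure_finite[OF assms(1)] finite_measure.emeasure_finite[OF assms(3)]
      by (simp add: \<open>space M = space N\<close>)
  qed
  have m: "(\<lambda>z. z) \<in> measurable S borel"
    by (rule borel_measurable_circle[OF sS]) simp
  \<comment> \<open>\<open>L1_approx_continuous\<close> works with Borel measures on the whole
    plane, so S is pushed forward from the circle.\<close>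
  define S' where "S' = distr S borel (\<lambda>z. z)"
  have "finite_measure S'" unfolding S'_def by (rule finite_measure.finite_measure_distr[OF finS m])
  moreover have "sets S' = sets borel" by (simp add: S'_def)
  moreover have "integrable S' f"
    using assms(5,6) \<open>finite_measure S'\<close> by (intro finite_measure.integrable_const_bound[of _ _ B]) (auto simp: S'_def)
  ultimately obtain g where g: "continuous_on UNIV g" "integrable S' g" "(\<integral>x. \<bar>f x - g x\<bar> \<partial>S') < \<epsilon>"
    using L1_approx_continuous[of S' f \<epsilon>] assms(7) by blast
  have mg: "(\<lambda>z. \<bar>f z - g z\<bar>) \<in> borel_measurable borel"
    using assms(5) borel_measurable_continuous_onI[OF g(1)] by measurable
  have "(\<integral>x. \<bar>f x - g x\<bar> \<partial>S') = (\<integral>x. \<bar>f x - g x\<bar> \<partial>S)"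
    unfolding S'_def using m mg by (rule integral_distr)
  moreover have "integrable S (\<lambda>z. \<bar>f z - g z\<bar>)"
    using \<open>integrable S' f\<close> g(2) unfolding S'_def
    by (subst integrable_distr_eq[OF m mg, symmetric]) auto
  moreover note sum_measure_ge[OF sN, folded S_def]
  ultimately have "(\<integral>z. \<bar>f z - g z\<bar> \<partial>M) < \<epsilon>" "(\<integral>z. \<bar>f z - g z\<bar> \<partial>N) < \<epsilon>"
    using integral_mono_measure(2)[of M S "\<lambda>z. \<bar>f z - g z\<bar>"] integral_mono_measure(2)[of N S "\<lambda>z. \<bar>f z - g z\<bar>"] g(3) assms sS
    by auto
  with g(1) show ?thesis by (rule that)
qed

section \<open>Semicontinuity of the entropy\<close>

text \<open>Laurent polynomials without negative powers: on the circle \<open>cnj (z ^ d)\<close> is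
  z^(-d).\<close>

definition laurent_on_circle :: "(complex \<Rightarrow> complex) \<Rightarrow> bool" where
  "laurent_on_circle g \<longleftrightarrow> (\<exists>d p. \<forall>z. norm z = 1 \<longrightarrow> g z = cnj (z ^ d) * poly p z)"

lemma laurent_mult:
  assumes "laurent_on_circle f" "laurent_on_circle g"
  shows "laurent_on_circle (\<lambda>z. f z * g z)"
proof -
  obtain d p e q where "\<forall>z. norm z = 1 \<longrightarrow> f z = cnj (z ^ d) * poly p z" "\<forall>z. norm z = 1 \<longrightarrow> g z = cnj (z ^ e) * poly q z"
    using assms by (auto simp: laurent_on_circle_def)
  then have "\<forall>z. norm z = 1 \<longrightarrow> f z * g z = cnj (z ^ (d + e)) * poly (p * q) z"
    by (simp add: power_add mult_ac)
  then show ?thesis unfolding laurent_on_circle_def by blast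
qed

lemma laurent_add:
  assumes "laurent_on_circle f" "laurent_on_circle g"
  shows "laurent_on_circle (\<lambda>z. f z + g z)"
proof -
  obtain d p e q where *: "\<forall>z. norm z = 1 \<longrightarrow> f z = cnj (z ^ d) * poly p z" "\<forall>z. norm z = 1 \<longrightarrow> g z = cnj (z ^ e) * poly q z"
    using assms by (auto simp: laurent_on_circle_def)
  have "f z + g z = cnj (z ^ (d + e)) * poly (monom 1 e * p + monom 1 d * q) z" if z: "norm z = 1" for z
  proof -
    have "cnj (z ^ d) * z ^ d = 1" "cnj (z ^ e) * z ^ e = 1"
      using cnj_power_mult[OF z, of d d] cnj_power_mult[OF z, of e e] by simp_all
    then have "f z + g z = cnj (z ^ d) * (cnj (z ^ e) * z ^ e) * poly p z + cnj (z ^ e) * (cnj (z ^ d) * z ^ d) * poly q z"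
      using * z by simp
    also have "\<dots> = cnj (z ^ (d + e)) * poly (monom 1 e * p + monom 1 d * q) z"
      by (simp add: poly_monom power_add algebra_simps)
    finally show ?thesis .
  qed
  then show ?thesis unfolding laurent_on_circle_def by blast
qed

lemma laurent_poly: "laurent_on_circle (poly p)"
  unfolding laurent_on_circle_def by (intro exI[of _ 0] exI[of _ p]) simp

lemma laurent_norm_poly: "laurent_on_circle (\<lambda>z. of_real ((norm (poly p z))\<^sup>2))"
proof -
  have "laurent_on_circle (\<lambda>z. cnj (poly p z))"
    unfolding laurent_on_circle_def
  proof (intro exI allI impI)
    fix z :: complex assume z: "norm z = 1"
    have "cnj (z ^ degree p) * z ^ degree p = 1" using cnj_power_mult[OF z, of "degree p" "degree p"] by simp
    then show "cnj (poly p z) = cnj (z ^ degree p) * poly (reflect_poly (map_poly cnj p)) z"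
      unfolding poly_reverse_circle[OF z] by (simp only: mult.assoc[symmetric] mult_1_left)
  qed
  from laurent_mult[OF laurent_poly[of p] this] show ?thesis
    by (simp only: complex_norm_square)
qed

lemma laurent_real_polynomial:
  assumes "real_polynomial_function g"
  shows "laurent_on_circle (\<lambda>z. of_real (g z))"
  using assms
proof (induction rule: real_polynomial_function.induct)
  case (linear f)
  interpret bounded_linear f by fact
  \<comment> \<open>From Re z = (z + cnj z) / 2 and Im z = (z - cnj z) / (2 i). With cnj z factored
    out, the coefficient of cnj z sits at position 0 and that of z at position 2.\<close>
  define p where "p = [: (of_real (f 1) + \<i> * of_real (f \<i>)) / 2, 0, (of_real (f 1) - \<i> * of_real (f \<i>)) / 2 :]"
  have "of_real (f z) = cnj (z ^ 1) * poly p z" if z: "norm z = 1" for z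
  proof -
    have zz: "cnj z * z = 1" using cnj_power_mult[OF z, of 1 1] by simp
    have "z = Re z *\<^sub>R 1 + Im z *\<^sub>R \<i>" by (simp add: complex_eq_iff)
    then have "f z = Re z * f 1 + Im z * f \<i>" by (metis add scaleR real_scaleR_def)
    then have "of_real (f z) = (of_real (f 1) + \<i> * of_real (f \<i>)) / 2 * cnj z + (of_real (f 1) - \<i> * of_real (f \<i>)) / 2 * z"
      by (simp add: complex_eq_iff field_simps)
    also have "\<dots> = (of_real (f 1) + \<i> * of_real (f \<i>)) / 2 * cnj z + (of_real (f 1) - \<i> * of_real (f \<i>)) / 2 * ((cnj z * z) * z)"
      by (simp add: zz)
    also have "\<dots> = cnj (z ^ 1) * poly p z"
      by (simp add: p_def algebra_simps add_divide_distrib diff_divide_distrib)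
    finally show ?thesis .
  qed
  then show ?case unfolding laurent_on_circle_def by blast
next
  case (const c)
  show ?case unfolding laurent_on_circle_def
    by (intro exI[of _ 0] exI[of _ "[:of_real c:]"]) simp
next
  case (add f g)
  then show ?case by (simp add: laurent_add)
next
  case (mult f g)
  then show ?case by (simp add: laurent_mult)
qed

lemma ln_diff_le: fixes x y :: real assumes "x \<ge> 1" "y \<ge> 1" shows "ln x - ln y \<le> \<bar>x - y\<bar>"
proof -
  have "ln x - ln y = ln (x / y)" using assms by (simp add: ln_divide_pos)
  also have "\<dots> \<le> x / y - 1" using assms by (intro ln_le_minus_one) auto
  also have "\<dots> = (x - y) / y" using assms by (simp add: field_simps)
  also have "\<dots> \<le> \<bar>x - y\<bar> / 1" using assms by (intro frac_le) auto
  finally show ?thesis by simp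
qed

lemma sets_circle_measure: "sets circle_measure = sets circle_borel"
  by (simp add: circle_measure_def)

lemma prob_space_circle_measure: "prob_space circle_measure"
  unfolding circle_measure_def by (rule prob_space.prob_space_distr[OF prob_space_angle cis_measurable])

lemma integral_circle_measure:
  fixes f :: "complex \<Rightarrow> 'a::{banach, second_countable_topology}"
  assumes "f \<in> borel_measurable circle_borel"
  shows "(\<integral>z. f z \<partial>circle_measure) = (LINT \<theta>|angle_measure. f (cis \<theta>))"
  unfolding circle_measure_def using cis_measurable assms by (rule integral_distr)

lemma borel_measurable_circle_continuous:
  "continuous_on (sphere 0 1) f \<Longrightarrow> f \<in> borel_measurable circle_borel"
  unfolding circle_borel_def by (rule borel_measurable_continuous_on_restrict)

context circle_opuc
begin

text \<open>W is P in the circle variable. Its form |q|^2 makes it a Laurent polynomial on the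
  circle, so that W g is one whenever g is.\<close>

context
  fixes q :: "complex poly" and K :: real and W :: "complex \<Rightarrow> real"
  defines "W \<equiv> \<lambda>z. (norm (poly q z))\<^sup>2"
  assumes entropy_bound: "\<And>N. (\<integral>z. W z * ln ((norm (poly (\<Phi> N) z))\<^sup>2 / h N) \<partial>circle_measure) \<le> K"
begin

lemma W_nonneg: "W z \<ge> 0" by (simp add: W_def)

lemma W_continuous: "continuous_on A W"
  unfolding W_def by (intro continuous_intros)

lemma finite_lam: "finite_measure circle_measure"
  using prob_space_circle_measure by (simp add: prob_space_def)

lemmas int_lam = integrable_circle[OF finite_lam sets_circle_measure]
lemmas int_\<mu> = integrable_circle[OF finite_\<mu> sets_\<mu>]

lemma space_lam: "space circle_measure = sphere 0 1"
  by (rule sets_circle_borel_cong[OF sets_circle_measure])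

text \<open>N is taken after g, at least the order of the Laurent polynomial W g, so that
  \<open>bs_measure N\<close> and \<mu> integrate W g alike; hence the entropy bound for all N. The
  - W left over from ln x \<le> x - 1 is dropped.\<close>

lemma bound_laurent:
  assumes g: "laurent_on_circle (\<lambda>z. of_real (g z))" "continuous_on (sphere 0 1) g" "\<And>z. norm z = 1 \<Longrightarrow> g z > 0"
  shows "(\<integral>z. W z * ln (g z) \<partial>circle_measure) \<le> K + (\<integral>z. W z * g z \<partial>\<mu>)"
proof -
  have "laurent_on_circle (\<lambda>z. of_real (W z) * of_real (g z))"
    unfolding W_def by (intro laurent_mult laurent_norm_poly g)
  then obtain d p where dp: "\<And>z. norm z = 1 \<Longrightarrow> of_real (W z * g z) = cnj (z ^ d) * poly p z"
    by (auto simp: laurent_on_circle_def)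
  define N where "N = max d (degree p)"
  have cWg: "continuous_on (sphere 0 1) (\<lambda>z. W z * g z)" by (intro continuous_intros W_continuous g)
  have "complex_of_real (\<integral>z. W z * g z \<partial>M) = (\<integral>z. cnj (z ^ d) * poly p z \<partial>M)" if "space M = sphere 0 1" for M
  proof -
    have "complex_of_real (\<integral>z. W z * g z \<partial>M) = (\<integral>z. of_real (W z * g z) \<partial>M)"
      by (rule integral_complex_of_real[symmetric])
    also have "\<dots> = (\<integral>z. cnj (z ^ d) * poly p z \<partial>M)"
      using that by (intro Bochner_Integration.integral_cong refl dp) auto
    finally show ?thesis .
  qed
  from this[OF space_\<mu>] this[OF space_bs[of N]] moments_laurent[of p N d]
  have "complex_of_real (\<integral>z. W z * g z \<partial>bs_measure N) = complex_of_real (\<integral>z. W z * g z \<partial>\<mu>)"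
    by (simp only: N_def max.cobounded1 max.cobounded2)
  then have eq: "(\<integral>z. W z * g z \<partial>bs_measure N) = (\<integral>z. W z * g z \<partial>\<mu>)" by (simp only: of_real_eq_iff)
  have cl: "continuous_on (sphere 0 1) (\<lambda>z. W z * ln ((norm (poly (\<Phi> N) z))\<^sup>2 / h N))"
    using h_pos[of N] by (intro continuous_intros W_continuous) (auto simp: \<Phi>_nonzero_circle)
  have cg: "continuous_on (sphere 0 1) (\<lambda>z. W z * ln (g z))"
    using g(3) by (intro continuous_intros W_continuous g) (auto simp: less_le)
  have cb: "continuous_on (sphere 0 1) (\<lambda>z. bs_weight N z * (W z * g z))"
    by (intro continuous_intros cWg continuous_bs_weight)
  have "(\<integral>z. W z * ln (g z) \<partial>circle_measure) \<le> (\<integral>z. W z * ln ((norm (poly (\<Phi> N) z))\<^sup>2 / h N) + bs_weight N z * (W z * g z) \<partial>circle_measure)"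
  proof (rule integral_mono)
    fix z assume "z \<in> space circle_measure"
    then have z: "norm z = 1" by (simp add: space_lam)
    have pos: "g z > 0" "bs_weight N z > 0" using g(3) bs_weight_pos z by auto
    have inv: "(norm (poly (\<Phi> N) z))\<^sup>2 / h N = inverse (bs_weight N z)" by (simp add: bs_weight_def)
    have "ln (bs_weight N z * g z) \<le> bs_weight N z * g z - 1" using pos by (intro ln_le_minus_one) auto
    then have "ln (g z) \<le> ln ((norm (poly (\<Phi> N) z))\<^sup>2 / h N) + bs_weight N z * g z"
      unfolding inv using pos by (simp add: ln_mult_pos ln_inverse)
    from mult_left_mono[OF this W_nonneg[of z]]
    show "W z * ln (g z) \<le> W z * ln ((norm (poly (\<Phi> N) z))\<^sup>2 / h N) + bs_weight N z * (W z * g z)"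
      by (simp add: algebra_simps)
  qed (intro Bochner_Integration.integrable_add int_lam cl cg cb)+
  also have "\<dots> = (\<integral>z. W z * ln ((norm (poly (\<Phi> N) z))\<^sup>2 / h N) \<partial>circle_measure) + (\<integral>z. bs_weight N z * (W z * g z) \<partial>circle_measure)"
    by (intro Bochner_Integration.integral_add int_lam cl cb)
  also have "(\<integral>z. bs_weight N z * (W z * g z) \<partial>circle_measure) = (\<integral>z. W z * g z \<partial>bs_measure N)"
    by (simp add: integral_bs[OF cWg] integral_circle_measure[OF borel_measurable_circle_continuous[OF cb]])
  finally show ?thesis using entropy_bound[of N] unfolding eq by linarith
qed

text \<open>The approximating polynomial is raised by \<eta> so as to lie above g: it stays positive
  and the logarithms compare in the right direction, at the cost of 2 \<eta> W on the other
  side.\<close>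

lemma bound_continuous:
  assumes g: "continuous_on (sphere 0 1) g" "\<And>z. norm z = 1 \<Longrightarrow> g z > 0"
  shows "(\<integral>z. W z * ln (g z) \<partial>circle_measure) \<le> K + (\<integral>z. W z * g z \<partial>\<mu>)"
proof (rule field_le_epsilon)
  fix \<epsilon> :: real assume "\<epsilon> > 0"
  define I where "I = (\<integral>z. W z \<partial>\<mu>)"
  have "I \<ge> 0" unfolding I_def by (intro integral_nonneg_AE) (simp add: W_nonneg)
  define \<eta> where "\<eta> = \<epsilon> / (2 * (I + 1))"
  have "\<eta> > 0" using \<open>\<epsilon> > 0\<close> \<open>I \<ge> 0\<close> by (simp add: \<eta>_def)
  obtain r where r: "real_polynomial_function r" "\<And>z. z \<in> sphere 0 1 \<Longrightarrow> \<bar>g z - r z\<bar> < \<eta>"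
    using Stone_Weierstrass_real_polynomial_function[OF compact_sphere g(1) \<open>\<eta> > 0\<close>] by blast
  define s where "s z = r z + \<eta>" for z
  have s: "real_polynomial_function s"
    unfolding s_def by (intro real_polynomial_function.intros(2,3) r)
  have cs: "continuous_on (sphere 0 1) s"
    using continuous_real_polymonial_function[OF s] by (simp add: continuous_at_imp_continuous_on)
  have gs: "g z \<le> s z" "s z \<le> g z + 2 * \<eta>" if "norm z = 1" for z
    using r(2)[of z] that by (auto simp: s_def abs_less_iff)
  have spos: "s z > 0" if "norm z = 1" for z using gs(1)[OF that] g(2)[OF that] by linarith
  have "(\<integral>z. W z * ln (g z) \<partial>circle_measure) \<le> (\<integral>z. W z * ln (s z) \<partial>circle_measure)"
  proof (rule integral_mono)
    show "integrable circle_measure (\<lambda>z. W z * ln (g z))" "integrable circle_measure (\<lambda>z. W z * ln (s z))"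
      using g spos by (intro int_lam continuous_intros W_continuous cs; force)+
    fix z assume "z \<in> space circle_measure"
    then have "norm z = 1" by (simp add: space_lam)
    then show "W z * ln (g z) \<le> W z * ln (s z)"
      using gs(1) g(2) by (intro mult_left_mono W_nonneg) (simp add: ln_mono)
  qed
  also have "\<dots> \<le> K + (\<integral>z. W z * s z \<partial>\<mu>)"
    by (intro bound_laurent laurent_real_polynomial s cs spos)
  also have "(\<integral>z. W z * s z \<partial>\<mu>) \<le> (\<integral>z. W z * g z + 2 * \<eta> * W z \<partial>\<mu>)"
  proof (rule integral_mono)
    show "integrable \<mu> (\<lambda>z. W z * s z)" "integrable \<mu> (\<lambda>z. W z * g z + 2 * \<eta> * W z)"
      by (intro int_\<mu> continuous_intros W_continuous cs g)+
    fix z assume "z \<in> space \<mu>"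
    then have "norm z = 1" by (simp add: space_\<mu>)
    from mult_left_mono[OF gs(2)[OF this] W_nonneg[of z]]
    show "W z * s z \<le> W z * g z + 2 * \<eta> * W z" by (simp add: algebra_simps)
  qed
  also have "(\<integral>z. W z * g z + 2 * \<eta> * W z \<partial>\<mu>) = (\<integral>z. W z * g z \<partial>\<mu>) + 2 * \<eta> * I"
    unfolding I_def by (subst Bochner_Integration.integral_add) (intro int_\<mu> continuous_intros W_continuous g refl | simp)+
  also have "2 * \<eta> * I \<le> \<epsilon>"
    using \<open>\<epsilon> > 0\<close> \<open>I \<ge> 0\<close> by (simp add: \<eta>_def field_simps)
  finally show "(\<integral>z. W z * ln (g z) \<partial>circle_measure) \<le> K + (\<integral>z. W z * g z \<partial>\<mu>) + \<epsilon>" by simp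
qed

text \<open>On [1, \<infinity>) the logarithm is 1-Lipschitz, so approximation in the mean controls
  both sides, provided that it holds for arc length and for \<mu> at once. Truncating the
  approximant to \<open>max 1 (f z)\<close> does not increase its distance to g.\<close>

lemma bound_borel:
  assumes g: "g \<in> borel_measurable borel" "\<And>z. 1 \<le> g z" "\<And>z. g z \<le> B"
  shows "(\<integral>z. W z * ln (g z) \<partial>circle_measure) \<le> K + (\<integral>z. W z * g z \<partial>\<mu>)"
proof (rule field_le_epsilon)
  fix \<epsilon> :: real assume "\<epsilon> > 0"
  have "bounded (W ` sphere 0 1)"
    by (intro compact_imp_bounded compact_continuous_image W_continuous) simp
  then obtain C where C0: "C > 0" "\<forall>x\<in>W ` sphere 0 1. norm x \<le> C"
    unfolding bounded_pos by blast
  then have C: "C > 0" "\<And>z. norm z = 1 \<Longrightarrow> W z \<le> C" by (force dest: abs_le_D1)+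
  define \<eta> where "\<eta> = \<epsilon> / (2 * C)"
  have "\<eta> > 0" using \<open>\<epsilon> > 0\<close> C by (simp add: \<eta>_def)
  have gB: "\<bar>g z\<bar> \<le> B" for z using g(2)[of z] g(3)[of z] by simp
  then obtain f where f: "continuous_on UNIV f" "(\<integral>z. \<bar>g z - f z\<bar> \<partial>circle_measure) < \<eta>" "(\<integral>z. \<bar>g z - f z\<bar> \<partial>\<mu>) < \<eta>"
    using L1_approx_circle[OF finite_lam sets_circle_measure finite_\<mu> sets_\<mu> g(1) gB \<open>\<eta> > 0\<close>] by blast
  define s where "s z = max 1 (f z)" for z
  have cs: "continuous_on A s" for A
    unfolding s_def by (intro continuous_intros continuous_on_subset[OF f(1)]) auto
  have s1: "s z \<ge> 1" for z by (simp add: s_def)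
  have gs: "\<bar>g z - s z\<bar> \<le> \<bar>g z - f z\<bar>" for z using g(2)[of z] by (auto simp: s_def)
  have bs: "s \<in> borel_measurable borel" "f \<in> borel_measurable borel"
    by (intro borel_measurable_continuous_onI cs f)+
  have ib: "integrable M u" if M: "finite_measure M" "sets M = sets circle_borel"
    and u: "u \<in> borel_measurable borel" "\<And>z. norm z = 1 \<Longrightarrow> \<bar>u z\<bar> \<le> c" for M c and u :: "complex \<Rightarrow> real"
    using u sets_circle_borel_cong[OF M(2)]
    by (intro finite_measure.integrable_const_bound[OF M(1), of _ c] borel_measurable_circle[OF M(2)] AE_I2) auto
  have bW: "W \<in> borel_measurable borel" by (intro borel_measurable_continuous_onI W_continuous)
  have ig: "integrable M g" if M: "finite_measure M" "sets M = sets circle_borel" for M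
    by (intro ib[OF M, of _ B] g(1) gB)
  have iWg: "integrable M (\<lambda>z. W z * g z)" if M: "finite_measure M" "sets M = sets circle_borel" for M
  proof (intro ib[OF M, of _ "C * B"])
    show "(\<lambda>z. W z * g z) \<in> borel_measurable borel" using bW g(1) by measurable
    fix z :: complex assume "norm z = 1"
    then show "\<bar>W z * g z\<bar> \<le> C * B"
      using C g(2)[of z] g(3)[of z] W_nonneg[of z] unfolding abs_mult by (intro mult_mono) auto
  qed
  have iWl: "integrable circle_measure (\<lambda>z. W z * ln (g z))"
  proof (intro ib[OF finite_lam sets_circle_measure, of _ "C * ln B"])
    show "(\<lambda>z. W z * ln (g z)) \<in> borel_measurable borel" using bW g(1) by measurable
    fix z :: complex assume "norm z = 1"
    then show "\<bar>W z * ln (g z)\<bar> \<le> C * ln B"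
      using C g(2)[of z] g(3)[of z] W_nonneg[of z] unfolding abs_mult by (intro mult_mono) (auto simp: ln_mono)
  qed
  have iWs: "integrable circle_measure (\<lambda>z. W z * ln (s z))"
    using s1 by (intro int_lam continuous_intros W_continuous cs) (metis not_one_le_zero)
  have iWs': "integrable \<mu> (\<lambda>z. W z * s z)" by (intro int_\<mu> continuous_intros W_continuous cs)
  have id: "integrable M (\<lambda>z. C * \<bar>g z - f z\<bar>)" if M: "finite_measure M" "sets M = sets circle_borel" for M
    using M by (intro integrable_mult_right integrable_abs Bochner_Integration.integrable_diff ig integrable_circle
        continuous_on_subset[OF f(1)]) auto
  have "(\<integral>z. W z * ln (g z) \<partial>circle_measure) \<le> (\<integral>z. W z * ln (s z) + C * \<bar>g z - f z\<bar> \<partial>circle_measure)"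
  proof (rule integral_mono)
    fix z assume "z \<in> space circle_measure"
    then have z: "norm z = 1" by (simp add: space_lam)
    have "ln (g z) \<le> ln (s z) + \<bar>g z - f z\<bar>"
      using ln_diff_le[OF g(2) s1, of z z] gs[of z] by linarith
    from mult_left_mono[OF this W_nonneg[of z]]
    have "W z * ln (g z) \<le> W z * ln (s z) + W z * \<bar>g z - f z\<bar>" by (simp add: algebra_simps)
    also have "W z * \<bar>g z - f z\<bar> \<le> C * \<bar>g z - f z\<bar>" using C(2)[OF z] by (intro mult_right_mono) auto
    finally show "W z * ln (g z) \<le> W z * ln (s z) + C * \<bar>g z - f z\<bar>" by simp
  qed (intro Bochner_Integration.integrable_add iWl iWs id finite_lam sets_circle_measure)+
  also have "\<dots> = (\<integral>z. W z * ln (s z) \<partial>circle_measure) + C * (\<integral>z. \<bar>g z - f z\<bar> \<partial>circle_measure)"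
    using iWs id[OF finite_lam sets_circle_measure] by (simp only: Bochner_Integration.integral_add integral_mult_right_zero)
  also have "\<dots> \<le> (K + (\<integral>z. W z * s z \<partial>\<mu>)) + C * \<eta>"
    using s1 f(2) C(1) by (intro add_mono mult_left_mono bound_continuous cs) (auto intro: less_le_trans[OF zero_less_one])
  also have "(\<integral>z. W z * s z \<partial>\<mu>) \<le> (\<integral>z. W z * g z + C * \<bar>g z - f z\<bar> \<partial>\<mu>)"
  proof (rule integral_mono)
    fix z assume "z \<in> space \<mu>"
    then have z: "norm z = 1" by (simp add: space_\<mu>)
    have "s z \<le> g z + \<bar>g z - f z\<bar>" using gs[of z] by linarith
    from mult_left_mono[OF this W_nonneg[of z]]
    have "W z * s z \<le> W z * g z + W z * \<bar>g z - f z\<bar>" by (simp add: algebra_simps)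
    also have "W z * \<bar>g z - f z\<bar> \<le> C * \<bar>g z - f z\<bar>" using C(2)[OF z] by (intro mult_right_mono) auto
    finally show "W z * s z \<le> W z * g z + C * \<bar>g z - f z\<bar>" by simp
  qed (intro Bochner_Integration.integrable_add iWg iWs' id finite_\<mu> sets_\<mu>)+
  also have "\<dots> = (\<integral>z. W z * g z \<partial>\<mu>) + C * (\<integral>z. \<bar>g z - f z\<bar> \<partial>\<mu>)"
    using iWg[OF finite_\<mu> sets_\<mu>] id[OF finite_\<mu> sets_\<mu>] by (simp only: Bochner_Integration.integral_add integral_mult_right_zero)
  also have "\<dots> \<le> (\<integral>z. W z * g z \<partial>\<mu>) + C * \<eta>"
    using f(3) C(1) by (intro add_mono mult_left_mono) auto
  finally have "(\<integral>z. W z * ln (g z) \<partial>circle_measure) \<le> K + (\<integral>z. W z * g z \<partial>\<mu>) + 2 * (C * \<eta>)" by simp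
  also have "2 * (C * \<eta>) = \<epsilon>" using C(1) by (simp add: \<eta>_def)
  finally show "(\<integral>z. W z * ln (g z) \<partial>circle_measure) \<le> K + (\<integral>z. W z * g z \<partial>\<mu>) + \<epsilon>" by simp
qed

end
end

section \<open>Integrability of the logarithm of the density\<close>

lemma e2ennreal_neg_log:
  assumes "P \<ge> 0"
  shows "e2ennreal (- (ereal P * ext_log w)) = (if w > 0 then ennreal (- (P * ln w)) else if P = 0 then 0 else \<top>)"
  using assms by (auto simp: ext_log_def e2ennreal_neg)

lemma e2ennreal_pos_log:
  assumes "0 \<le> P" "P \<le> C" "w \<ge> 0"
  shows "e2ennreal (ereal P * ext_log w) \<le> ennreal (C * w)"
proof (cases "w > 0")
  case True
  have "ln w \<le> w" using ln_le_minus_one[OF True] by simp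
  then have "P * ln w \<le> P * w" using assms by (intro mult_left_mono) auto
  also have "\<dots> \<le> C * w" using assms by (intro mult_right_mono) auto
  finally show ?thesis using True by (simp add: ext_log_def ennreal_leI)
next
  case False
  then have "ereal P * ext_log w \<le> 0" using assms by (cases "P = 0") (auto simp: ext_log_def)
  then show ?thesis by (simp add: e2ennreal_neg)
qed

lemma ennreal_add_le: "0 \<le> x \<Longrightarrow> ennreal (x + y) \<le> ennreal x + ennreal y"
  by (cases "y \<ge> 0") (auto simp: ennreal_neg intro: ennreal_leI)

lemma borel_measurable_ext_log [measurable]: "ext_log \<in> borel_measurable borel"
  unfolding ext_log_def[abs_def] by measurable

text \<open>The endpoint \<open>2*pi\<close> is discarded as a null set because
  \<open>angle_of\<close> inverts cis on the half-open interval only.\<close>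

lemma AE_angle: assumes "\<And>\<theta>. \<theta> \<in> {0..<2*pi} \<Longrightarrow> R \<theta>" shows "AE \<theta> in angle_measure. R \<theta>"
proof (rule AE_uniform_measureI)
  show "AE \<theta> in lborel. \<theta> \<in> {0..2*pi} \<longrightarrow> R \<theta>"
    using AE_lborel_singleton[of "2*pi"] by eventually_elim (use assms in auto)
qed simp

text \<open>A Borel inverse of cis on [0, 2 pi), which turns w into a function on the circle.
  Clamping Re z makes the arccos term continuous on the whole plane, hence measurable.\<close>

definition angle_of :: "complex \<Rightarrow> real" where
  "angle_of z = (let t = arccos (max (- 1) (min 1 (Re z))) in if Im z \<ge> 0 then t else 2 * pi - t)"

lemma angle_of_cis: assumes "\<theta> \<in> {0..<2*pi}" shows "angle_of (cis \<theta>) = \<theta>"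
proof -
  have m: "max (- 1) (min 1 (cos \<theta>)) = cos \<theta>"
    using cos_le_one[of \<theta>] cos_ge_minus_one[of \<theta>] by (simp add: min_absorb2 max_absorb2)
  show ?thesis
  proof (cases "\<theta> \<le> pi")
    case True
    then have "sin \<theta> \<ge> 0" using assms by (intro sin_ge_zero) auto
    then show ?thesis using True assms m by (simp add: angle_of_def arccos_cos)
  next
    case False
    then have "sin \<theta> < 0" using assms by (intro sin_lt_zero) auto
    moreover have "arccos (cos \<theta>) = 2 * pi - \<theta>"
      using False assms arccos_cos[of "2 * pi - \<theta>"] by (simp add: cos_diff)
    ultimately show ?thesis using m by (simp add: angle_of_def)
  qed
qed

lemma borel_measurable_angle_of: "angle_of \<in> borel_measurable borel"
proof -
  have "(\<lambda>z. arccos (max (- 1) (min 1 (Re z)))) \<in> borel_measurable borel"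
    by (intro borel_measurable_continuous_onI continuous_on_arccos continuous_intros) auto
  then show ?thesis unfolding angle_of_def[abs_def] Let_def by measurable
qed

locale decomposed_circle_opuc = circle_opuc +
  fixes w :: "real \<Rightarrow> real" and \<mu>s :: "complex measure"
  assumes decomposition: "lebesgue_decomposition \<mu> w \<mu>s"
begin

definition ac_measure :: "complex measure" where
  "ac_measure = distr (density angle_measure (\<lambda>\<theta>. ennreal (w \<theta>))) circle_borel cis"

lemma w_borel [measurable]: "w \<in> borel_measurable borel"
  and w_nonneg: "\<theta> \<in> {0..2*pi} \<Longrightarrow> w \<theta> \<ge> 0"
  and emeasure_\<mu>: "A \<in> sets circle_borel \<Longrightarrow> emeasure \<mu> A = emeasure ac_measure A + emeasure \<mu>s A"
  using decomposition by (auto simp: lebesgue_decomposition_def ac_measure_def)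

lemma singular_set:
  obtains A where "A \<in> sets circle_borel" "emeasure \<mu>s A = 0" "emeasure circle_measure (sphere 0 1 - A) = 0"
  using decomposition sets_circle_borel_cong[OF sets_circle_measure]
  by (auto simp: lebesgue_decomposition_def mutually_singular_def)

lemma sets_ac: "sets ac_measure = sets circle_borel"
  by (simp add: ac_measure_def)

lemma ac_le: "ac_measure \<le> \<mu>"
proof (subst le_measure)
  show "sets ac_measure = sets \<mu>" by (simp add: sets_ac sets_\<mu>)
  show "\<forall>A\<in>sets ac_measure. emeasure ac_measure A \<le> emeasure \<mu> A"
    by (simp add: sets_ac emeasure_\<mu>)
qed

lemma nn_integral_ac:
  assumes "f \<in> borel_measurable circle_borel"
  shows "(\<integral>\<^sup>+z. f z \<partial>ac_measure) = (\<integral>\<^sup>+\<theta>. ennreal (w \<theta>) * f (cis \<theta>) \<partial>angle_measure)"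
proof -
  have c: "cis \<in> measurable angle_measure circle_borel" by (rule cis_measurable)
  have "(\<integral>\<^sup>+z. f z \<partial>ac_measure) = (\<integral>\<^sup>+\<theta>. f (cis \<theta>) \<partial>density angle_measure (\<lambda>\<theta>. ennreal (w \<theta>)))"
    unfolding ac_measure_def using c assms by (intro nn_integral_distr) auto
  also have "\<dots> = (\<integral>\<^sup>+\<theta>. ennreal (w \<theta>) * f (cis \<theta>) \<partial>angle_measure)"
    using measurable_compose[OF c assms] by (intro nn_integral_density) (auto simp: uniform_measure_def)
  finally show ?thesis .
qed

lemma nn_integral_ac_le:
  assumes "f \<in> borel_measurable circle_borel"
  shows "(\<integral>\<^sup>+\<theta>. ennreal (w \<theta>) * f (cis \<theta>) \<partial>angle_measure) \<le> (\<integral>\<^sup>+z. f z \<partial>\<mu>)"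
  unfolding nn_integral_ac[OF assms, symmetric]
  by (rule nn_integral_mono_measure[OF _ ac_le]) (simp add: sets_ac sets_\<mu>)

lemma nn_integral_w: "(\<integral>\<^sup>+\<theta>. ennreal (w \<theta>) \<partial>angle_measure) \<le> 1"
  using nn_integral_ac_le[of "\<lambda>z. 1"] prob_space.emeasure_space_1[OF prob_space_\<mu>] by simp

text \<open>On A, \<mu> is dominated by its absolutely continuous part; off A, f is at most 1 and
  the mass of \<mu> is at most 1.\<close>

lemma nn_integral_\<mu>_split:
  assumes A: "A \<in> sets circle_borel" "emeasure \<mu>s A = 0" and f: "f \<in> borel_measurable circle_borel"
    and "\<And>z. z \<in> sphere 0 1 - A \<Longrightarrow> f z \<le> 1"
  shows "(\<integral>\<^sup>+z. f z \<partial>\<mu>) \<le> (\<integral>\<^sup>+\<theta>. ennreal (w \<theta>) * f (cis \<theta>) \<partial>angle_measure) + 1"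
proof -
  have fm: "f \<in> borel_measurable \<mu>" and Am: "A \<in> sets \<mu>"
    using f A by (simp_all add: measurable_cong_sets[OF sets_\<mu> refl] sets_\<mu>)
  have "density \<mu> (indicator A) \<le> ac_measure"
  proof (subst le_measure)
    show "sets (density \<mu> (indicator A)) = sets ac_measure" by (simp add: sets_ac sets_\<mu>)
    show "\<forall>X\<in>sets (density \<mu> (indicator A)). emeasure (density \<mu> (indicator A)) X \<le> emeasure ac_measure X"
    proof
      fix X assume "X \<in> sets (density \<mu> (indicator A))"
      then have X: "X \<in> sets \<mu>" by simp
      have "emeasure (density \<mu> (indicator A)) X = (\<integral>\<^sup>+z. indicator A z * indicator X z \<partial>\<mu>)"
        using X Am by (intro emeasure_density) auto
      also have "\<dots> = (\<integral>\<^sup>+z. indicator (A \<inter> X) z \<partial>\<mu>)"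
        by (simp only: indicator_inter_arith)
      also have "\<dots> = emeasure \<mu> (A \<inter> X)" using X Am by (intro nn_integral_indicator) auto
      also have "\<dots> = emeasure ac_measure (A \<inter> X) + emeasure \<mu>s (A \<inter> X)"
        using X Am by (intro emeasure_\<mu>) (auto simp: sets_\<mu>)
      also have "emeasure \<mu>s (A \<inter> X) \<le> emeasure \<mu>s A"
        using decomposition A X by (intro emeasure_mono) (auto simp: lebesgue_decomposition_def)
      also have "emeasure ac_measure (A \<inter> X) \<le> emeasure ac_measure X"
        using X by (intro emeasure_mono) (auto simp: sets_ac sets_\<mu>)
      finally show "emeasure (density \<mu> (indicator A)) X \<le> emeasure ac_measure X"
        using A(2) by (simp add: add_mono)
    qed
  qed
  then have le: "(\<integral>\<^sup>+z. f z \<partial>density \<mu> (indicator A)) \<le> (\<integral>\<^sup>+z. f z \<partial>ac_measure)"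
    by (intro nn_integral_mono_measure) (simp_all add: sets_ac sets_\<mu>)
  have "(\<integral>\<^sup>+z. f z \<partial>\<mu>) \<le> (\<integral>\<^sup>+z. indicator A z * f z + 1 \<partial>\<mu>)"
    using assms(4) by (intro nn_integral_mono) (auto simp: indicator_def space_\<mu>)
  also have "\<dots> = (\<integral>\<^sup>+z. indicator A z * f z \<partial>\<mu>) + 1"
    using fm Am prob_space.emeasure_space_1[OF prob_space_\<mu>] by (subst nn_integral_add) auto
  also have "(\<integral>\<^sup>+z. indicator A z * f z \<partial>\<mu>) = (\<integral>\<^sup>+z. f z \<partial>density \<mu> (indicator A))"
    using fm Am by (intro nn_integral_density[symmetric]) auto
  finally show ?thesis using le nn_integral_ac[OF f] by (simp add: add_right_mono order.trans)
qed

context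
  fixes q :: "complex poly" and P :: "real \<Rightarrow> real"
  assumes P_eq: "\<And>\<theta>. P \<theta> = (norm (poly q (cis \<theta>)))\<^sup>2"
begin

lemma P_nonneg: "P \<theta> \<ge> 0" by (simp add: P_eq)

lemma P_borel [measurable]: "P \<in> borel_measurable borel"
proof -
  have "P = (\<lambda>\<theta>. (norm (poly q (cis \<theta>)))\<^sup>2)" by (rule ext) (rule P_eq)
  then show ?thesis by (simp only:) (intro borel_measurable_continuous_onI continuous_intros)
qed

lemma P_bounded: obtains C where "C > 0" "\<And>\<theta>. P \<theta> \<le> C"
proof -
  have "bounded ((\<lambda>z. (norm (poly q z))\<^sup>2) ` sphere 0 1)"
    by (intro compact_imp_bounded compact_continuous_image continuous_intros) simp
  then obtain C where C: "C > 0" "\<forall>x\<in>(\<lambda>z. (norm (poly q z))\<^sup>2) ` sphere 0 1. norm x \<le> C"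
    unfolding bounded_pos by blast
  then have "P \<theta> \<le> C" for \<theta> unfolding P_eq by (force dest: abs_le_D1)
  with C(1) show ?thesis by (rule that)
qed

text \<open>The positive part is always finite, since ln w \<le> w and w has integral at most 1;
  only the negative part decides.\<close>

lemma ext_integral_finite_iff:
  "ext_integral angle_measure (\<lambda>\<theta>. ereal (P \<theta>) * ext_log (w \<theta>)) > -\<infinity> \<longleftrightarrow>
   (\<integral>\<^sup>+\<theta>. e2ennreal (- (ereal (P \<theta>) * ext_log (w \<theta>))) \<partial>angle_measure) < \<infinity>"
proof -
  obtain C where C: "C > 0" "\<And>\<theta>. P \<theta> \<le> C" by (rule P_bounded) blast
  have "(\<integral>\<^sup>+\<theta>. e2ennreal (ereal (P \<theta>) * ext_log (w \<theta>)) \<partial>angle_measure) \<le> (\<integral>\<^sup>+\<theta>. ennreal C * ennreal (w \<theta>) \<partial>angle_measure)"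
    using P_nonneg C w_nonneg
    by (intro nn_integral_mono_AE AE_angle) (auto simp: ennreal_mult[symmetric] intro!: e2ennreal_pos_log)
  also have "\<dots> = ennreal C * (\<integral>\<^sup>+\<theta>. ennreal (w \<theta>) \<partial>angle_measure)"
    by (intro nn_integral_cmult) (auto simp: uniform_measure_def)
  also have "\<dots> \<le> ennreal C * 1" by (intro mult_left_mono nn_integral_w) simp
  finally have "(\<integral>\<^sup>+\<theta>. e2ennreal (ereal (P \<theta>) * ext_log (w \<theta>)) \<partial>angle_measure) < \<infinity>"
    by (simp add: le_less_trans)
  moreover have "enn2ereal x - enn2ereal y > -\<infinity> \<longleftrightarrow> y < \<infinity>" if "x < \<infinity>" for x y :: ennreal
    using that by (cases x; cases y) (auto simp: top_ereal_def enn2ereal_ennreal)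
  ultimately show ?thesis unfolding ext_integral_def by blast
qed

definition entropy :: "nat \<Rightarrow> real" where
  "entropy N = (LINT \<theta>|angle_measure. P \<theta> * ln ((norm (poly (\<Phi> N) (cis \<theta>)))\<^sup>2 / h N))"

text \<open>With v = 1 / w_N, ln (w v) \<le> w v - 1 gives P ln v \<le> C w v - P ln w pointwise;
  where w = 0 the negative part is infinite unless P = 0. The integral of w v is at most that of
  |\<Phi>_N|^2 / h_N against \<mu>, which is 1 by \<open>h_eq\<close>.\<close>

lemma entropy_bounded_if:
  assumes "(\<integral>\<^sup>+\<theta>. e2ennreal (- (ereal (P \<theta>) * ext_log (w \<theta>))) \<partial>angle_measure) < \<infinity>"
  shows "\<exists>K. \<forall>N. entropy N \<le> K"
proof -
  let ?neg = "\<lambda>\<theta>. e2ennreal (- (ereal (P \<theta>) * ext_log (w \<theta>)))"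
  obtain C where C: "C > 0" "\<And>\<theta>. P \<theta> \<le> C" by (rule P_bounded) blast
  define I where "I = ennreal C + (\<integral>\<^sup>+\<theta>. ?neg \<theta> \<partial>angle_measure)"
  have "I < \<infinity>" using assms by (simp add: I_def)
  have "entropy N \<le> enn2real I" for N
  proof -
    define v where "v \<theta> = (norm (poly (\<Phi> N) (cis \<theta>)))\<^sup>2 / h N" for \<theta>
    have v_pos: "v \<theta> > 0" for \<theta> using h_pos[of N] \<Phi>_nonzero_circle[of "cis \<theta>" N] by (simp add: v_def)
    have cv: "continuous_on UNIV v" unfolding v_def using h_pos[of N] by (intro continuous_intros) auto
    have [measurable]: "v \<in> borel_measurable borel" by (rule borel_measurable_continuous_onI[OF cv])
    have "continuous_on UNIV P"
      by (subst P_eq[abs_def]) (intro continuous_intros)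
    then have int: "integrable angle_measure (\<lambda>\<theta>. P \<theta> * ln (v \<theta>))"
      using v_pos by (intro integral_angle continuous_intros cv) (auto simp: less_le)
    have m: "(\<lambda>z. ennreal ((norm (poly (\<Phi> N) z))\<^sup>2 / h N)) \<in> borel_measurable circle_borel"
      using h_pos[of N] by (intro measurable_compose[OF _ measurable_ennreal] borel_measurable_circle_continuous continuous_intros) auto
    have "(\<integral>\<^sup>+\<theta>. ennreal (w \<theta>) * ennreal (v \<theta>) \<partial>angle_measure) \<le> (\<integral>\<^sup>+z. ennreal ((norm (poly (\<Phi> N) z))\<^sup>2 / h N) \<partial>\<mu>)"
      unfolding v_def using nn_integral_ac_le[OF m] .
    also have "\<dots> = ennreal (\<integral>z. (norm (poly (\<Phi> N) z))\<^sup>2 / h N \<partial>\<mu>)"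
      using h_pos[of N] by (intro nn_integral_eq_integral integrable_circle finite_\<mu> sets_\<mu> continuous_intros AE_I2) auto
    also have "(\<integral>z. (norm (poly (\<Phi> N) z))\<^sup>2 / h N \<partial>\<mu>) = 1"
      using h_pos[of N] by (simp add: h_eq)
    finally have wv: "(\<integral>\<^sup>+\<theta>. ennreal (w \<theta>) * ennreal (v \<theta>) \<partial>angle_measure) \<le> 1" by simp
    have "(\<integral>\<^sup>+\<theta>. ennreal (P \<theta> * ln (v \<theta>)) \<partial>angle_measure) \<le> (\<integral>\<^sup>+\<theta>. ennreal C * (ennreal (w \<theta>) * ennreal (v \<theta>)) + ?neg \<theta> \<partial>angle_measure)"
    proof (intro nn_integral_mono_AE AE_angle)
      fix \<theta> :: real assume \<theta>: "\<theta> \<in> {0..<2*pi}"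
      then have w: "w \<theta> \<ge> 0" by (intro w_nonneg) auto
      have e: "ennreal C * (ennreal (w \<theta>) * ennreal (v \<theta>)) = ennreal (C * (w \<theta> * v \<theta>))"
        using C(1) w v_pos[of \<theta>] by (simp add: ennreal_mult)
      show "ennreal (P \<theta> * ln (v \<theta>)) \<le> ennreal C * (ennreal (w \<theta>) * ennreal (v \<theta>)) + ?neg \<theta>"
      proof (cases "w \<theta> > 0")
        case True
        have "ln (w \<theta> * v \<theta>) \<le> w \<theta> * v \<theta> - 1" using True v_pos[of \<theta>] by (intro ln_le_minus_one) auto
        then have "ln (v \<theta>) \<le> w \<theta> * v \<theta> - ln (w \<theta>)" using True v_pos[of \<theta>] by (simp add: ln_mult_pos)
        from mult_left_mono[OF this P_nonneg[of \<theta>]]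
        have "P \<theta> * ln (v \<theta>) \<le> P \<theta> * (w \<theta> * v \<theta>) + - (P \<theta> * ln (w \<theta>))" by (simp add: algebra_simps)
        also have "P \<theta> * (w \<theta> * v \<theta>) \<le> C * (w \<theta> * v \<theta>)"
          using C(2)[of \<theta>] w v_pos[of \<theta>] by (intro mult_right_mono) auto
        finally have le: "P \<theta> * ln (v \<theta>) \<le> C * (w \<theta> * v \<theta>) + - (P \<theta> * ln (w \<theta>))" by simp
        have "0 \<le> C * (w \<theta> * v \<theta>)" using C(1) w v_pos[of \<theta>] by simp
        then have "ennreal (C * (w \<theta> * v \<theta>) + - (P \<theta> * ln (w \<theta>))) \<le> ennreal (C * (w \<theta> * v \<theta>)) + ennreal (- (P \<theta> * ln (w \<theta>)))"
          by (rule ennreal_add_le)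
        with ennreal_leI[OF le] show ?thesis
          unfolding e e2ennreal_neg_log[OF P_nonneg] using True by (simp add: order.trans)
      next
        case False
        then show ?thesis using P_nonneg[of \<theta>] by (simp add: e2ennreal_neg_log)
      qed
    qed
    also have "\<dots> = (\<integral>\<^sup>+\<theta>. ennreal C * (ennreal (w \<theta>) * ennreal (v \<theta>)) \<partial>angle_measure) + (\<integral>\<^sup>+\<theta>. ?neg \<theta> \<partial>angle_measure)"
      by (intro nn_integral_add) (auto simp: uniform_measure_def)
    also have "(\<integral>\<^sup>+\<theta>. ennreal C * (ennreal (w \<theta>) * ennreal (v \<theta>)) \<partial>angle_measure) = ennreal C * (\<integral>\<^sup>+\<theta>. ennreal (w \<theta>) * ennreal (v \<theta>) \<partial>angle_measure)"
      by (intro nn_integral_cmult) (auto simp: uniform_measure_def)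
    also have "\<dots> \<le> ennreal C * 1" using wv by (intro mult_left_mono) auto
    finally have le: "(\<integral>\<^sup>+\<theta>. ennreal (P \<theta> * ln (v \<theta>)) \<partial>angle_measure) \<le> I" by (simp add: I_def add_right_mono)
    have "entropy N \<le> (LINT \<theta>|angle_measure. max 0 (P \<theta> * ln (v \<theta>)))"
      unfolding entropy_def v_def[symmetric] using int by (intro integral_mono integrable_max) auto
    also have "\<dots> = enn2real (\<integral>\<^sup>+\<theta>. ennreal (max 0 (P \<theta> * ln (v \<theta>))) \<partial>angle_measure)"
      using int by (intro integral_eq_nn_integral) (auto intro!: borel_measurable_max)
    also have "(\<integral>\<^sup>+\<theta>. ennreal (max 0 (P \<theta> * ln (v \<theta>))) \<partial>angle_measure) = (\<integral>\<^sup>+\<theta>. ennreal (P \<theta> * ln (v \<theta>)) \<partial>angle_measure)"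
      by (intro nn_integral_cong) (simp add: max_def ennreal_neg)
    also have "enn2real \<dots> \<le> enn2real I" using le \<open>I < \<infinity>\<close> by (intro enn2real_mono) auto
    finally show ?thesis .
  qed
  then show ?thesis by blast
qed

text \<open>\<open>bound_borel\<close> is applied to the reciprocal of the clamped w on A, and to 1
  off A. The clamp at 1 ensures g \<ge> 1 and the one at \<epsilon> makes g bounded. The resulting
  bound is free of \<epsilon>: w g \<le> w + 1 contributes at most 2 and the part of \<mu> off A at
  most 1, whence 3 C.\<close>

lemma clamp_bound:
  assumes K: "\<And>N. entropy N \<le> K" and \<epsilon>: "0 < \<epsilon>" "\<epsilon> < 1" and C: "C > 0" "\<And>\<theta>. P \<theta> \<le> C"
  shows "(\<integral>\<^sup>+\<theta>. ennreal (P \<theta> * - ln (max \<epsilon> (min 1 (w \<theta>)))) \<partial>angle_measure) \<le> ennreal (K + 3 * C)"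
proof -
  let ?c = "\<lambda>x. max \<epsilon> (min 1 x)"
  obtain A where A: "A \<in> sets circle_borel" "emeasure \<mu>s A = 0" "emeasure circle_measure (sphere 0 1 - A) = 0"
    by (rule singular_set)
  have "A \<in> sets borel"
    using A(1) by (auto simp: circle_borel_def sets_restrict_space)
  define g where "g z = (if z \<in> A then 1 / ?c (w (angle_of z)) else 1)" for z
  have g_borel: "g \<in> borel_measurable borel"
    unfolding g_def[abs_def] using \<open>A \<in> sets borel\<close> borel_measurable_angle_of w_borel by measurable
  have c: "\<epsilon> \<le> ?c x" "?c x \<le> 1" "?c x > 0" for x using \<epsilon> by auto
  have g1: "1 \<le> g z" for z using c(2,3)[of "w (angle_of z)"] by (simp add: g_def)
  have g2: "g z \<le> 1 / \<epsilon>" for z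
    using c(1)[of "w (angle_of z)"] \<epsilon> by (auto simp: g_def intro!: divide_left_mono)
  define W where "W z = (norm (poly q z))\<^sup>2" for z
  have W_cont: "continuous_on S W" for S unfolding W_def by (intro continuous_intros)
  have W_P: "W (cis \<theta>) = P \<theta>" for \<theta> by (simp add: W_def P_eq)
  have W_C: "W z \<le> C" if "norm z = 1" for z
  proof -
    have "z = cis (Arg z)" using that cis_Arg[of z] by (cases "z = 0") (auto simp: sgn_eq)
    then show ?thesis using C(2) W_P by metis
  qed
  have gc: "g \<in> borel_measurable circle_borel" by (rule borel_measurable_circle[OF refl g_borel])
  have Wc: "W \<in> borel_measurable circle_borel" by (rule borel_measurable_circle_continuous[OF W_cont])
  have lg: "(\<lambda>z. W z * ln (g z)) \<in> borel_measurable circle_borel"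
    by (intro borel_measurable_times borel_measurable_ln gc Wc)
  have ent: "(\<integral>z. W z * ln ((norm (poly (\<Phi> N) z))\<^sup>2 / h N) \<partial>circle_measure) \<le> K" for N
  proof -
    have "continuous_on (sphere 0 1) (\<lambda>z. W z * ln ((norm (poly (\<Phi> N) z))\<^sup>2 / h N))"
      using h_pos[of N] by (intro continuous_intros W_cont) (auto simp: \<Phi>_nonzero_circle)
    from integral_circle_measure[OF borel_measurable_circle_continuous[OF this]] show ?thesis
      using K[of N] by (simp add: entropy_def W_P)
  qed
  have main: "(\<integral>z. W z * ln (g z) \<partial>circle_measure) \<le> K + (\<integral>z. W z * g z \<partial>\<mu>)"
    using bound_borel[OF ent[unfolded W_def] g_borel g1 g2] by (simp add: W_def)
  \<comment> \<open>A has full arc length, so under the angle measure g is almost everywhere the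
    reciprocal of the clamped w.\<close>
  have "AE z in circle_measure. z \<in> A"
  proof (rule AE_I[OF _ A(3)])
    note sp = sets_circle_borel_cong[OF sets_circle_measure]
    show "{z \<in> space circle_measure. z \<notin> A} \<subseteq> sphere 0 1 - A" unfolding sp by blast
    show "sphere 0 1 - A \<in> sets circle_measure"
      using A(1) unfolding sp[symmetric] by (intro sets.compl_sets) (simp only: sets_circle_measure)
  qed
  moreover have "{z \<in> space circle_borel. z \<in> A} = A" using sets.sets_into_space[OF A(1)] by blast
  ultimately have AEA: "AE \<theta> in angle_measure. cis \<theta> \<in> A"
    unfolding circle_measure_def using A(1) by (simp add: AE_distr_iff[OF cis_measurable])
  have AE0: "AE \<theta> in angle_measure. \<theta> \<in> {0..<2*pi}" by (rule AE_angle)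
  have AEg: "AE \<theta> in angle_measure. W (cis \<theta>) * ln (g (cis \<theta>)) = P \<theta> * - ln (?c (w \<theta>))"
    using AEA AE0
  proof eventually_elim
    case (elim \<theta>)
    then have "g (cis \<theta>) = inverse (?c (w \<theta>))" by (simp add: g_def angle_of_cis inverse_eq_divide)
    then show ?case using c(3)[of "w \<theta>"] by (simp only: W_P ln_inverse)
  qed
  have mP: "(\<lambda>\<theta>. P \<theta> * - ln (?c (w \<theta>))) \<in> borel_measurable angle_measure"
    using P_borel w_borel by (simp add: uniform_measure_def)
  have nn: "P \<theta> * - ln (?c (w \<theta>)) \<ge> 0" for \<theta>
    using c(2,3)[of "w \<theta>"] P_nonneg[of \<theta>] by (intro mult_nonneg_nonneg) auto
  have iL: "integrable angle_measure (\<lambda>\<theta>. P \<theta> * - ln (?c (w \<theta>)))"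
  proof (rule finite_measure.integrable_const_bound[OF _ _ mP])
    show "finite_measure angle_measure" using prob_space_angle by (simp add: prob_space_def)
    have "\<bar>P \<theta> * - ln (?c (w \<theta>))\<bar> \<le> C * - ln \<epsilon>" for \<theta>
      unfolding abs_of_nonneg[OF nn] using c(1,2,3)[of "w \<theta>"] C P_nonneg[of \<theta>] \<epsilon>
      by (intro mult_mono) (auto intro: ln_mono)
    then show "AE \<theta> in angle_measure. norm (P \<theta> * - ln (?c (w \<theta>))) \<le> C * - ln \<epsilon>" by simp
  qed
  have "(\<integral>z. W z * ln (g z) \<partial>circle_measure) = (LINT \<theta>|angle_measure. W (cis \<theta>) * ln (g (cis \<theta>)))"
    by (rule integral_circle_measure[OF lg])
  also have "\<dots> = (LINT \<theta>|angle_measure. P \<theta> * - ln (?c (w \<theta>)))"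
    by (intro integral_cong_AE AEg mP measurable_compose[OF cis_measurable lg])
  finally have eq: "(\<integral>z. W z * ln (g z) \<partial>circle_measure) = (LINT \<theta>|angle_measure. P \<theta> * - ln (?c (w \<theta>)))" .
  have "(\<integral>\<^sup>+z. ennreal (g z) \<partial>\<mu>) \<le> (\<integral>\<^sup>+\<theta>. ennreal (w \<theta>) * ennreal (g (cis \<theta>)) \<partial>angle_measure) + 1"
    by (rule nn_integral_\<mu>_split[OF A(1,2) measurable_compose[OF gc measurable_ennreal]]) (simp add: g_def)
  also have "(\<integral>\<^sup>+\<theta>. ennreal (w \<theta>) * ennreal (g (cis \<theta>)) \<partial>angle_measure) \<le> (\<integral>\<^sup>+\<theta>. ennreal (w \<theta>) + 1 \<partial>angle_measure)"
  proof (rule nn_integral_mono_AE)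
    show "AE \<theta> in angle_measure. ennreal (w \<theta>) * ennreal (g (cis \<theta>)) \<le> ennreal (w \<theta>) + 1"
      using AEA AE0
    proof eventually_elim
      case (elim \<theta>)
      then have w: "w \<theta> \<ge> 0" and g: "g (cis \<theta>) = 1 / ?c (w \<theta>)"
        by (auto simp: g_def angle_of_cis intro: w_nonneg)
      \<comment> \<open>The quotient of w by its clamped value is w itself for w \<ge> 1 and at most
        1 otherwise.\<close>
      have "w \<theta> \<le> (w \<theta> + 1) * ?c (w \<theta>)"
      proof (cases "w \<theta> \<ge> 1")
        case True
        then have "?c (w \<theta>) = 1" using \<epsilon> by simp
        then show ?thesis by simp
      next
        case False
        then have "w \<theta> \<le> ?c (w \<theta>)" by simp
        also have "?c (w \<theta>) \<le> (w \<theta> + 1) * ?c (w \<theta>)" using w c(3)[of "w \<theta>"] by (simp add: algebra_simps)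
        finally show ?thesis .
      qed
      then have "w \<theta> * g (cis \<theta>) \<le> w \<theta> + 1"
        unfolding g using c(3)[of "w \<theta>"] by (simp add: pos_divide_le_eq)
      then show ?case
        using w g1[of "cis \<theta>"] by (simp add: ennreal_mult[symmetric] ennreal_leI flip: ennreal_1 ennreal_plus)
    qed
  qed
  also have "(\<integral>\<^sup>+\<theta>. ennreal (w \<theta>) + 1 \<partial>angle_measure) = (\<integral>\<^sup>+\<theta>. ennreal (w \<theta>) \<partial>angle_measure) + (\<integral>\<^sup>+\<theta>. 1 \<partial>angle_measure)"
    by (intro nn_integral_add) (auto simp: uniform_measure_def)
  also have "(\<integral>\<^sup>+\<theta>. 1 \<partial>angle_measure) = 1"
    using prob_space.emeasure_space_1[OF prob_space_angle] by simp
  also have "(\<integral>\<^sup>+\<theta>. ennreal (w \<theta>) \<partial>angle_measure) \<le> 1" by (rule nn_integral_w)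
  finally have "(\<integral>\<^sup>+z. ennreal (g z) \<partial>\<mu>) \<le> 1 + 1 + 1" by (simp add: add_right_mono)
  moreover have "(1 + 1 + 1 :: ennreal) = ennreal 3" by simp
  moreover have ig: "integrable \<mu> g"
    using g1 g2 by (intro finite_measure.integrable_const_bound[OF finite_\<mu>, of _ "1 / \<epsilon>"] borel_measurable_circle[OF sets_\<mu> g_borel])
      (auto simp: abs_of_nonneg order.trans[OF zero_le_one])
  ultimately have "ennreal (\<integral>z. g z \<partial>\<mu>) \<le> ennreal 3"
    using nn_integral_eq_integral[OF ig] g1 by (simp add: order.trans[OF zero_le_one])
  then have g3: "(\<integral>z. g z \<partial>\<mu>) \<le> 3" by (subst (asm) ennreal_le_iff) simp_all
  have "(\<integral>z. W z * g z \<partial>\<mu>) \<le> (\<integral>z. C * g z \<partial>\<mu>)"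
  proof (rule integral_mono_AE')
    show "integrable \<mu> (\<lambda>z. C * g z)" using ig by simp
    show "AE z in \<mu>. W z * g z \<le> C * g z"
      using W_C g1 by (intro AE_I2 mult_right_mono) (auto simp: space_\<mu> order.trans[OF zero_le_one])
    show "AE z in \<mu>. 0 \<le> C * g z"
      using g1 C(1) by (intro AE_I2 mult_nonneg_nonneg) (auto simp: order.trans[OF zero_le_one])
  qed
  also have "\<dots> \<le> 3 * C" using g3 C(1) by simp
  finally have "(LINT \<theta>|angle_measure. P \<theta> * - ln (?c (w \<theta>))) \<le> K + 3 * C"
    using main eq by linarith
  then show ?thesis using nn_integral_eq_integral[OF iL] nn by (simp add: ennreal_leI)
qed

text \<open>Monotone convergence as the lower clamp decreases to 0, the bound of
  \<open>clamp_bound\<close> being uniform. Capping w at 1 discards only points where - ln w is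
  negative, which the negative part ignores anyway.\<close>

lemma finite_if_entropy_bounded:
  assumes K: "\<And>N. entropy N \<le> K"
  shows "(\<integral>\<^sup>+\<theta>. e2ennreal (- (ereal (P \<theta>) * ext_log (w \<theta>))) \<partial>angle_measure) < \<infinity>"
proof -
  obtain C where C: "C > 0" "\<And>\<theta>. P \<theta> \<le> C" by (rule P_bounded) blast
  \<comment> \<open>The offset 2 keeps \<open>\<epsilon> i < 1\<close> at i = 0.\<close>
  define \<epsilon> where "\<epsilon> i = 1 / real (i + 2)" for i :: nat
  have \<epsilon>: "0 < \<epsilon> i" "\<epsilon> i < 1" for i by (auto simp: \<epsilon>_def)
  define L where "L i \<theta> = ennreal (P \<theta> * - ln (max (\<epsilon> i) (min 1 (w \<theta>))))" for i \<theta>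
  have "incseq L"
  proof (intro incseq_SucI le_funI)
    fix i \<theta>
    have "\<epsilon> (Suc i) \<le> \<epsilon> i" by (simp add: \<epsilon>_def field_simps)
    then have "ln (max (\<epsilon> (Suc i)) (min 1 (w \<theta>))) \<le> ln (max (\<epsilon> i) (min 1 (w \<theta>)))"
      using \<epsilon>[of "Suc i"] \<epsilon>[of i] by (intro ln_mono) (auto simp: less_max_iff_disj)
    then show "L i \<theta> \<le> L (Suc i) \<theta>"
      unfolding L_def using P_nonneg[of \<theta>] by (intro ennreal_leI mult_left_mono) auto
  qed
  have "(\<integral>\<^sup>+\<theta>. e2ennreal (- (ereal (P \<theta>) * ext_log (w \<theta>))) \<partial>angle_measure) \<le> (\<integral>\<^sup>+\<theta>. (SUP i. L i \<theta>) \<partial>angle_measure)"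
  proof (intro nn_integral_mono_AE AE_angle)
    fix \<theta> :: real assume "\<theta> \<in> {0..<2*pi}"
    show "e2ennreal (- (ereal (P \<theta>) * ext_log (w \<theta>))) \<le> (SUP i. L i \<theta>)"
    proof (cases "w \<theta> > 0")
      case True
      obtain i where "1 / w \<theta> < real i" using reals_Archimedean2 by blast
      then have "1 / w \<theta> < real (i + 2)" by simp
      then have "\<epsilon> i < w \<theta>" using True by (simp add: \<epsilon>_def field_simps)
      have "e2ennreal (- (ereal (P \<theta>) * ext_log (w \<theta>))) = ennreal (P \<theta> * - ln (w \<theta>))"
        using True by (simp add: e2ennreal_neg_log P_nonneg)
      also have "\<dots> \<le> L i \<theta>"
      proof -
        have "max (\<epsilon> i) (min 1 (w \<theta>)) \<le> w \<theta>" using \<open>\<epsilon> i < w \<theta>\<close> by auto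
        then have "ln (max (\<epsilon> i) (min 1 (w \<theta>))) \<le> ln (w \<theta>)"
          using \<epsilon>[of i] by (intro ln_mono) (auto simp: less_max_iff_disj)
        then show ?thesis unfolding L_def using P_nonneg[of \<theta>] by (intro ennreal_leI mult_left_mono) auto
      qed
      also have "\<dots> \<le> (SUP i. L i \<theta>)" by (rule SUP_upper) simp
      finally show ?thesis .
    next
      case False
      show ?thesis
      proof (cases "P \<theta> = 0")
        case True
        then show ?thesis using False by (simp add: e2ennreal_neg_log)
      next
        case P0: False
        then have "P \<theta> > 0" using P_nonneg[of \<theta>] by simp
        have "(SUP i. L i \<theta>) = \<top>"
        proof (rule ennreal_SUP_eq_top)
          fix m :: nat
          \<comment> \<open>For w not positive, \<open>L i \<theta>\<close> is P ln (i + 2), which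
            exceeds m once i > exp (m / P); the supremum is then infinite, as the integrand
            is.\<close>
          obtain i where i: "exp (real m / P \<theta>) < real i" using reals_Archimedean2 by blast
          have "max (\<epsilon> i) (min 1 (w \<theta>)) = \<epsilon> i" using False \<epsilon>[of i] by auto
          moreover have "- ln (\<epsilon> i) = ln (real (i + 2))" by (simp add: \<epsilon>_def ln_div)
          moreover have "real m / P \<theta> \<le> ln (real (i + 2))"
            using i by (subst ln_ge_iff) auto
          then have "real m \<le> P \<theta> * ln (real (i + 2))"
            using \<open>P \<theta> > 0\<close> by (simp add: field_simps)
          ultimately have "of_nat m \<le> L i \<theta>" unfolding L_def by (simp add: ennreal_leI flip: ennreal_of_nat_eq_real_of_nat)
          then show "\<exists>i\<in>UNIV. of_nat m \<le> L i \<theta>" by blast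
        qed
        then show ?thesis by (simp only: top_greatest)
      qed
    qed
  qed
  also have "\<dots> = (SUP i. \<integral>\<^sup>+\<theta>. L i \<theta> \<partial>angle_measure)"
    using \<open>incseq L\<close> P_borel w_borel
    by (intro nn_integral_monotone_convergence_SUP) (auto simp: L_def[abs_def] uniform_measure_def)
  also have "\<dots> \<le> ennreal (K + 3 * C)"
    unfolding L_def by (intro SUP_least clamp_bound[OF K \<epsilon> C])
  finally show ?thesis by (simp add: le_less_trans)
qed

end

end

text \<open>The weight (l^2 - 1) / 2 is 2 j (j + 1) at l = 2 j + 1 and (2 j - 1) (2 j + 1) / 2 at l
  = 2 j. For even n the odd indices are numbered 2 j - 1, so that the last one is n - 1.\<close>

lemma odd_even_condition:
  fixes a :: "nat \<Rightarrow> real"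
  assumes "odd n \<longrightarrow> a 0 / 2 =
           2 * (\<Sum>l=0..n div 2. real l * (real l + 1) * a (2*l+1))
           + 1/2 * (\<Sum>l=1..n div 2. (2 * real l - 1) * (2 * real l + 1) * a (2*l))"
    and "even n \<longrightarrow> a 0 / 2 =
           2 * (\<Sum>l=1..n div 2. real l * (real l - 1) * a (2*l-1))
           + 1/2 * (\<Sum>l=1..n div 2. (2 * real l - 1) * (2 * real l + 1) * a (2*l))"
  shows "a 0 / 2 = (\<Sum>l=1..n. ((real l)\<^sup>2 - 1) / 2 * a l)"
proof (cases "odd n")
  case True
  then obtain m where m: "n = 2 * m + 1" by (rule oddE)
  have "(\<Sum>l=1..2*m+1. ((real l)\<^sup>2 - 1) / 2 * a l) = 2 * (\<Sum>l=0..m. real l * (real l + 1) * a (2*l+1))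
           + 1/2 * (\<Sum>l=1..m. (2 * real l - 1) * (2 * real l + 1) * a (2*l))"
    by (induction m) (simp_all add: field_simps power2_eq_square)
  then show ?thesis using assms(1) True m by simp
next
  case False
  then obtain m where m: "n = 2 * m" by (auto elim: evenE)
  have "(\<Sum>l=1..2*m. ((real l)\<^sup>2 - 1) / 2 * a l) = 2 * (\<Sum>l=1..m. real l * (real l - 1) * a (2*l-1))
           + 1/2 * (\<Sum>l=1..m. (2 * real l - 1) * (2 * real l + 1) * a (2*l))"
    by (induction m) (simp_all add: field_simps power2_eq_square)
  then show ?thesis using assms(2) False m by simp
qed

theorem theorem5p9:
  fixes \<mu> \<mu>s :: "complex measure" and w :: "real \<Rightarrow> real"
    and \<Phi> :: "nat \<Rightarrow> complex poly" and \<alpha> :: "nat \<Rightarrow> complex"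
    and n :: nat and a b :: "nat \<Rightarrow> real"
  assumes "prob_on_circle \<mu>" and "infinite (msupport \<mu>)"
    and "lebesgue_decomposition \<mu> w \<mu>s"
    and "monic_orthogonal_polynomials \<mu> \<Phi>"
    and "\<alpha> = verblunsky \<Phi>"
    and "cos_poly n a 0 = 0"
    and "\<forall>\<theta>\<in>{0..<2*pi}. cos_poly n a \<theta> \<ge> 0"
    and "odd n \<longrightarrow> a 0 / 2 =
           2 * (\<Sum>l=0..n div 2. real l * (real l + 1) * a (2*l+1))
           + 1/2 * (\<Sum>l=1..n div 2. (2 * real l - 1) * (2 * real l + 1) * a (2*l))"
    and "even n \<longrightarrow> a 0 / 2 =
           2 * (\<Sum>l=1..n div 2. real l * (real l - 1) * a (2*l-1))
           + 1/2 * (\<Sum>l=1..n div 2. (2 * real l - 1) * (2 * real l + 1) * a (2*l))"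
    and "\<forall>\<theta>::real. (cmod (\<Sum>l\<le>n. of_real (b l) * cis \<theta> ^ l))\<^sup>2 = cos_poly n a \<theta>"
    and "in_lp 6 \<alpha>"
    and "in_lp 3 (\<lambda>k. left_shift \<alpha> k - \<alpha> k)"
  shows "ext_integral angle_measure (\<lambda>\<theta>. ereal (cos_poly n a \<theta>) * ext_log (w \<theta>)) > -\<infinity>
         \<longleftrightarrow> in_lp 2 (shift_poly n b \<alpha>)"
proof -
  interpret decomposed_circle_opuc \<mu> \<Phi> w \<mu>s
    using assms by unfold_locales
  \<comment> \<open>Q as a polynomial, which exhibits P as the squared modulus that the entropy
    bounds on the circle require.\<close>
  define q :: "complex poly" where "q = (\<Sum>l\<le>n. monom (of_real (b l)) l)"
  have P: "cos_poly n a \<theta> = (norm (poly q (cis \<theta>)))\<^sup>2" for \<theta>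
    using assms(10) by (simp add: q_def poly_sum poly_monom)
  have "in_lp 2 (shift_poly n b \<alpha>) \<longleftrightarrow> (\<exists>K. \<forall>N. entropy (cos_poly n a) N \<le> K)"
    unfolding entropy_def[OF P] assms(5)
    using assms(11,12) odd_even_condition[OF assms(8,9)] assms(10)
    by (intro entropy_equiv) (auto simp: assms(5) in_lp_def left_shift_def)
  also have "\<dots> \<longleftrightarrow> (\<integral>\<^sup>+\<theta>. e2ennreal (- (ereal (cos_poly n a \<theta>) * ext_log (w \<theta>))) \<partial>angle_measure) < \<infinity>"
    using entropy_bounded_if[OF P] finite_if_entropy_bounded[OF P] by blast
  also have "\<dots> \<longleftrightarrow> ext_integral angle_measure (\<lambda>\<theta>. ereal (cos_poly n a \<theta>) * ext_log (w \<theta>)) > -\<infinity>"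
    by (rule ext_integral_finite_iff[OF P, symmetric])
  finally show ?thesis by blast
qed

end
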